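(* There exists a family of centrally symmetric PL $i$-spheres $S_0\subset S_1\subset S_2\subset\cdots$ (with the involution of each $S_{i+1}$ restricting to that of $S_i$) such that each $S_i$ satisfies Property $\mathrm{P}_i$ with respect to some $(B_i,D_i,v_i)$ with $\partial B_i=S_{i-1}$, and each $S_i$ has no induced centrally symmetric $4$-cycle. Furthermore $f_0(S_{i+1})=f_0(S_i)+f_0(S_{i-1})+4$ for all $i\geq 1$.
   Context: A simplicial complex is centrally symmetric (cs) if its vertex set carries a free involution $\sigma$ mapping faces to faces and inducing a free involution on non-empty faces. An induced cs $4$-cycle is an induced subcomplex $C$ (containing every face whose vertices lie in $C$) isomorphic to a $4$-cycle with $\sigma(C)=C$. $f_0$ is the number of vertices. $\mathrm{st}_\Delta(F)=\{G\in\Delta:G\cup F\in\Delta\}$; $\Delta\setminus\Gamma$ is the induced subcomplex on $V(\Delta)\setminus V(\Gamma)$. PL balls/spheres: complexes PL homeomorphic to a simplex/boundary of a simplex. Property $\mathrm{P}_k$: a cs PL $k$-sphere $S$ with free involution $\sigma$ satisfies $\mathrm{P}_k$ if there are subcomplexes $S_0\subset\cdots\subset S_k=S$, each $S_i$ a PL $i$-sphere invariant under $\sigma$, and for each $1\leq i\leq k$ PL $i$-balls $B_i,D_i\subseteq S_i$ and a vertex $v_i\in D_i$ with: (i) $S_i=B_i\cup\sigma(B_i)$, $B_i\cap\sigma(B_i)=\partial B_i=S_{i-1}$; (ii) $S_i\setminus S_{i-1}$ is the union of $D_i$ and $\sigma(D_i)$ on disjoint vertex sets; (iii) $V(\mathrm{st}_{S_i}(v_i))\cup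 V(\mathrm{st}_{S_i}(\sigma(v_i)))=V(S_i)$; for $i=0$, $D_0=\{v_0\}$ for a vertex $v_0$ of the $0$-sphere $S_0$. *)

theory Defs
  imports "HOL-Analysis.Analysis" "HOL-Analysis.Finite_Function_Topology"
begin

section \<open>Abstract simplicial complexes\<close>

text \<open>The empty face always belongs to a complex.\<close>

definition abstract_complex :: "'a set set \<Rightarrow> bool" where
  "abstract_complex K \<longleftrightarrow>
     finite K \<and> {} \<in> K \<and> (\<forall>F\<in>K. finite F) \<and> (\<forall>F\<in>K. \<forall>G. G \<subseteq> F \<longrightarrow> G \<in> K)"

definition verts :: "'a set set \<Rightarrow> 'a set" where
  "verts K = \<Union>K"

definition f0 :: "'a set set \<Rightarrow> nat" where
  "f0 K = card (verts K)"

definition induced :: "'a set set \<Rightarrow> 'a set \<Rightarrow> 'a set set" where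
  "induced K W = {F \<in> K. F \<subseteq> W}"

definition star :: "'a set set \<Rightarrow> 'a set \<Rightarrow> 'a set set" where
  "star K F = {G \<in> K. G \<union> F \<in> K}"

text \<open>The complex \<open>K \ L\<close> in the sense of deleting all vertices of \<open>L\<close>,
  as opposed to the set difference \<open>K - L\<close> of the sets of faces.\<close>

definition delete :: "'a set set \<Rightarrow> 'a set set \<Rightarrow> 'a set set" where
  "delete K L = induced K (verts K - verts L)"

definition map_complex :: "('a \<Rightarrow> 'b) \<Rightarrow> 'a set set \<Rightarrow> 'b set set" where
  "map_complex \<phi> K = (\<lambda>F. \<phi> ` F) ` K"

definition isomorphic_complexes :: "'a set set \<Rightarrow> 'b set set \<Rightarrow> bool" where
  "isomorphic_complexes K L \<longleftrightarrow>
     (\<exists>\<phi>. bij_betw \<phi> (verts K) (verts L) \<and> map_complex \<phi> K = L)"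

text \<open>For a \<open>d\<close>-dimensional ball \<open>B\<close>, the complex generated by the \<open>(d-1)\<close>-faces that lie in exactly
  one \<open>d\<close>-face; a \<open>j\<close>-face has \<open>j+1\<close> vertices.\<close>

definition boundary :: "nat \<Rightarrow> 'a set set \<Rightarrow> 'a set set" where
  "boundary d B =
     {F. \<exists>G\<in>B. F \<subseteq> G \<and> card G = d \<and> card {H \<in> B. G \<subseteq> H \<and> card H = d + 1} = 1}"

section \<open>PL balls and PL spheres\<close>

text \<open>Points are given by barycentric coordinates: the vertex \<open>v\<close> is the unit vector at \<open>v\<close> in the
  normed space of finitely supported functions \<open>'a \<Rightarrow>\<^sub>0 real\<close>.\<close>

definition realization :: "'a set set \<Rightarrow> ('a \<Rightarrow>\<^sub>0 real) set" where
  "realization K = (\<Union>F\<in>K. convex hull ((\<lambda>v. Poly_Mapping.single v 1) ` F))"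

definition affine_map_on :: "'a::real_vector set \<Rightarrow> ('a \<Rightarrow> 'b::real_vector) \<Rightarrow> bool" where
  "affine_map_on P f \<longleftrightarrow>
     (\<forall>x\<in>P. \<forall>y\<in>P. \<forall>t\<in>{0..1}. f ((1 - t) *\<^sub>R x + t *\<^sub>R y) = (1 - t) *\<^sub>R f x + t *\<^sub>R f y)"

definition pl_map_on :: "'a::real_normed_vector set \<Rightarrow> ('a \<Rightarrow> 'b::real_normed_vector) \<Rightarrow> bool" where
  "pl_map_on X f \<longleftrightarrow> continuous_on X f \<and>
     (\<exists>\<P>. finite \<P> \<and> \<Union>\<P> = X \<and> (\<forall>P\<in>\<P>. polytope P \<and> affine_map_on P f))"

definition pl_homeomorphic :: "'a set set \<Rightarrow> 'b set set \<Rightarrow> bool" where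
  "pl_homeomorphic K L \<longleftrightarrow>
     (\<exists>f g. homeomorphism (realization K) (realization L) f g \<and>
        pl_map_on (realization K) f \<and> pl_map_on (realization L) g)"

definition simplex_complex :: "nat \<Rightarrow> nat set set" where
  "simplex_complex d = Pow {..d}"

definition simplex_boundary :: "nat \<Rightarrow> nat set set" where
  "simplex_boundary d = Pow {..d} - {{..d}}"

definition pl_ball :: "nat \<Rightarrow> 'a set set \<Rightarrow> bool" where
  "pl_ball d K \<longleftrightarrow> abstract_complex K \<and> pl_homeomorphic K (simplex_complex d)"

definition pl_sphere :: "nat \<Rightarrow> 'a set set \<Rightarrow> bool" where
  "pl_sphere d K \<longleftrightarrow> abstract_complex K \<and> pl_homeomorphic K (simplex_boundary (d + 1))"

section \<open>Central symmetry\<close>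

text \<open>Only the values of \<open>\<sigma>\<close> on the vertices of \<open>K\<close> matter.\<close>

definition centrally_symmetric :: "'a set set \<Rightarrow> ('a \<Rightarrow> 'a) \<Rightarrow> bool" where
  "centrally_symmetric K \<sigma> \<longleftrightarrow> abstract_complex K \<and>
     (\<forall>v\<in>verts K. \<sigma> v \<in> verts K \<and> \<sigma> (\<sigma> v) = v \<and> \<sigma> v \<noteq> v) \<and>
     (\<forall>F\<in>K. \<sigma> ` F \<in> K) \<and>
     (\<forall>F\<in>K. F \<noteq> {} \<longrightarrow> \<sigma> ` F \<noteq> F)"

definition four_cycle :: "nat set set" where
  "four_cycle = {{}, {0}, {1}, {2}, {3}, {0,1}, {1,2}, {2,3}, {3,0}}"

definition has_induced_cs_4_cycle :: "'a set set \<Rightarrow> ('a \<Rightarrow> 'a) \<Rightarrow> bool" where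
  "has_induced_cs_4_cycle K \<sigma> \<longleftrightarrow>
     (\<exists>W \<subseteq> verts K. isomorphic_complexes (induced K W) four_cycle \<and>
        map_complex \<sigma> (induced K W) = induced K W)"

text \<open>\<open>property_P k S \<sigma> T B D v\<close>: the centrally symmetric PL \<open>k\<close>-sphere \<open>S\<close> with involution \<open>\<sigma>\<close>
  satisfies \<open>P\<^sub>k\<close> with respect to the chain \<open>T 0 \<subset> \<dots> \<subset> T k = S\<close> and the data \<open>(B i, D i, v i)\<close>.
  Values at indices above \<open>k\<close>, and the ball \<open>B 0\<close>, are irrelevant.\<close>

definition property_P ::
  "nat \<Rightarrow> 'a set set \<Rightarrow> ('a \<Rightarrow> 'a) \<Rightarrow>
   (nat \<Rightarrow> 'a set set) \<Rightarrow> (nat \<Rightarrow> 'a set set) \<Rightarrow> (nat \<Rightarrow> 'a set set) \<Rightarrow> (nat \<Rightarrow> 'a) \<Rightarrow> bool" where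
  "property_P k S \<sigma> T B D v \<longleftrightarrow>
     pl_sphere k S \<and> centrally_symmetric S \<sigma> \<and>
     T k = S \<and> (\<forall>i<k. T i \<subset> T (Suc i)) \<and>
     (\<forall>i\<le>k. pl_sphere i (T i) \<and> map_complex \<sigma> (T i) = T i) \<and>
     v 0 \<in> verts (T 0) \<and> D 0 = {{}, {v 0}} \<and>
     (\<forall>i\<in>{1..k}.
        pl_ball i (B i) \<and> B i \<subseteq> T i \<and>
        pl_ball i (D i) \<and> D i \<subseteq> T i \<and> v i \<in> verts (D i) \<and>
        T i = B i \<union> map_complex \<sigma> (B i) \<and>
        B i \<inter> map_complex \<sigma> (B i) = boundary i (B i) \<and>
        boundary i (B i) = T (i - 1) \<and>
        delete (T i) (T (i - 1)) = D i \<union> map_complex \<sigma> (D i) \<and>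
        verts (D i) \<inter> verts (map_complex \<sigma> (D i)) = {} \<and>
        verts (star (T i) {v i}) \<union> verts (star (T i) {\<sigma> (v i)}) = verts (T i))"

end

theory Submission
  imports Defs
begin

text \<open>
  Given \<open>S\<^sub>i = B \<union> \<sigma>(B)\<close> with \<open>B \<inter> \<sigma>(B) = S\<^sub>i\<^sub>-\<^sub>1\<close>, split the vertices into a positive and a negative half.
  In the cone \<open>v * S\<^sub>i\<close>, subdivide successively the edges from \<open>v\<close> to the negative vertices of \<open>S\<^sub>i\<^sub>-\<^sub>1\<close>;
  this replaces the link of \<open>v\<close> by a copy of \<open>S\<^sub>i\<close> in which these vertices have become new ones. Then split
  the apex into an edge \<open>{v, w}\<close>, with \<open>v\<close> seeing the copy of \<open>B\<close>, \<open>w\<close> seeing the copy of \<open>\<sigma>(B)\<close> and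
  both seeing the copy of \<open>S\<^sub>i\<^sub>-\<^sub>1\<close>. The result is \<open>B\<^sub>i\<^sub>+\<^sub>1\<close>: no new vertex is adjacent to two
  antipodal vertices, and the new vertices are \<open>v\<close>, \<open>w\<close> and one for each antipodal pair of \<open>S\<^sub>i\<^sub>-\<^sub>1\<close>.

  All PL homeomorphisms are generated by subdividing edges, taking cones and gluing. The invariant
  is that \<open>B\<^sub>i\<close> is PL homeomorphic to the cone over \<open>S\<^sub>i\<^sub>-\<^sub>1\<close> relative to \<open>S\<^sub>i\<^sub>-\<^sub>1\<close>.
\<close>

section \<open>Affine maps and polytopes\<close>

text \<open>A plain cone over S_i fails because its apex would see antipodal pairs. Replacing the
  negative vertices of S_{i-1} cures this over \<open>B\<close>, whose other vertices are all
  positive. Over the mirror image of \<open>B\<close>, however, negative vertices outside S_{i-1}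
  survive, and this forces the second apex \<open>w\<close>. Property P also asks that
  \<open>v\<close> see every positive vertex and that the faces on new positive vertices form a ball
  D_{i+1}. These faces are the edge \<open>{v, w}\<close> joined with a copy of the negative faces
  of S_{i-1}, which mirror its positive faces. So a second statement accompanies the induction: the
  positive faces of B_i form an i-ball, being a cone over a sphere. The invariant is relative to
  S_{i-1} so that it can be glued: two halves fixed on their common boundary make S_i a suspension
  of S_{i-1}, and one cone can be exchanged for another without disturbing the rest. The
  combinatorial boundary of B_i is tracked separately by counting facets over ridges, since reading
  it off a homeomorphism would need the invariance of the boundary.\<close>

lemma affine_map_on_subset:
  "affine_map_on P f \<Longrightarrow> Q \<subseteq> P \<Longrightarrow> affine_map_on Q f"
  by (auto simp: affine_map_on_def)

lemma affine_map_on_cong: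
  assumes "affine_map_on P f" "convex P" "\<And>x. x \<in> P \<Longrightarrow> g x = f x"
  shows "affine_map_on P g"
  using assms unfolding affine_map_on_def convex_alt by simp

lemma linear_imp_affine_map_on: "linear f \<Longrightarrow> affine_map_on P f"
  by (simp add: affine_map_on_def linear_add linear_cmul)

lemma affine_map_on_convex_image:
  assumes "affine_map_on P f" "convex C" "C \<subseteq> P"
  shows "convex (f ` C)"
  unfolding convex_alt
proof (intro ballI allI impI)
  fix x y and t :: real
  assume "x \<in> f ` C" "y \<in> f ` C" and t: "0 \<le> t \<and> t \<le> 1"
  then obtain x' y' where xy: "x' \<in> C" "y' \<in> C" "x = f x'" "y = f y'" by auto
  then have "(1 - t) *\<^sub>R x + t *\<^sub>R y = f ((1 - t) *\<^sub>R x' + t *\<^sub>R y')"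
    using assms t unfolding affine_map_on_def by (metis atLeastAtMost_iff subsetD)
  moreover have "(1 - t) *\<^sub>R x' + t *\<^sub>R y' \<in> C"
    using assms(2) xy t unfolding convex_alt by blast
  ultimately show "(1 - t) *\<^sub>R x + t *\<^sub>R y \<in> f ` C" by blast
qed

lemma affine_map_on_convex_hull_image:
  assumes "affine_map_on (convex hull A) f"
  shows "f ` (convex hull A) = convex hull (f ` A)"
proof
  have "convex (f ` (convex hull A))"
    using affine_map_on_convex_image[OF assms convex_convex_hull] by simp
  then show "convex hull (f ` A) \<subseteq> f ` (convex hull A)"
    by (intro hull_minimal image_mono hull_subset)
  let ?C = "{x \<in> convex hull A. f x \<in> convex hull (f ` A)}"
  have "convex ?C"
  proof (rule convexI)
    fix x y and s t :: real
    assume xy: "x \<in> ?C" "y \<in> ?C" and "0 \<le> s" "0 \<le> t" "s + t = 1"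
    then have s: "s = 1 - t" and t: "0 \<le> t \<and> t \<le> 1" by auto
    have "(1 - t) *\<^sub>R x + t *\<^sub>R y \<in> convex hull A"
      using xy t convex_convex_hull[of A] unfolding convex_alt by blast
    moreover have "(1 - t) *\<^sub>R f x + t *\<^sub>R f y \<in> convex hull (f ` A)"
      using xy t convex_convex_hull[of "f ` A"] unfolding convex_alt by blast
    ultimately show "s *\<^sub>R x + t *\<^sub>R y \<in> ?C"
      using assms xy t unfolding s affine_map_on_def by simp
  qed
  moreover have "A \<subseteq> ?C" by (auto intro: hull_inc)
  ultimately have "convex hull A \<subseteq> ?C" by (rule hull_minimal[rotated])
  then show "f ` (convex hull A) \<subseteq> convex hull (f ` A)" by auto
qed

lemma polytope_affine_image:
  assumes "polytope P" "affine_map_on P f"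
  shows "polytope (f ` P)"
  using assms unfolding polytope_def
  by (metis affine_map_on_convex_hull_image finite_imageI)

lemma polytope_convex: "polytope P \<Longrightarrow> convex P"
  unfolding polytope_def using convex_convex_hull by blast

lemma polytope_compact:
  fixes P :: "'a::real_normed_vector set"
  shows "polytope P \<Longrightarrow> compact P"
  unfolding polytope_def using finite_imp_compact_convex_hull by blast

lemma affine_map_on_inverse:
  assumes "affine_map_on P f" "convex P" "\<And>x. x \<in> P \<Longrightarrow> g (f x) = x"
  shows "affine_map_on (f ` P) g"
  unfolding affine_map_on_def
proof (intro ballI)
  fix x y and t :: real
  assume "x \<in> f ` P" "y \<in> f ` P" and t: "t \<in> {0..1}"
  then obtain x' y' where xy: "x' \<in> P" "y' \<in> P" "x = f x'" "y = f y'" by auto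
  have "(1 - t) *\<^sub>R x' + t *\<^sub>R y' \<in> P"
    using assms(2) xy t unfolding convex_alt by simp
  then show "g ((1 - t) *\<^sub>R x + t *\<^sub>R y) = (1 - t) *\<^sub>R g x + t *\<^sub>R g y"
    using assms(1,3) xy t unfolding affine_map_on_def by metis
qed

text \<open>The graph is a polytope, hence compact, so the projection of the graph onto \<open>P\<close> is a
  homeomorphism; this works in infinite-dimensional spaces too.\<close>

lemma affine_map_on_polytope_continuous:
  fixes f :: "'a::real_normed_vector \<Rightarrow> 'b::real_normed_vector"
  assumes "polytope P" "affine_map_on P f"
  shows "continuous_on P f"
proof -
  let ?G = "(\<lambda>x. (x, f x)) ` P"
  have "affine_map_on P (\<lambda>x. (x, f x))"
    using assms(2) by (simp add: affine_map_on_def)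
  then have "compact ?G"
    using assms(1) polytope_affine_image polytope_compact by blast
  then have "continuous_on (fst ` ?G) (\<lambda>x. (x, f x))"
    by (intro continuous_on_inv[where f = fst]) (auto intro: continuous_intros)
  moreover have "fst ` ?G = P" by force
  ultimately have "continuous_on P (snd \<circ> (\<lambda>x. (x, f x)))"
    by (intro continuous_on_compose) (auto intro: continuous_intros)
  then show ?thesis by (simp add: o_def)
qed

text \<open>The section is spanned by the generators lying on the hyperplane and by the points where
  segments between generators of opposite sign cross it. Working with generators alone keeps the
  argument valid in infinite-dimensional spaces.\<close>

lemma polytope_Int_hyperplane:
  fixes l :: "'a::real_vector \<Rightarrow> real"
  assumes "polytope P" "linear l"
  shows "polytope (P \<inter> {x. l x = 0})"
proof -
  obtain A where A: "finite A" "P = convex hull A"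
    using assms(1) unfolding polytope_def by blast
  interpret linear l by fact
  define Z where "Z = {a \<in> A. l a = 0}"
  define A1 where "A1 = {a \<in> A. l a > 0}"
  define A2 where "A2 = {a \<in> A. l a < 0}"
  define cr where "cr = (\<lambda>(a, b). (- l b / (l a - l b)) *\<^sub>R a + (l a / (l a - l b)) *\<^sub>R b)"
  define V where "V = Z \<union> cr ` (A1 \<times> A2)"
  have finV: "finite V" using A(1) by (simp add: V_def Z_def A1_def A2_def)
  have cr: "cr (a, b) \<in> P \<and> l (cr (a, b)) = 0" if ab: "a \<in> A1" "b \<in> A2" for a b
  proof
    have pos: "l a - l b > 0" using ab by (simp add: A1_def A2_def)
    show "cr (a, b) \<in> P"
    proof -
      have "- l b / (l a - l b) + l a / (l a - l b) = 1"
        using add_divide_distrib[of "- l b" "l a" "l a - l b"] pos by simp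
      moreover have "- l b / (l a - l b) \<ge> 0" "l a / (l a - l b) \<ge> 0"
        using ab pos by (auto simp: A1_def A2_def divide_nonpos_pos)
      moreover have "a \<in> P" "b \<in> P" using ab A(2) by (auto simp: A1_def A2_def hull_inc)
      ultimately show ?thesis
        unfolding cr_def prod.case A(2) by (intro convexD[OF convex_convex_hull])
    qed
    show "l (cr (a, b)) = 0" using pos by (simp add: cr_def add diff scale)
  qed
  have "convex hull V \<subseteq> P \<inter> {x. l x = 0}"
  proof (rule hull_minimal)
    show "V \<subseteq> P \<inter> {x. l x = 0}"
      using cr A(2) by (auto simp: V_def Z_def hull_inc)
    have "convex {x. l x = 0}" by (auto simp: convex_alt add scale)
    then show "convex (P \<inter> {x. l x = 0})"
      using A(2) by (intro convex_Int) simp_all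
  qed
  moreover have "P \<inter> {x. l x = 0} \<subseteq> convex hull V"
  proof
    fix x assume "x \<in> P \<inter> {x. l x = 0}"
    then have xP: "x \<in> convex hull A" and lx: "l x = 0" using A(2) by auto
    obtain u where u: "\<And>a. a \<in> A \<Longrightarrow> 0 \<le> u a" "sum u A = 1" "x = (\<Sum>a\<in>A. u a *\<^sub>R a)"
      using xP A(1) by (auto simp: convex_hull_finite)
    have AU: "A = Z \<union> (A1 \<union> A2)" by (auto simp: Z_def A1_def A2_def)
    have fin: "finite Z" "finite A1" "finite A2" using A(1) by (auto simp: Z_def A1_def A2_def)
    have dis: "Z \<inter> (A1 \<union> A2) = {}" "A1 \<inter> A2 = {}" by (auto simp: Z_def A1_def A2_def)
    have split: "sum g A = sum g Z + (sum g A1 + sum g A2)" for g :: "'a \<Rightarrow> 'c::comm_monoid_add"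
      using fin dis by (simp add: AU sum.union_disjoint)
    define p where "p = (\<Sum>a\<in>A1. u a * l a)"
    have p2: "(\<Sum>b\<in>A2. u b * l b) = - p"
    proof -
      have "0 = (\<Sum>a\<in>A. u a * l a)" using lx by (simp add: u(3) sum scale)
      also have "\<dots> = (\<Sum>a\<in>Z. u a * l a) + (p + (\<Sum>b\<in>A2. u b * l b))"
        by (simp add: split p_def)
      also have "(\<Sum>a\<in>Z. u a * l a) = 0" by (simp add: Z_def)
      finally show ?thesis by simp
    qed
    have p0: "p \<ge> 0" unfolding p_def using u(1) by (intro sum_nonneg) (auto simp: A1_def)
    show "x \<in> convex hull V"
    proof (cases "p = 0")
      case True
      have "u a * l a = 0" if "a \<in> A1" for a
        using True that fin u(1) sum_nonneg_eq_0_iff[of A1 "\<lambda>a. u a * l a"]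
        by (auto simp: p_def A1_def)
      then have z1: "u a = 0" if "a \<in> A1" for a using that by (force simp: A1_def)
      have "u a * - l a = 0" if "a \<in> A2" for a
      proof -
        have "(\<Sum>b\<in>A2. u b * - l b) = 0" using p2 True by (simp add: sum_negf)
        then show ?thesis
          using that fin u(1) sum_nonneg_eq_0_iff[of A2 "\<lambda>a. u a * - l a"]
          by (auto simp: A2_def mult_nonneg_nonpos)
      qed
      then have z2: "u a = 0" if "a \<in> A2" for a using that by (force simp: A2_def)
      have "sum u Z = 1" "x = (\<Sum>a\<in>Z. u a *\<^sub>R a)"
        using u(2,3) z1 z2 by (simp_all add: split)
      then have "x \<in> convex hull Z"
        using u(1) fin(1) by (auto simp: convex_hull_finite Z_def)
      then show ?thesis using hull_mono[of Z V] by (auto simp: V_def)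
    next
      case False
      then have pp: "p > 0" using p0 by simp
      \<comment> \<open>A transport plan between the two sides. Since \<open>u\<close> has moment
        \<open>p\<close> on \<open>A1\<close> and \<open>- p\<close> on \<open>A2\<close>, these
        weights make the \<open>a\<close>-parts of the weighted crossing points sum over
        \<open>b\<close> to \<open>u a *\<^sub>R a\<close>, and the \<open>b\<close>-parts sum over
        \<open>a\<close> to \<open>u b *\<^sub>R b\<close>.\<close>
      define c where "c = (\<lambda>(a, b). u a * u b * (l a - l b) / p)"
      have c0: "0 \<le> c ab" if "ab \<in> A1 \<times> A2" for ab
        using that u(1) pp by (auto simp: c_def A1_def A2_def intro!: divide_nonneg_pos mult_nonneg_nonneg)
      have csum: "sum c (A1 \<times> A2) = sum u A1 + sum u A2"
      proof -
        have "sum c (A1 \<times> A2) = (\<Sum>a\<in>A1. \<Sum>b\<in>A2. u a * u b * (l a - l b) / p)"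
          by (simp add: sum.cartesian_product c_def)
        also have "\<dots> = (\<Sum>a\<in>A1. \<Sum>b\<in>A2. (u a * l a) * u b / p - u a * (u b * l b) / p)"
          by (simp add: algebra_simps diff_divide_distrib)
        also have "\<dots> = p * sum u A2 / p - sum u A1 * (- p) / p"
          unfolding sum_subtractf p2[symmetric]
          by (simp add: p_def sum_product flip: sum_divide_distrib)
        finally show ?thesis using pp by simp
      qed
      have cx: "(\<Sum>ab\<in>A1 \<times> A2. c ab *\<^sub>R cr ab) = (\<Sum>a\<in>A1. u a *\<^sub>R a) + (\<Sum>b\<in>A2. u b *\<^sub>R b)"
      proof -
        have "c (a, b) *\<^sub>R cr (a, b) = (u b * - l b / p) *\<^sub>R (u a *\<^sub>R a) + (u a * l a / p) *\<^sub>R (u b *\<^sub>R b)"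
          if "a \<in> A1" "b \<in> A2" for a b
        proof -
          have "l a - l b \<noteq> 0" using that by (auto simp: A1_def A2_def)
          then show ?thesis by (simp add: c_def cr_def scaleR_add_right scaleR_diff_right mult_ac)
        qed
        then have "(\<Sum>ab\<in>A1 \<times> A2. c ab *\<^sub>R cr ab) =
            (\<Sum>a\<in>A1. \<Sum>b\<in>A2. (u b * - l b / p) *\<^sub>R (u a *\<^sub>R a) + (u a * l a / p) *\<^sub>R (u b *\<^sub>R b))"
          by (auto simp: sum.cartesian_product intro!: sum.cong)
        also have "\<dots> = (\<Sum>a\<in>A1. (\<Sum>b\<in>A2. u b * - l b / p) *\<^sub>R (u a *\<^sub>R a)) +
            (\<Sum>b\<in>A2. (\<Sum>a\<in>A1. u a * l a / p) *\<^sub>R (u b *\<^sub>R b))"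
          unfolding sum.distrib
          by (subst (2) sum.swap) (simp only: scaleR_sum_left)
        also have "(\<Sum>b\<in>A2. u b * - l b / p) = 1"
          using p2 pp by (simp add: sum_negf flip: sum_divide_distrib)
        also have "(\<Sum>a\<in>A1. u a * l a / p) = 1"
          using pp by (simp add: p_def flip: sum_divide_distrib)
        finally show ?thesis by simp
      qed
      \<comment> \<open>Indexing by a disjoint sum keeps the weights apart when crossing points
        coincide with one another or with points of \<open>Z\<close>.\<close>
      define U :: "'a + 'a \<times> 'a \<Rightarrow> real" where "U = case_sum u c"
      define W :: "'a + 'a \<times> 'a \<Rightarrow> 'a" where "W = case_sum (\<lambda>a. a) cr"
      let ?I = "Z <+> A1 \<times> A2"
      have "(\<Sum>i\<in>?I. U i *\<^sub>R W i) \<in> convex hull V"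
      proof (rule convex_sum)
        show "finite ?I" using fin by simp
        show "convex (convex hull V)" by (rule convex_convex_hull)
        show "sum U ?I = 1"
          using u(2) csum fin by (simp add: sum.Plus U_def split)
        show "0 \<le> U i" if "i \<in> ?I" for i
          using that u(1) c0 by (auto simp: U_def Z_def)
        show "W i \<in> convex hull V" if "i \<in> ?I" for i
          using that by (auto simp: W_def V_def intro!: hull_inc)
      qed
      moreover have "(\<Sum>i\<in>?I. U i *\<^sub>R W i) = x"
        using fin cx by (simp add: sum.Plus U_def W_def u(3) split)
      ultimately show ?thesis by simp
    qed
  qed
  ultimately show ?thesis using finV unfolding polytope_def by blast
qed

section \<open>Polytopes of finitely supported functions\<close>

lemma lookup_scaleR [simp]: "Poly_Mapping.lookup (r *\<^sub>R x) i = r *\<^sub>R Poly_Mapping.lookup x i"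
proof -
  have "finite {i. r *\<^sub>R Poly_Mapping.lookup x i \<noteq> 0}"
    by (rule finite_subset[of _ "{i. Poly_Mapping.lookup x i \<noteq> 0}"]) auto
  then show ?thesis by (simp add: scaleR_poly_mapping_def)
qed

lemma polytope_finite_support:
  fixes P :: "('a \<Rightarrow>\<^sub>0 real) set"
  assumes "polytope P"
  shows "\<exists>W. finite W \<and> (\<forall>x\<in>P. Poly_Mapping.keys x \<subseteq> W)"
proof -
  obtain A where A: "finite A" "P = convex hull A"
    using assms unfolding polytope_def by blast
  let ?W = "\<Union>(Poly_Mapping.keys ` A)"
  have "P \<subseteq> {x. \<forall>i. i \<notin> ?W \<longrightarrow> Poly_Mapping.lookup x i = 0}"
    unfolding A(2) by (rule hull_minimal) (auto simp: in_keys_iff convex_alt lookup_add)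
  then show ?thesis
    using A(1) by (intro exI[of _ ?W]) (fastforce simp: in_keys_iff)
qed

text \<open>The intersection is the projection of the diagonal part of \<open>P \<times> Q\<close>.
  Both supports are finite, so the diagonal is cut out there by finitely many hyperplanes, one for
  each coordinate.\<close>

lemma polytope_Int_poly_mapping:
  fixes P Q :: "('a \<Rightarrow>\<^sub>0 real) set"
  assumes "polytope P" "polytope Q"
  shows "polytope (P \<inter> Q)"
proof -
  obtain W where W: "finite W" "\<And>x. x \<in> P \<Longrightarrow> Poly_Mapping.keys x \<subseteq> W"
    using polytope_finite_support[OF assms(1)] by blast
  obtain W' where W': "finite W'" "\<And>x. x \<in> Q \<Longrightarrow> Poly_Mapping.keys x \<subseteq> W'"
    using polytope_finite_support[OF assms(2)] by blast
  let ?l = "\<lambda>i z. Poly_Mapping.lookup (fst z) i - Poly_Mapping.lookup (snd z) i"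
  have cut: "polytope (P \<times> Q \<inter> {z. \<forall>i\<in>V. ?l i z = 0})" if "finite V" for V
    using that
  proof (induction V)
    case empty
    then show ?case using assms by (simp add: polytope_Times)
  next
    case (insert j V)
    have "linear (?l j)"
      by (rule linearI) (auto simp: lookup_add algebra_simps)
    from polytope_Int_hyperplane[OF insert.IH this] show ?case
      by (rule back_subst[of polytope]) auto
  qed
  have "polytope (fst ` (P \<times> Q \<inter> {z. \<forall>i\<in>W \<union> W'. ?l i z = 0}))"
    using cut[of "W \<union> W'"] W W' by (intro polytope_linear_image) (auto intro: linear_fst)
  moreover have "fst ` (P \<times> Q \<inter> {z. \<forall>i\<in>W \<union> W'. ?l i z = 0}) = P \<inter> Q"
  proof -
    have "x = y" if "x \<in> P" "y \<in> Q" "\<forall>i\<in>W \<union> W'. Poly_Mapping.lookup x i = Poly_Mapping.lookup y i" for x y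
      using that W(2)[of x] W'(2)[of y]
      by (intro poly_mapping_eqI) (metis UnI1 UnI2 in_keys_iff subsetD)
    then show ?thesis by (force simp: image_iff)
  qed
  ultimately show ?thesis by simp
qed

section \<open>Realizations in barycentric coordinates\<close>

abbreviation bary :: "'a \<Rightarrow> ('a \<Rightarrow>\<^sub>0 real)" where
  "bary v \<equiv> Poly_Mapping.single v 1"

abbreviation coord :: "('a \<Rightarrow>\<^sub>0 real) \<Rightarrow> 'a \<Rightarrow> real" where
  "coord \<equiv> Poly_Mapping.lookup"

definition mass :: "('a \<Rightarrow>\<^sub>0 real) \<Rightarrow> real" where
  "mass x = sum (coord x) (Poly_Mapping.keys x)"

lemma mass_superset: "finite W \<Longrightarrow> Poly_Mapping.keys x \<subseteq> W \<Longrightarrow> mass x = sum (coord x) W"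
  unfolding mass_def by (rule sum.mono_neutral_left) (auto simp: in_keys_iff)

lemma mass_add [simp]: "mass (x + y) = mass x + mass y"
proof -
  let ?W = "Poly_Mapping.keys x \<union> Poly_Mapping.keys y"
  have "mass (x + y) = sum (coord (x + y)) ?W"
    using keys_add[of x y] by (intro mass_superset) auto
  also have "\<dots> = sum (coord x) ?W + sum (coord y) ?W"
    by (simp add: lookup_add sum.distrib)
  finally show ?thesis by (simp add: mass_superset[of ?W])
qed

lemma mass_scaleR [simp]: "mass (c *\<^sub>R x) = c * mass x"
proof -
  have "Poly_Mapping.keys (c *\<^sub>R x) \<subseteq> Poly_Mapping.keys x" by (auto simp: in_keys_iff)
  then have "mass (c *\<^sub>R x) = sum (coord (c *\<^sub>R x)) (Poly_Mapping.keys x)"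
    by (intro mass_superset) auto
  then show ?thesis by (simp add: mass_def sum_distrib_left)
qed

lemma mass_diff [simp]: "mass (x - y) = mass x - mass y"
  using mass_add[of "x - y" y] by simp

lemma mass_single [simp]: "mass (Poly_Mapping.single v c) = c"
  by (simp add: mass_def)

lemma coord_bary: "coord (bary v) w = (if w = v then 1 else 0)"
  by (simp add: lookup_single when_def)

lemmas coord_simps = lookup_add lookup_minus coord_bary

lemma sum_coord_bary:
  assumes "finite F" "Poly_Mapping.keys x \<subseteq> F"
  shows "(\<Sum>v\<in>F. coord x v *\<^sub>R bary v) = x"
proof (rule poly_mapping_eqI)
  fix k
  have "coord (\<Sum>v\<in>F. coord x v *\<^sub>R bary v) k = (\<Sum>v\<in>F. if v = k then coord x v else 0)"
    unfolding lookup_sum by (intro sum.cong) (auto simp: coord_bary)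
  also have "\<dots> = coord x k"
    using assms by (auto simp: sum.delta in_keys_iff)
  finally show "coord (\<Sum>v\<in>F. coord x v *\<^sub>R bary v) k = coord x k" .
qed

lemma convex_hull_bary:
  assumes "finite F"
  shows "convex hull (bary ` F) =
    {x. (\<forall>v. 0 \<le> coord x v) \<and> mass x = 1 \<and> Poly_Mapping.keys x \<subseteq> F}" (is "_ = ?R")
proof
  show "convex hull (bary ` F) \<subseteq> ?R"
  proof (rule hull_minimal)
    show "bary ` F \<subseteq> ?R" by (auto simp: coord_bary)
    show "convex ?R"
    proof (rule convexI)
      fix x y and s t :: real
      assume *: "x \<in> ?R" "y \<in> ?R" "0 \<le> s" "0 \<le> t" "s + t = 1"
      have "Poly_Mapping.keys (s *\<^sub>R x + t *\<^sub>R y) \<subseteq> F"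
      proof
        fix i assume "i \<in> Poly_Mapping.keys (s *\<^sub>R x + t *\<^sub>R y)"
        then have "i \<in> Poly_Mapping.keys x \<or> i \<in> Poly_Mapping.keys y"
          by (auto simp: in_keys_iff lookup_add)
        then show "i \<in> F" using * by auto
      qed
      then show "s *\<^sub>R x + t *\<^sub>R y \<in> ?R" using * by (simp add: lookup_add)
    qed
  qed
  show "?R \<subseteq> convex hull (bary ` F)"
  proof
    fix x assume x: "x \<in> ?R"
    have "(\<Sum>v\<in>F. coord x v *\<^sub>R bary v) \<in> convex hull (bary ` F)"
      using x assms by (intro convex_sum) (auto simp: mass_superset[of F] intro: hull_inc)
    then show "x \<in> convex hull (bary ` F)"
      using x assms by (simp add: sum_coord_bary)
  qed
qed

lemma complex_finite_face: "abstract_complex K \<Longrightarrow> F \<in> K \<Longrightarrow> finite F"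
  by (simp add: abstract_complex_def)

lemma complex_subset: "abstract_complex K \<Longrightarrow> F \<in> K \<Longrightarrow> G \<subseteq> F \<Longrightarrow> G \<in> K"
  unfolding abstract_complex_def by blast

lemma complex_empty: "abstract_complex K \<Longrightarrow> {} \<in> K"
  by (simp add: abstract_complex_def)

lemma complex_finite: "abstract_complex K \<Longrightarrow> finite K"
  by (simp add: abstract_complex_def)

lemma complex_finite_verts: "abstract_complex K \<Longrightarrow> finite (verts K)"
  by (auto simp: abstract_complex_def verts_def)

lemma complex_Un: "abstract_complex K \<Longrightarrow> abstract_complex L \<Longrightarrow> abstract_complex (K \<union> L)"
  by (auto simp: abstract_complex_def)

lemma complex_Int: "abstract_complex K \<Longrightarrow> abstract_complex L \<Longrightarrow> abstract_complex (K \<inter> L)"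
  by (auto simp: abstract_complex_def)

text \<open>A point lies in the hull of \<open>F\<close> iff its support is contained in
  \<open>F\<close>; closure under subfaces turns this into the condition that the support is itself
  a face. Membership thus becomes a combinatorial question about supports.\<close>

lemma realization_iff:
  assumes "abstract_complex K"
  shows "x \<in> realization K \<longleftrightarrow>
    (\<forall>v. 0 \<le> coord x v) \<and> mass x = 1 \<and> Poly_Mapping.keys x \<in> K"
proof -
  have "x \<in> realization K \<longleftrightarrow> (\<exists>F\<in>K. x \<in> convex hull (bary ` F))"
    by (simp add: realization_def)
  also have "\<dots> \<longleftrightarrow> (\<exists>F\<in>K. (\<forall>v. 0 \<le> coord x v) \<and> mass x = 1 \<and> Poly_Mapping.keys x \<subseteq> F)"
    using complex_finite_face[OF assms] by (intro bex_cong) (auto simp: convex_hull_bary)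
  also have "\<dots> \<longleftrightarrow> (\<forall>v. 0 \<le> coord x v) \<and> mass x = 1 \<and> Poly_Mapping.keys x \<in> K"
    using complex_subset[OF assms] by blast
  finally show ?thesis .
qed

lemma realization_mono: "K \<subseteq> L \<Longrightarrow> realization K \<subseteq> realization L"
  by (auto simp: realization_def)

lemma realization_Un: "realization (K \<union> L) = realization K \<union> realization L"
  by (auto simp: realization_def)

lemma realization_Int:
  "abstract_complex K \<Longrightarrow> abstract_complex L \<Longrightarrow>
    realization (K \<inter> L) = realization K \<inter> realization L"
  by (auto simp: realization_iff complex_Int)

lemma coord_outside_verts:
  "abstract_complex K \<Longrightarrow> x \<in> realization K \<Longrightarrow> v \<notin> verts K \<Longrightarrow> coord x v = 0"
  by (auto simp: realization_iff verts_def in_keys_iff)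

section \<open>PL homeomorphisms of complexes\<close>

text \<open>Continuity of the map and of its inverse is automatic, so it is not part of the definition.\<close>

definition pl_homeo :: "'a set set \<Rightarrow> 'b set set \<Rightarrow> (('a \<Rightarrow>\<^sub>0 real) \<Rightarrow> ('b \<Rightarrow>\<^sub>0 real)) \<Rightarrow> bool" where
  "pl_homeo K L f \<longleftrightarrow> bij_betw f (realization K) (realization L) \<and>
     (\<exists>\<P>. finite \<P> \<and> \<Union>\<P> = realization K \<and> (\<forall>P\<in>\<P>. polytope P \<and> affine_map_on P f))"

lemma pl_homeo_inv_into:
  assumes "pl_homeo K L f"
  shows "pl_homeo L K (inv_into (realization K) f)"
proof -
  obtain \<P> where bij: "bij_betw f (realization K) (realization L)" and
    P: "finite \<P>" "\<Union>\<P> = realization K" "\<And>P. P \<in> \<P> \<Longrightarrow> polytope P \<and> affine_map_on P f"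
    using assms unfolding pl_homeo_def by blast
  let ?g = "inv_into (realization K) f"
  have "\<Union>((`) f ` \<P>) = realization L"
    using image_Union[of f \<P>] bij by (simp add: P(2) bij_betw_imp_surj_on)
  moreover have "polytope (f ` P) \<and> affine_map_on (f ` P) ?g" if "P \<in> \<P>" for P
  proof
    show "polytope (f ` P)" using P(3)[OF that] polytope_affine_image by blast
    have "?g (f x) = x" if "x \<in> P" for x
      using bij P(2) that \<open>P \<in> \<P>\<close> by (intro bij_betw_inv_into_left) auto
    then show "affine_map_on (f ` P) ?g"
      using P(3)[OF that] polytope_convex by (intro affine_map_on_inverse) auto
  qed
  ultimately show ?thesis
    unfolding pl_homeo_def using bij_betw_inv_into[OF bij] P(1)
    by (intro conjI exI[of _ "(`) f ` \<P>"]) auto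
qed

lemma pl_homeo_imp_pl_map_on:
  assumes "pl_homeo K L f"
  shows "pl_map_on (realization K) f"
proof -
  obtain \<P> where P: "finite \<P>" "\<Union>\<P> = realization K" "\<And>P. P \<in> \<P> \<Longrightarrow> polytope P \<and> affine_map_on P f"
    using assms unfolding pl_homeo_def by blast
  have "closed P \<and> continuous_on P f" if "P \<in> \<P>" for P
    using P(3)[OF that]
    by (simp add: compact_imp_closed polytope_compact affine_map_on_polytope_continuous)
  then have "continuous_on (\<Union>P\<in>\<P>. P) f"
    using P(1) by (intro continuous_on_closed_Union) auto
  then show ?thesis unfolding pl_map_on_def using P by auto
qed

lemma pl_homeo_imp_pl_homeomorphic:
  assumes "pl_homeo K L f"
  shows "pl_homeomorphic K L"
proof -
  let ?g = "inv_into (realization K) f"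
  have maps: "pl_map_on (realization K) f" "pl_map_on (realization L) ?g"
    using assms pl_homeo_inv_into pl_homeo_imp_pl_map_on by blast+
  have bij: "bij_betw f (realization K) (realization L)"
    using assms by (simp add: pl_homeo_def)
  have "homeomorphism (realization K) (realization L) f ?g"
    unfolding homeomorphism_def
    using maps bij bij_betw_inv_into[OF bij]
    by (auto simp: pl_map_on_def bij_betw_inv_into_left bij_betw_inv_into_right bij_betw_imp_surj_on)
  then show ?thesis using maps unfolding pl_homeomorphic_def by blast
qed

text \<open>The composite is affine on the sets of points of \<open>P\<close> that \<open>f\<close>
  sends into \<open>Q\<close>. Such a set is the image of the polytope \<open>f\<close> P \<inter>
  Q\<open>under the affine inverse of\<close>f\<open>on\<close>f \<open>P\<close>, hence a
  polytope.\<close>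

lemma pl_homeo_compose:
  assumes "pl_homeo K L f" "pl_homeo L M g"
  shows "pl_homeo K M (g \<circ> f)"
proof -
  obtain \<P> where bij: "bij_betw f (realization K) (realization L)" and
    P: "finite \<P>" "\<Union>\<P> = realization K" "\<And>P. P \<in> \<P> \<Longrightarrow> polytope P \<and> affine_map_on P f"
    using assms(1) unfolding pl_homeo_def by blast
  obtain \<Q> where bij': "bij_betw g (realization L) (realization M)" and
    Q: "finite \<Q>" "\<Union>\<Q> = realization L" "\<And>Q. Q \<in> \<Q> \<Longrightarrow> polytope Q \<and> affine_map_on Q g"
    using assms(2) unfolding pl_homeo_def by blast
  define \<R> where "\<R> = (\<lambda>(P, Q). {x \<in> P. f x \<in> Q}) ` (\<P> \<times> \<Q>)"
  have "\<Union>\<R> = realization K"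
    using P(2) Q(2) bij by (fastforce simp: \<R>_def bij_betw_def)
  moreover have "polytope {x \<in> P. f x \<in> Q} \<and> affine_map_on {x \<in> P. f x \<in> Q} (g \<circ> f)"
    if PQ: "P \<in> \<P>" "Q \<in> \<Q>" for P Q
  proof
    let ?h = "inv_into (realization K) f"
    have h: "?h (f x) = x" if "x \<in> P" for x
      using bij P(2) that PQ by (intro bij_betw_inv_into_left) auto
    have "affine_map_on (f ` P) ?h"
      using P(3) PQ polytope_convex h by (intro affine_map_on_inverse) auto
    then have "affine_map_on (f ` P \<inter> Q) ?h" by (rule affine_map_on_subset) auto
    moreover have "polytope (f ` P \<inter> Q)"
      using P(3) Q(3) PQ polytope_affine_image by (intro polytope_Int_poly_mapping) blast+
    ultimately have "polytope (?h ` (f ` P \<inter> Q))" by (rule polytope_affine_image[rotated])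
    moreover have "?h ` (f ` P \<inter> Q) = {x \<in> P. f x \<in> Q}" using h by (force simp: image_iff)
    ultimately show "polytope {x \<in> P. f x \<in> Q}" by simp
    have "affine_map_on P f" "affine_map_on Q g" using P(3) Q(3) PQ by auto
    then show "affine_map_on {x \<in> P. f x \<in> Q} (g \<circ> f)" by (simp add: affine_map_on_def)
  qed
  ultimately show ?thesis
    unfolding pl_homeo_def using bij_betw_trans[OF bij bij'] P(1) Q(1)
    by (intro conjI exI[of _ \<R>]) (auto simp: \<R>_def)
qed

lemma pl_homeo_linear:
  assumes "abstract_complex K" "linear f" "bij_betw f (realization K) (realization L)"
  shows "pl_homeo K L f"
  unfolding pl_homeo_def
proof (intro conjI exI[of _ "(\<lambda>F. convex hull (bary ` F)) ` K"] ballI)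
  show "finite ((\<lambda>F. convex hull (bary ` F)) ` K)"
    using assms(1) by (simp add: complex_finite)
  show "\<Union> ((\<lambda>F. convex hull (bary ` F)) ` K) = realization K"
    by (simp add: realization_def)
  fix P assume "P \<in> (\<lambda>F. convex hull (bary ` F)) ` K"
  then show "polytope P"
    using assms(1) complex_finite_face by (auto intro!: polytope_convex_hull)
  show "affine_map_on P f" by (rule linear_imp_affine_map_on[OF assms(2)])
qed (rule assms)

lemma pl_homeo_glue:
  assumes K: "abstract_complex K1" "abstract_complex K2"
    and L: "abstract_complex L1" "abstract_complex L2"
    and f1: "pl_homeo K1 L1 f1" and f2: "pl_homeo K2 L2 f2"
    and eq: "\<And>x. x \<in> realization (K1 \<inter> K2) \<Longrightarrow> f1 x = f2 x"
    and img: "f1 ` realization (K1 \<inter> K2) = realization (L1 \<inter> L2)"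
  shows "pl_homeo (K1 \<union> K2) (L1 \<union> L2) (\<lambda>x. if x \<in> realization K1 then f1 x else f2 x)"
proof -
  let ?f = "\<lambda>x. if x \<in> realization K1 then f1 x else f2 x"
  obtain \<P> where b1: "bij_betw f1 (realization K1) (realization L1)" and
    P: "finite \<P>" "\<Union>\<P> = realization K1" "\<And>P. P \<in> \<P> \<Longrightarrow> polytope P \<and> affine_map_on P f1"
    using f1 unfolding pl_homeo_def by blast
  obtain \<Q> where b2: "bij_betw f2 (realization K2) (realization L2)" and
    Q: "finite \<Q>" "\<Union>\<Q> = realization K2" "\<And>Q. Q \<in> \<Q> \<Longrightarrow> polytope Q \<and> affine_map_on Q f2"
    using f2 unfolding pl_homeo_def by blast
  have eq1: "?f x = f1 x" if "x \<in> realization K1" for x using that by simp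
  have eq2: "?f x = f2 x" if "x \<in> realization K2" for x
    using that eq by (auto simp: realization_Int K)
  have img2: "f2 ` realization (K1 \<inter> K2) = realization (L1 \<inter> L2)"
    using img eq by force
  \<comment> \<open>Injectivity across the two parts: a common value lies over
    \<open>L1 \<inter> L2\<close>, which is the image of the overlap, so its preimage under
    \<open>f2\<close> is already in the overlap.\<close>
  have cross: "y \<in> realization K1"
    if "x \<in> realization K1" "y \<in> realization K2" "f1 x = f2 y" for x y
  proof -
    have "f2 y \<in> realization (L1 \<inter> L2)"
      using that b1 b2 by (metis IntI L bij_betwE realization_Int)
    then obtain z where z: "z \<in> realization (K1 \<inter> K2)" "f2 y = f2 z" using img2 by auto
    then have "y = z" using b2 that unfolding bij_betw_def inj_on_def
      by (metis IntD2 K realization_Int)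
    then show ?thesis using z K by (simp add: realization_Int)
  qed
  have "bij_betw ?f (realization (K1 \<union> K2)) (realization (L1 \<union> L2))"
    unfolding bij_betw_def
  proof
    show "inj_on ?f (realization (K1 \<union> K2))"
    proof (rule inj_onI)
      fix x y assume xy: "x \<in> realization (K1 \<union> K2)" "y \<in> realization (K1 \<union> K2)" "?f x = ?f y"
      consider "x \<in> realization K1" "y \<in> realization K1"
        | "x \<in> realization K2" "y \<in> realization K2"
        | "x \<in> realization K1" "y \<in> realization K2" "y \<notin> realization K1"
        | "y \<in> realization K1" "x \<in> realization K2" "x \<notin> realization K1"
        using xy(1,2) unfolding realization_Un by blast
      then show "x = y"
      proof cases
        case 1
        then show ?thesis using xy(3) b1 by (auto simp: bij_betw_def dest: inj_onD)
      next
        case 2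
        then have "f2 x = f2 y" using xy(3) eq2 by metis
        then show ?thesis using 2 b2 by (auto simp: bij_betw_def dest: inj_onD)
      next
        case 3
        then show ?thesis using xy(3) cross[of x y] by simp
      next
        case 4
        then show ?thesis using xy(3) cross[of y x] by simp
      qed
    qed
    have "?f ` realization K1 = realization L1" "?f ` realization K2 = realization L2"
      using b1 b2 eq1 eq2 by (simp_all add: bij_betw_def cong: image_cong)
    then show "?f ` realization (K1 \<union> K2) = realization (L1 \<union> L2)"
      by (simp only: realization_Un image_Un)
  qed
  moreover have "polytope P \<and> affine_map_on P ?f" if "P \<in> \<P> \<union> \<Q>" for P
    using that
  proof
    assume P': "P \<in> \<P>"
    have "?f x = f1 x" if "x \<in> P" for x using that P' P(2) by (intro eq1) blast
    then have "affine_map_on P ?f"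
      using P(3)[OF P'] by (intro affine_map_on_cong[of P f1 ?f] polytope_convex) simp_all
    then show ?thesis using P(3)[OF P'] by blast
  next
    assume P': "P \<in> \<Q>"
    have "?f x = f2 x" if "x \<in> P" for x using that P' Q(2) by (intro eq2) blast
    then have "affine_map_on P ?f"
      using Q(3)[OF P'] by (intro affine_map_on_cong[of P f2 ?f] polytope_convex) simp_all
    then show ?thesis using Q(3)[OF P'] by blast
  qed
  ultimately show ?thesis
    unfolding pl_homeo_def using P(1,2) Q(1,2)
    by (intro conjI exI[of _ "\<P> \<union> \<Q>"]) (auto simp: realization_Un)
qed

section \<open>Cones\<close>

text \<open>The apex itself enters through the empty face: the cone over \<open>{{}}\<close> is a
  point, whereas the cone over \<open>{}\<close> is empty.\<close>

definition cone_over :: "'a \<Rightarrow> 'a set set \<Rightarrow> 'a set set" where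
  "cone_over v K = K \<union> insert v ` K"

lemma cone_iff:
  assumes "abstract_complex K" "v \<notin> verts K"
  shows "F \<in> cone_over v K \<longleftrightarrow> F - {v} \<in> K"
proof
  assume "F \<in> cone_over v K"
  then show "F - {v} \<in> K"
    using assms by (auto simp: cone_over_def intro: complex_subset)
next
  assume *: "F - {v} \<in> K"
  show "F \<in> cone_over v K"
  proof (cases "v \<in> F")
    case True
    then have "F = insert v (F - {v})" by auto
    then show ?thesis using * unfolding cone_over_def by blast
  next
    case False
    then show ?thesis using * by (simp add: cone_over_def)
  qed
qed

lemma complex_cone: "abstract_complex K \<Longrightarrow> abstract_complex (cone_over v K)"
  unfolding abstract_complex_def
proof (elim conjE, intro conjI ballI allI impI)
  fix F G assume K: "\<forall>F\<in>K. \<forall>G. G \<subseteq> F \<longrightarrow> G \<in> K" and F: "F \<in> cone_over v K" "G \<subseteq> F"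
  show "G \<in> cone_over v K"
  proof (cases "F \<in> K")
    case True
    then show ?thesis using K F by (auto simp: cone_over_def)
  next
    case False
    then obtain H where H: "H \<in> K" "F = insert v H" using F by (auto simp: cone_over_def)
    show ?thesis
    proof (cases "v \<in> G")
      case True
      have "G - {v} \<in> K" using K H F by blast
      moreover have "G = insert v (G - {v})" using True by auto
      ultimately show ?thesis unfolding cone_over_def by blast
    next
      case False
      then have "G \<subseteq> H" using H F by auto
      then show ?thesis using K H by (auto simp: cone_over_def)
    qed
  qed
qed (auto simp: cone_over_def)

lemma verts_cone: "{} \<in> K \<Longrightarrow> verts (cone_over v K) = insert v (verts K)"
  by (auto simp: verts_def cone_over_def)

lemma cone_mono: "K \<subseteq> L \<Longrightarrow> cone_over v K \<subseteq> cone_over v L"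
  by (auto simp: cone_over_def)

lemma subset_cone: "K \<subseteq> cone_over v K"
  by (auto simp: cone_over_def)

lemma cone_Un: "cone_over v (K \<union> L) = cone_over v K \<union> cone_over v L"
  by (auto simp: cone_over_def)

lemma keys_cone_point:
  assumes "0 \<le> t" "t < 1" "\<And>i. 0 \<le> coord y i"
  shows "Poly_Mapping.keys (t *\<^sub>R bary v + (1 - t) *\<^sub>R y) =
    (if t = 0 then Poly_Mapping.keys y else insert v (Poly_Mapping.keys y))"
proof -
  have "coord (t *\<^sub>R bary v + (1 - t) *\<^sub>R y) i \<noteq> 0 \<longleftrightarrow> coord y i \<noteq> 0 \<or> (t \<noteq> 0 \<and> i = v)" for i
  proof (cases "i = v \<and> t \<noteq> 0")
    case True
    have "0 \<le> (1 - t) * coord y i" using assms by simp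
    then have "coord (t *\<^sub>R bary v + (1 - t) *\<^sub>R y) i > 0"
      using True assms(1) by (simp add: coord_simps)
    then show ?thesis using True by simp
  next
    case False
    then show ?thesis using assms(2) by (auto simp: coord_simps)
  qed
  then show ?thesis by (auto simp: in_keys_iff)
qed

lemma cone_pointI:
  assumes K: "abstract_complex K" and y: "y \<in> realization K" and t: "0 \<le> t" "t \<le> 1"
  shows "t *\<^sub>R bary v + (1 - t) *\<^sub>R y \<in> realization (cone_over v K)"
proof (cases "t = 1")
  case True
  then show ?thesis
    using complex_cone[OF K, of v] complex_empty[OF K]
    by (auto simp: realization_iff coord_bary cone_over_def)
next
  case False
  then have "t < 1" using t by simp
  then show ?thesis
    using complex_cone[OF K, of v] y K t
    by (auto simp: realization_iff keys_cone_point coord_simps cone_over_def)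
qed

lemma bary_in_cone: "abstract_complex K \<Longrightarrow> bary v \<in> realization (cone_over v K)"
  using complex_cone[of K v] complex_empty[of K]
  by (auto simp: realization_iff coord_bary cone_over_def)

lemma cone_pointE:
  assumes K: "abstract_complex K" "v \<notin> verts K" and x: "x \<in> realization (cone_over v K)"
  obtains "x = bary v"
  | t y where "0 \<le> t" "t < 1" "y \<in> realization K" "x = t *\<^sub>R bary v + (1 - t) *\<^sub>R y"
proof (cases "coord x v = 1")
  case True
  have x': "\<And>i. 0 \<le> coord x i" "mass x = 1"
    using x complex_cone[OF K(1), of v] by (auto simp: realization_iff)
  have "coord x i = 0" if "i \<noteq> v" for i
  proof -
    have "coord x v + coord x i = sum (coord x) {v, i}" using that by simp
    also have "\<dots> \<le> sum (coord x) (Poly_Mapping.keys x \<union> {v, i})"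
      using x' by (intro sum_mono2) auto
    also have "\<dots> = 1" using x'(2) mass_superset[of "Poly_Mapping.keys x \<union> {v, i}" x] by auto
    finally show ?thesis using True x'(1)[of i] by simp
  qed
  then have "x = bary v" using True by (intro poly_mapping_eqI) (simp add: coord_bary)
  then show ?thesis by (rule that)
next
  case False
  let ?t = "coord x v"
  have x': "\<And>i. 0 \<le> coord x i" "mass x = 1" "Poly_Mapping.keys x - {v} \<in> K"
    using x complex_cone[OF K(1), of v] cone_iff[OF K] by (auto simp: realization_iff)
  have "coord x v \<le> sum (coord x) (Poly_Mapping.keys x \<union> {v})"
    using x' by (intro member_le_sum) auto
  also have "\<dots> = 1" using x'(2) mass_superset[of "Poly_Mapping.keys x \<union> {v}" x] by auto
  finally have t: "?t < 1" using False by simp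
  define y where "y = (1 / (1 - ?t)) *\<^sub>R (x - ?t *\<^sub>R bary v)"
  have cy: "coord y i = (if i = v then 0 else coord x i / (1 - ?t))" for i
    by (simp add: y_def coord_simps)
  have "Poly_Mapping.keys y = Poly_Mapping.keys x - {v}"
    using t by (auto simp: in_keys_iff cy split: if_splits)
  moreover have "mass y = 1" using t x'(2) by (simp add: y_def)
  ultimately have "y \<in> realization K"
    using x' t K by (auto simp: realization_iff cy)
  moreover have "x = ?t *\<^sub>R bary v + (1 - ?t) *\<^sub>R y"
    using t by (simp add: y_def)
  ultimately show ?thesis using that t x'(1) by blast
qed

text \<open>At the apex the division by zero feeds a meaningless argument to \<open>f\<close>, but
  the result is multiplied by \<open>0\<close>, so the apex goes to the apex whatever
  \<open>f\<close> does.\<close>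

definition cone_map :: "'a \<Rightarrow> 'b \<Rightarrow> (('a \<Rightarrow>\<^sub>0 real) \<Rightarrow> ('b \<Rightarrow>\<^sub>0 real)) \<Rightarrow> ('a \<Rightarrow>\<^sub>0 real) \<Rightarrow> ('b \<Rightarrow>\<^sub>0 real)" where
  "cone_map v w f x = coord x v *\<^sub>R bary w +
     (1 - coord x v) *\<^sub>R f ((1 / (1 - coord x v)) *\<^sub>R (x - coord x v *\<^sub>R bary v))"

lemma cone_map_point:
  assumes "coord y v = 0"
  shows "cone_map v w f (t *\<^sub>R bary v + (1 - t) *\<^sub>R y) = t *\<^sub>R bary w + (1 - t) *\<^sub>R f y"
  using assms by (cases "t = 1") (simp_all add: cone_map_def coord_simps)

lemma cone_map_bary [simp]: "cone_map v w f (bary v) = bary w"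
  by (simp add: cone_map_def)

lemma cone_map_base: "coord y v = 0 \<Longrightarrow> cone_map v w f y = f y"
  by (simp add: cone_map_def)

lemma affine_cone_map:
  assumes P: "convex P" "affine_map_on P f" and v: "\<And>y. y \<in> P \<Longrightarrow> coord y v = 0"
  shows "affine_map_on {t *\<^sub>R bary v + (1 - t) *\<^sub>R y | t y. 0 \<le> t \<and> t \<le> 1 \<and> y \<in> P} (cone_map v w f)"
  unfolding affine_map_on_def
proof (intro ballI)
  fix x1 x2 and s :: real
  assume x: "x1 \<in> {t *\<^sub>R bary v + (1 - t) *\<^sub>R y | t y. 0 \<le> t \<and> t \<le> 1 \<and> y \<in> P}"
    "x2 \<in> {t *\<^sub>R bary v + (1 - t) *\<^sub>R y | t y. 0 \<le> t \<and> t \<le> 1 \<and> y \<in> P}" and s: "s \<in> {0..1}"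
  obtain t1 y1 where 1: "x1 = t1 *\<^sub>R bary v + (1 - t1) *\<^sub>R y1" "0 \<le> t1" "t1 \<le> 1" "y1 \<in> P" using x(1) by blast
  obtain t2 y2 where 2: "x2 = t2 *\<^sub>R bary v + (1 - t2) *\<^sub>R y2" "0 \<le> t2" "t2 \<le> 1" "y2 \<in> P" using x(2) by blast
  \<comment> \<open>Join coordinates do not combine linearly: in a convex combination of two cone
    points, the base points enter with the weights \<open>m1\<close> and \<open>m2\<close>, and the
    new base point is their weighted mean. It is undetermined when both weights vanish.\<close>
  define m1 where "m1 = (1 - s) * (1 - t1)"
  define m2 where "m2 = s * (1 - t2)"
  define m where "m = m1 + m2"
  have nn: "m1 \<ge> 0" "m2 \<ge> 0" using 1 2 s by (auto simp: m1_def m2_def)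
  have mt: "1 - m = (1 - s) * t1 + s * t2" by (simp add: m_def m1_def m2_def algebra_simps)
  have comb: "(1 - s) *\<^sub>R (t1 *\<^sub>R e + (1 - t1) *\<^sub>R z1) + s *\<^sub>R (t2 *\<^sub>R e + (1 - t2) *\<^sub>R z2)
      = (1 - m) *\<^sub>R e + (m1 *\<^sub>R z1 + m2 *\<^sub>R z2)" for e z1 z2 :: "'c \<Rightarrow>\<^sub>0 real"
    unfolding mt by (simp add: m1_def m2_def algebra_simps)
  obtain y where y: "y \<in> P" "m *\<^sub>R y = m1 *\<^sub>R y1 + m2 *\<^sub>R y2" "m *\<^sub>R f y = m1 *\<^sub>R f y1 + m2 *\<^sub>R f y2"
  proof (cases "m = 0")
    case True
    then have "m1 = 0" "m2 = 0" using nn by (auto simp: m_def)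
    then show ?thesis using that[of y1] 1 True by simp
  next
    case False
    then have mp: "m > 0" using nn by (simp add: m_def)
    define r where "r = m2 / m"
    have r: "r \<in> {0..1}" "1 - r = m1 / m" using mp nn by (auto simp: r_def m_def field_simps)
    let ?y = "(1 - r) *\<^sub>R y1 + r *\<^sub>R y2"
    have "?y \<in> P" using P(1) 1(4) 2(4) r(1) unfolding convex_alt by simp
    moreover have "m *\<^sub>R ?y = m1 *\<^sub>R y1 + m2 *\<^sub>R y2"
      using mp unfolding r(2) by (simp add: r_def scaleR_add_right)
    moreover have "f ?y = (1 - r) *\<^sub>R f y1 + r *\<^sub>R f y2"
      using P(2) 1 2 r unfolding affine_map_on_def by blast
    then have "m *\<^sub>R f ?y = m1 *\<^sub>R f y1 + m2 *\<^sub>R f y2"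
      using mp unfolding r(2) by (simp add: r_def scaleR_add_right)
    ultimately show ?thesis by (rule that)
  qed
  have "(1 - s) *\<^sub>R x1 + s *\<^sub>R x2 = (1 - m) *\<^sub>R bary v + (1 - (1 - m)) *\<^sub>R y"
    unfolding 1(1) 2(1) comb y(2)[symmetric] by simp
  then have "cone_map v w f ((1 - s) *\<^sub>R x1 + s *\<^sub>R x2) = (1 - m) *\<^sub>R bary w + m *\<^sub>R f y"
    using cone_map_point[OF v[OF y(1)], of w f "1 - m"] by simp
  also have "\<dots> = (1 - s) *\<^sub>R cone_map v w f x1 + s *\<^sub>R cone_map v w f x2"
    unfolding 1(1) 2(1) cone_map_point[OF v[OF 1(4)]] cone_map_point[OF v[OF 2(4)]] comb y(3) ..
  finally show "cone_map v w f ((1 - s) *\<^sub>R x1 + s *\<^sub>R x2) =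
      (1 - s) *\<^sub>R cone_map v w f x1 + s *\<^sub>R cone_map v w f x2" .
qed

lemma polytope_cone:
  assumes "polytope P"
  shows "polytope ({t *\<^sub>R a + (1 - t) *\<^sub>R y | t y. 0 \<le> t \<and> t \<le> 1 \<and> y \<in> P})"
proof (cases "P = {}")
  case True
  then show ?thesis by (simp add: polytope_empty)
next
  case False
  obtain A where A: "finite A" "P = convex hull A" using assms unfolding polytope_def by blast
  have "convex hull (insert a P) = {t *\<^sub>R a + (1 - t) *\<^sub>R y | t y. 0 \<le> t \<and> t \<le> 1 \<and> y \<in> P}" (is "_ = ?R")
  proof -
    have "convex hull P = P" using A(2) by simp
    then have "convex hull (insert a P) = {x. \<exists>u\<ge>0. \<exists>v\<ge>0. \<exists>b. b \<in> P \<and> u + v = 1 \<and> x = u *\<^sub>R a + v *\<^sub>R b}"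
      using convex_hull_insert[OF False, of a] by auto
    also have "\<dots> = ?R"
    proof (intro set_eqI iffI)
      fix x assume "x \<in> {x. \<exists>u\<ge>0. \<exists>v\<ge>0. \<exists>b. b \<in> P \<and> u + v = 1 \<and> x = u *\<^sub>R a + v *\<^sub>R b}"
      then obtain u v b where "0 \<le> u" "0 \<le> v" "b \<in> P" "u + v = 1" "x = u *\<^sub>R a + v *\<^sub>R b" by blast
      then have "v = 1 - u" by simp
      then have "x = u *\<^sub>R a + (1 - u) *\<^sub>R b" "u \<le> 1"
        using \<open>0 \<le> v\<close> \<open>x = _\<close> by auto
      then show "x \<in> ?R" using \<open>0 \<le> u\<close> \<open>b \<in> P\<close> by blast
    next
      fix x assume "x \<in> ?R"
      then obtain t y where "0 \<le> t" "t \<le> 1" "y \<in> P" "x = t *\<^sub>R a + (1 - t) *\<^sub>R y" by blast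
      then show "x \<in> {x. \<exists>u\<ge>0. \<exists>v\<ge>0. \<exists>b. b \<in> P \<and> u + v = 1 \<and> x = u *\<^sub>R a + v *\<^sub>R b}"
        by (intro CollectI exI[of _ t] conjI exI[of _ "1 - t"] exI[of _ y]) auto
    qed
    finally show ?thesis .
  qed
  moreover have "convex hull (insert a P) = convex hull (insert a A)"
    unfolding A(2) by (rule hull_insert[symmetric])
  ultimately show ?thesis using A(1) unfolding polytope_def by (metis finite_insert)
qed

lemma pl_homeo_cone:
  assumes K: "abstract_complex K" "v \<notin> verts K" and L: "abstract_complex L" "w \<notin> verts L"
    and f: "pl_homeo K L f"
  shows "pl_homeo (cone_over v K) (cone_over w L) (cone_map v w f)"
proof -
  obtain \<P> where bij: "bij_betw f (realization K) (realization L)" and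
    P: "finite \<P>" "\<Union>\<P> = realization K" "\<And>P. P \<in> \<P> \<Longrightarrow> polytope P \<and> affine_map_on P f"
    using f unfolding pl_homeo_def by blast
  let ?g = "inv_into (realization K) f"
  have gbij: "bij_betw ?g (realization L) (realization K)" by (rule bij_betw_inv_into[OF bij])
  have v0: "coord y v = 0" if "y \<in> realization K" for y
    using coord_outside_verts[OF K(1) that K(2)] .
  have w0: "coord y w = 0" if "y \<in> realization L" for y
    using coord_outside_verts[OF L(1) that L(2)] .
  have fw: "f y \<in> realization L" if "y \<in> realization K" for y using bij that by (rule bij_betwE[rule_format])
  have gv: "?g y \<in> realization K" if "y \<in> realization L" for y using gbij that by (rule bij_betwE[rule_format])
  have "bij_betw (cone_map v w f) (realization (cone_over v K)) (realization (cone_over w L))"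
  proof (rule bij_betw_byWitness[where f' = "cone_map w v ?g"])
    show "\<forall>a\<in>realization (cone_over v K). cone_map w v ?g (cone_map v w f a) = a"
    proof
      fix x assume x: "x \<in> realization (cone_over v K)"
      show "cone_map w v ?g (cone_map v w f x) = x"
      proof (cases rule: cone_pointE[OF K x])
        case (2 t y)
        then show ?thesis
          by (simp add: cone_map_point v0 w0 fw bij_betw_inv_into_left[OF bij])
      qed simp
    qed
    show "\<forall>a\<in>realization (cone_over w L). cone_map v w f (cone_map w v ?g a) = a"
    proof
      fix x assume x: "x \<in> realization (cone_over w L)"
      show "cone_map v w f (cone_map w v ?g x) = x"
      proof (cases rule: cone_pointE[OF L x])
        case (2 t y)
        then show ?thesis
          by (simp add: cone_map_point v0 w0 gv bij_betw_inv_into_right[OF bij])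
      qed simp
    qed
    show "cone_map v w f ` realization (cone_over v K) \<subseteq> realization (cone_over w L)"
    proof (rule image_subsetI)
      fix x assume x: "x \<in> realization (cone_over v K)"
      show "cone_map v w f x \<in> realization (cone_over w L)"
        by (cases rule: cone_pointE[OF K x])
          (auto simp: cone_map_point v0 bary_in_cone L intro!: cone_pointI fw)
    qed
    show "cone_map w v ?g ` realization (cone_over w L) \<subseteq> realization (cone_over v K)"
    proof (rule image_subsetI)
      fix x assume x: "x \<in> realization (cone_over w L)"
      show "cone_map w v ?g x \<in> realization (cone_over v K)"
        by (cases rule: cone_pointE[OF L x])
          (auto simp: cone_map_point w0 bary_in_cone K intro!: cone_pointI gv)
    qed
  qed
  moreover
  define C where "C = (\<lambda>P. {t *\<^sub>R bary v + (1 - t) *\<^sub>R y | t y. 0 \<le> t \<and> t \<le> 1 \<and> y \<in> P})"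
  \<comment> \<open>The apex is listed as a piece of its own, because for \<open>K = {{}}\<close>
    there may be no piece whose cone contains it.\<close>
  have "\<Union>(insert {bary v} (C ` \<P>)) = realization (cone_over v K)"
  proof
    show "\<Union>(insert {bary v} (C ` \<P>)) \<subseteq> realization (cone_over v K)"
      using P(2) K(1) by (auto simp: C_def intro!: cone_pointI bary_in_cone)
    show "realization (cone_over v K) \<subseteq> \<Union>(insert {bary v} (C ` \<P>))"
    proof
      fix x assume x: "x \<in> realization (cone_over v K)"
      show "x \<in> \<Union>(insert {bary v} (C ` \<P>))"
      proof (cases rule: cone_pointE[OF K x])
        case (2 t y)
        then obtain P where "P \<in> \<P>" "y \<in> P" using P(2) by blast
        then have "x \<in> C P"
          unfolding C_def using 2 by (intro CollectI exI[of _ t] exI[of _ y]) simp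
        then show ?thesis using \<open>P \<in> \<P>\<close> by blast
      qed simp
    qed
  qed
  moreover have "polytope Q \<and> affine_map_on Q (cone_map v w f)" if "Q \<in> insert {bary v} (C ` \<P>)" for Q
    using that
  proof
    assume "Q = {bary v}"
    moreover have "polytope {bary v}" using polytope_convex_hull[of "{bary v}"] by simp
    ultimately show ?thesis by (simp add: affine_map_on_def flip: scaleR_left.add)
  next
    assume "Q \<in> C ` \<P>"
    then obtain R where R: "R \<in> \<P>" "Q = C R" by blast
    have "coord y v = 0" if "y \<in> R" for y using that R P(2) v0 by blast
    then show ?thesis
      using P(3)[OF R(1)] unfolding R(2) C_def
      by (auto intro!: polytope_cone affine_cone_map polytope_convex)
  qed
  ultimately show ?thesis
    unfolding pl_homeo_def using P(1) by (metis finite.insertI finite_imageI)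
qed

section \<open>Relabelling vertices\<close>

definition relabel :: "('a \<Rightarrow> 'b) \<Rightarrow> ('a \<Rightarrow>\<^sub>0 real) \<Rightarrow> ('b \<Rightarrow>\<^sub>0 real)" where
  "relabel \<phi> x = (\<Sum>v\<in>Poly_Mapping.keys x. coord x v *\<^sub>R bary (\<phi> v))"

lemma relabel_superset:
  "finite W \<Longrightarrow> Poly_Mapping.keys x \<subseteq> W \<Longrightarrow> relabel \<phi> x = (\<Sum>v\<in>W. coord x v *\<^sub>R bary (\<phi> v))"
  unfolding relabel_def by (rule sum.mono_neutral_left) (auto simp: in_keys_iff)

lemma linear_relabel: "linear (relabel \<phi>)"
proof (rule linearI)
  fix x y :: "'a \<Rightarrow>\<^sub>0 real" and c :: real
  let ?W = "Poly_Mapping.keys x \<union> Poly_Mapping.keys y"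
  have "relabel \<phi> (x + y) = (\<Sum>v\<in>?W. coord (x + y) v *\<^sub>R bary (\<phi> v))"
    using keys_add[of x y] by (intro relabel_superset) auto
  also have "\<dots> = relabel \<phi> x + relabel \<phi> y"
    by (simp add: relabel_superset[of ?W] lookup_add scaleR_left.add sum.distrib)
  finally show "relabel \<phi> (x + y) = relabel \<phi> x + relabel \<phi> y" .
  have "Poly_Mapping.keys (c *\<^sub>R x) \<subseteq> Poly_Mapping.keys x" by (auto simp: in_keys_iff)
  then have "relabel \<phi> (c *\<^sub>R x) = (\<Sum>v\<in>Poly_Mapping.keys x. coord (c *\<^sub>R x) v *\<^sub>R bary (\<phi> v))"
    by (intro relabel_superset) auto
  then show "relabel \<phi> (c *\<^sub>R x) = c *\<^sub>R relabel \<phi> x"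
    by (simp add: relabel_def scaleR_sum_right)
qed

lemma relabel_bary [simp]: "relabel \<phi> (bary v) = bary (\<phi> v)"
  by (simp add: relabel_def)

lemma relabel_relabel: "relabel \<psi> (relabel \<phi> x) = relabel (\<psi> \<circ> \<phi>) x"
proof -
  interpret linear "relabel \<psi>" by (rule linear_relabel)
  show ?thesis by (simp add: relabel_def[of \<phi>] relabel_def[of "\<psi> \<circ> \<phi>"] sum scale)
qed

lemma relabel_id:
  assumes "\<And>v. v \<in> Poly_Mapping.keys x \<Longrightarrow> \<phi> v = v"
  shows "relabel \<phi> x = x"
proof -
  have "relabel \<phi> x = (\<Sum>v\<in>Poly_Mapping.keys x. coord x v *\<^sub>R bary v)"
    unfolding relabel_def using assms by (intro sum.cong) auto
  then show ?thesis by (simp add: sum_coord_bary)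
qed

lemma relabel_image: "relabel \<phi> ` realization K = realization (map_complex \<phi> K)"
proof -
  have "relabel \<phi> ` realization K = (\<Union>F\<in>K. convex hull (relabel \<phi> ` bary ` F))"
    by (simp add: realization_def image_UN convex_hull_linear_image[OF linear_relabel])
  also have "\<dots> = (\<Union>F\<in>K. convex hull (bary ` \<phi> ` F))"
    by (simp add: image_image)
  finally show ?thesis by (simp add: realization_def map_complex_def)
qed

lemma pl_homeo_relabel:
  assumes K: "abstract_complex K" and inj: "inj_on \<phi> (verts K)"
  shows "pl_homeo K (map_complex \<phi> K) (relabel \<phi>)"
proof (rule pl_homeo_linear[OF K linear_relabel])
  let ?\<psi> = "inv_into (verts K) \<phi>"
  have "relabel ?\<psi> (relabel \<phi> x) = x" if "x \<in> realization K" for x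
    unfolding relabel_relabel
  proof (rule relabel_id)
    fix v assume "v \<in> Poly_Mapping.keys x"
    then have "v \<in> verts K" using that K by (auto simp: realization_iff verts_def)
    then show "(?\<psi> \<circ> \<phi>) v = v" using inj by simp
  qed
  then have "inj_on (relabel \<phi>) (realization K)" by (rule inj_on_inverseI)
  then show "bij_betw (relabel \<phi>) (realization K) (realization (map_complex \<phi> K))"
    by (simp add: bij_betw_def relabel_image)
qed

lemma complex_map: "abstract_complex K \<Longrightarrow> abstract_complex (map_complex \<phi> K)"
  unfolding abstract_complex_def map_complex_def
  by (auto simp: subset_image_iff image_iff)

lemma verts_map: "verts (map_complex \<phi> K) = \<phi> ` verts K"
  by (auto simp: verts_def map_complex_def)

lemma verts_Un [simp]: "verts (K \<union> L) = verts K \<union> verts L"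
  by (auto simp: verts_def)

section \<open>Edge subdivisions\<close>

text \<open>The stellar subdivision of the edge \<open>{p, q}\<close> at \<open>m\<close>. The faces
  through \<open>m\<close> are spanned by \<open>m\<close>, at most one endpoint of the edge, and a
  face of the link of the edge.\<close>

definition edge_subdivision :: "'a \<Rightarrow> 'a \<Rightarrow> 'a \<Rightarrow> 'a set set \<Rightarrow> 'a set set" where
  "edge_subdivision p q m K =
     {F \<in> K. \<not> {p, q} \<subseteq> F} \<union> insert m ` {F. \<not> {p, q} \<subseteq> F \<and> F \<union> {p, q} \<in> K}"

lemma edge_subdivision_iff:
  assumes "abstract_complex K" "m \<notin> verts K" "m \<noteq> p" "m \<noteq> q"
  shows "F \<in> edge_subdivision p q m K \<longleftrightarrow>
    \<not> {p, q} \<subseteq> F \<and> (if m \<in> F then F - {m} \<union> {p, q} \<in> K else F \<in> K)"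
proof (cases "m \<in> F")
  case True
  then have FK: "F \<notin> K" using assms(2) by (auto simp: verts_def)
  have "F \<in> insert m ` {F. \<not> {p, q} \<subseteq> F \<and> F \<union> {p, q} \<in> K} \<longleftrightarrow>
      \<not> {p, q} \<subseteq> F \<and> F - {m} \<union> {p, q} \<in> K" (is "?l \<longleftrightarrow> ?r")
  proof
    assume ?l
    then obtain G where G: "F = insert m G" "\<not> {p, q} \<subseteq> G" "G \<union> {p, q} \<in> K" by auto
    then have "F - {m} \<union> {p, q} \<subseteq> G \<union> {p, q}" by auto
    then show ?r using G assms complex_subset by blast
  next
    assume ?r
    moreover have "F = insert m (F - {m})" using True by auto
    ultimately show ?l by blast
  qed
  then show ?thesis using True FK by (auto simp: edge_subdivision_def)
next
  case False
  then show ?thesis by (auto simp: edge_subdivision_def)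
qed

lemma complex_edge_subdivision:
  assumes K: "abstract_complex K" "m \<notin> verts K" "m \<noteq> p" "m \<noteq> q"
  shows "abstract_complex (edge_subdivision p q m K)"
  unfolding abstract_complex_def
proof (intro conjI ballI allI impI)
  have "{F. \<not> {p, q} \<subseteq> F \<and> F \<union> {p, q} \<in> K} \<subseteq> Pow (verts K)"
    by (auto simp: verts_def)
  then show "finite (edge_subdivision p q m K)"
    using complex_finite_verts[OF K(1)] complex_finite[OF K(1)] finite_subset
    unfolding edge_subdivision_def by (auto intro: finite_subset)
  show "{} \<in> edge_subdivision p q m K"
    using K by (simp add: edge_subdivision_iff complex_empty)
  fix F assume F: "F \<in> edge_subdivision p q m K"
  show "finite F"
    using F by (auto simp: edge_subdivision_def dest!: complex_finite_face[OF K(1)])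
  fix G assume GF: "G \<subseteq> F"
  have "F - {m} \<in> K"
  proof (cases "m \<in> F")
    case True
    then have "F - {m} \<union> {p, q} \<in> K" using F K by (simp add: edge_subdivision_iff)
    then show ?thesis using complex_subset[OF K(1)] by blast
  next
    case False
    then show ?thesis using F K by (simp add: edge_subdivision_iff)
  qed
  moreover have "m \<in> F \<Longrightarrow> F - {m} \<union> {p, q} \<in> K" using F K by (simp add: edge_subdivision_iff)
  moreover have "G - {m} \<subseteq> F - {m}" "G - {m} \<union> {p, q} \<subseteq> F - {m} \<union> {p, q}" using GF by auto
  ultimately have "m \<in> G \<Longrightarrow> G - {m} \<union> {p, q} \<in> K" "G - {m} \<in> K"
    using GF complex_subset[OF K(1)] by blast+
  then show "G \<in> edge_subdivision p q m K"
    using F GF K by (auto simp: edge_subdivision_iff)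
qed

definition edge_midpoint_map :: "'a \<Rightarrow> 'a \<Rightarrow> 'a \<Rightarrow> ('a \<Rightarrow>\<^sub>0 real) \<Rightarrow> ('a \<Rightarrow>\<^sub>0 real)" where
  "edge_midpoint_map p q m x = x - coord x m *\<^sub>R bary m + (coord x m / 2) *\<^sub>R (bary p + bary q)"

text \<open>The direction is chosen so that the map is linear on the whole space, sending
  \<open>m\<close> to the midpoint of the edge. Its inverse is only piecewise linear and serves
  merely to prove bijectivity.\<close>

lemma pl_homeo_edge_subdivision:
  assumes K: "abstract_complex K" "m \<notin> verts K" "m \<noteq> p" "m \<noteq> q" and pq: "p \<noteq> q"
  shows "pl_homeo (edge_subdivision p q m K) K (edge_midpoint_map p q m)"
proof (rule pl_homeo_linear)
  let ?K' = "edge_subdivision p q m K" and ?r = "edge_midpoint_map p q m"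
  \<comment> \<open>The inverse moves the common part of the \<open>p\<close>- and
    \<open>q\<close>-coordinates to \<open>m\<close>. Afterwards one of the two vanishes, so the
    support no longer contains the edge.\<close>
  define \<tau> where "\<tau> x = x - min (coord x p) (coord x q) *\<^sub>R (bary p + bary q)
      + (2 * min (coord x p) (coord x q)) *\<^sub>R bary m" for x :: "'a \<Rightarrow>\<^sub>0 real"
  show K': "abstract_complex ?K'" by (rule complex_edge_subdivision[OF K])
  show "linear ?r"
    by (rule linearI; rule poly_mapping_eqI) (simp_all add: edge_midpoint_map_def coord_simps algebra_simps add_divide_distrib)
  have cr: "coord (?r x) i = (if i = m then 0 else coord x i + (if i = p \<or> i = q then coord x m / 2 else 0))"
    for x i using K(3,4) pq by (auto simp: edge_midpoint_map_def coord_simps)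
  have ct: "coord (\<tau> x) i = (if i = m then coord x m + 2 * min (coord x p) (coord x q) else
      coord x i - (if i = p \<or> i = q then min (coord x p) (coord x q) else 0))" for x i
    using K(3,4) pq by (auto simp: \<tau>_def coord_simps)
  have mr: "mass (?r x) = mass x" and mt: "mass (\<tau> x) = mass x" for x
    by (simp_all add: edge_midpoint_map_def \<tau>_def)
  show "bij_betw ?r (realization ?K') (realization K)"
  proof (rule bij_betw_byWitness[where f' = \<tau>])
    show "\<forall>x\<in>realization ?K'. \<tau> (?r x) = x"
    proof
      fix x assume "x \<in> realization ?K'"
      then have x: "\<And>i. 0 \<le> coord x i" "coord x p = 0 \<or> coord x q = 0"
        using K K' by (auto simp: realization_iff edge_subdivision_iff in_keys_iff)
      have "min (coord (?r x) p) (coord (?r x) q) = coord x m / 2"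
        using x(1)[of p] x(1)[of q] x(2) K(3,4) by (auto simp: cr)
      then show "\<tau> (?r x) = x"
        using K(3,4) by (intro poly_mapping_eqI) (auto simp: ct cr)
    qed
    show "\<forall>x\<in>realization K. ?r (\<tau> x) = x"
    proof
      fix x assume "x \<in> realization K"
      then have "coord x m = 0" by (rule coord_outside_verts[OF K(1) _ K(2)])
      then show "?r (\<tau> x) = x"
        using K(3,4) by (intro poly_mapping_eqI) (auto simp: ct cr)
    qed
    show "?r ` realization ?K' \<subseteq> realization K"
    proof (rule image_subsetI)
      fix x assume "x \<in> realization ?K'"
      then have x: "\<And>i. 0 \<le> coord x i" "mass x = 1" "Poly_Mapping.keys x \<in> ?K'"
        using K' by (auto simp: realization_iff)
      have "Poly_Mapping.keys (?r x) \<in> K"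
      proof (cases "m \<in> Poly_Mapping.keys x")
        case True
        then have "Poly_Mapping.keys x - {m} \<union> {p, q} \<in> K" using x K by (simp add: edge_subdivision_iff)
        moreover have "Poly_Mapping.keys (?r x) \<subseteq> Poly_Mapping.keys x - {m} \<union> {p, q}"
          by (auto simp: in_keys_iff cr split: if_splits)
        ultimately show ?thesis by (rule complex_subset[OF K(1)])
      next
        case False
        then have "?r x = x" by (simp add: edge_midpoint_map_def in_keys_iff)
        then show ?thesis using x False K by (simp add: edge_subdivision_iff)
      qed
      then show "?r x \<in> realization K" using x K by (auto simp: realization_iff cr mr)
    qed
    show "\<tau> ` realization K \<subseteq> realization ?K'"
    proof (rule image_subsetI)
      fix x assume x': "x \<in> realization K"
      then have x: "\<And>i. 0 \<le> coord x i" "mass x = 1" "Poly_Mapping.keys x \<in> K"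
        using K by (auto simp: realization_iff)
      have m0: "coord x m = 0" by (rule coord_outside_verts[OF K(1) x' K(2)])
      have "Poly_Mapping.keys (\<tau> x) \<in> ?K'"
      proof (cases "{p, q} \<subseteq> Poly_Mapping.keys x")
        case True
        let ?k = "Poly_Mapping.keys (\<tau> x)"
        have "?k - {m} \<union> {p, q} \<subseteq> Poly_Mapping.keys x"
          using True by (auto simp: in_keys_iff ct split: if_splits)
        then have "?k - {m} \<union> {p, q} \<in> K" using x complex_subset[OF K(1)] by blast
        moreover from this have "m \<notin> ?k \<Longrightarrow> ?k \<in> K"
          by (metis Diff_insert0 Diff_empty Un_upper1 complex_subset[OF K(1)])
        moreover have "\<not> {p, q} \<subseteq> ?k"
          using K(3,4) by (auto simp: in_keys_iff ct min_def split: if_splits)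
        ultimately show ?thesis using K by (simp add: edge_subdivision_iff)
      next
        case False
        then have "min (coord x p) (coord x q) = 0"
          using x(1)[of p] x(1)[of q] by (auto simp: in_keys_iff)
        then have "\<tau> x = x" by (simp add: \<tau>_def)
        then show ?thesis using x False K m0 by (simp add: edge_subdivision_iff in_keys_iff)
      qed
      moreover have "0 \<le> coord (\<tau> x) i" for i
        using x(1)[of i] x(1)[of p] x(1)[of q] m0 by (auto simp: ct)
      ultimately show "\<tau> x \<in> realization ?K'" using x K' by (simp add: realization_iff mt)
    qed
  qed
qed

section \<open>PL equivalence relative to a subcomplex\<close>

text \<open>For \<open>M = {{}}\<close> the realization is empty and the second condition void, so
  \<open>pl_equiv {{}}\<close> is the absolute relation.\<close>

definition pl_equiv :: "'a set set \<Rightarrow> 'a set set \<Rightarrow> 'a set set \<Rightarrow> bool" where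
  "pl_equiv M K L \<longleftrightarrow> (\<exists>f. pl_homeo K L f \<and> (\<forall>x\<in>realization M. f x = x))"

lemma realization_empty_complex [simp]: "realization {{}} = {}"
  by (simp add: realization_def)

lemma complex_empty_complex [simp]: "abstract_complex {{}}"
  by (simp add: abstract_complex_def)

lemma pl_equiv_mono: "pl_equiv N K L \<Longrightarrow> M \<subseteq> N \<Longrightarrow> pl_equiv M K L"
  unfolding pl_equiv_def using realization_mono[of M N] by blast

lemma pl_equiv_refl: "abstract_complex K \<Longrightarrow> pl_equiv M K K"
  unfolding pl_equiv_def
  by (intro exI[of _ id] conjI pl_homeo_linear) (auto intro: linear_id)

lemma pl_equiv_sym:
  assumes "pl_equiv M K L" "M \<subseteq> K"
  shows "pl_equiv M L K"
proof -
  obtain f where f: "pl_homeo K L f" "\<And>x. x \<in> realization M \<Longrightarrow> f x = x"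
    using assms(1) unfolding pl_equiv_def by blast
  have "inv_into (realization K) f x = x" if "x \<in> realization M" for x
    using f realization_mono[OF assms(2)] that
    by (metis bij_betw_inv_into_left pl_homeo_def subsetD)
  then show ?thesis using pl_homeo_inv_into[OF f(1)] unfolding pl_equiv_def by blast
qed

lemma pl_equiv_trans:
  assumes "pl_equiv M K L" "pl_equiv M L N"
  shows "pl_equiv M K N"
proof -
  obtain f g where "pl_homeo K L f" "\<And>x. x \<in> realization M \<Longrightarrow> f x = x"
    "pl_homeo L N g" "\<And>x. x \<in> realization M \<Longrightarrow> g x = x"
    using assms unfolding pl_equiv_def by blast
  then show ?thesis
    unfolding pl_equiv_def by (intro exI[of _ "g \<circ> f"]) (simp add: pl_homeo_compose)
qed

lemma pl_equiv_edge_subdivision: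
  assumes "abstract_complex K" "m \<notin> verts K" "m \<noteq> p" "m \<noteq> q" "p \<noteq> q"
    and M: "abstract_complex M" "m \<notin> verts M"
  shows "pl_equiv M (edge_subdivision p q m K) K"
  unfolding pl_equiv_def
  using pl_homeo_edge_subdivision[OF assms(1-5)] coord_outside_verts[OF M(1) _ M(2)]
  by (intro exI[of _ "edge_midpoint_map p q m"]) (simp add: edge_midpoint_map_def)

text \<open>Both maps are the identity on the overlap, so they agree there and carry it onto itself;
  nothing beyond the equality of the two overlaps has to be matched.\<close>

lemma pl_equiv_glue:
  assumes cplx: "abstract_complex K1" "abstract_complex K2" "abstract_complex L1" "abstract_complex L2"
    and e1: "pl_equiv N1 K1 L1" and e2: "pl_equiv N2 K2 L2"
    and Int: "K1 \<inter> K2 = L1 \<inter> L2" "K1 \<inter> K2 \<subseteq> N1" "K1 \<inter> K2 \<subseteq> N2"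
    and N: "N1 \<subseteq> K1" "N2 \<subseteq> K2"
  shows "pl_equiv (N1 \<union> N2) (K1 \<union> K2) (L1 \<union> L2)"
proof -
  obtain f1 f2 where f1: "pl_homeo K1 L1 f1" "\<And>x. x \<in> realization N1 \<Longrightarrow> f1 x = x"
    and f2: "pl_homeo K2 L2 f2" "\<And>x. x \<in> realization N2 \<Longrightarrow> f2 x = x"
    using e1 e2 unfolding pl_equiv_def by blast
  let ?I = "realization (K1 \<inter> K2)"
  have id: "f1 x = x" "f2 x = x" if "x \<in> ?I" for x
    using that f1(2) f2(2) realization_mono[OF Int(2)] realization_mono[OF Int(3)] by blast+
  then have "f1 ` ?I = realization (L1 \<inter> L2)" using Int(1) by simp
  then have "pl_homeo (K1 \<union> K2) (L1 \<union> L2) (\<lambda>x. if x \<in> realization K1 then f1 x else f2 x)" (is "pl_homeo _ _ ?f")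
    using id f1 f2 cplx by (intro pl_homeo_glue) auto
  moreover have "?f x = x" if "x \<in> realization (N1 \<union> N2)" for x
  proof (cases "x \<in> realization N1")
    case True
    then show ?thesis using f1(2) realization_mono[OF N(1)] by auto
  next
    case False
    then have x: "x \<in> realization N2" using that by (simp add: realization_Un)
    then have "x \<in> realization K1 \<Longrightarrow> x \<in> ?I"
      using realization_mono[OF N(2)] cplx by (auto simp: realization_Int)
    then show ?thesis using id f2(2)[OF x] by auto
  qed
  ultimately show ?thesis unfolding pl_equiv_def by (intro exI[of _ ?f]) simp
qed

lemma pl_equiv_cone:
  assumes K: "abstract_complex K" "v \<notin> verts K" and L: "abstract_complex L" "v \<notin> verts L"
    and N: "abstract_complex N" "N \<subseteq> K" and e: "pl_equiv N K L"
  shows "pl_equiv (cone_over v N) (cone_over v K) (cone_over v L)"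
proof -
  obtain f where f: "pl_homeo K L f" "\<And>x. x \<in> realization N \<Longrightarrow> f x = x"
    using e unfolding pl_equiv_def by blast
  have vN: "v \<notin> verts N" using K(2) N(2) by (auto simp: verts_def)
  have "cone_map v v f x = x" if x: "x \<in> realization (cone_over v N)" for x
    by (cases rule: cone_pointE[OF N(1) vN x])
      (simp_all add: cone_map_point coord_outside_verts[OF N(1) _ vN] f(2))
  then show ?thesis
    using pl_homeo_cone[OF K L f(1)] unfolding pl_equiv_def by blast
qed

lemma cone_inter_cone:
  assumes "p \<noteq> q" "p \<notin> verts K" "q \<notin> verts L"  "p \<notin> verts L" "q \<notin> verts K"
  shows "cone_over p K \<inter> cone_over q L = K \<inter> L"
  using assms by (auto simp: cone_over_def verts_def)

lemma pl_equiv_suspension: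
  assumes K: "abstract_complex K" "p \<notin> verts K" "q \<notin> verts K"
    and L: "abstract_complex L" "p \<notin> verts L" "q \<notin> verts L"
    and pq: "p \<noteq> q" and e: "pl_equiv {{}} K L"
  shows "pl_equiv {{}} (cone_over p K \<union> cone_over q K) (cone_over p L \<union> cone_over q L)"
proof -
  obtain f where f: "pl_homeo K L f" using e unfolding pl_equiv_def by blast
  have I: "cone_over p K \<inter> cone_over q K = K" "cone_over p L \<inter> cone_over q L = L"
    using cone_inter_cone[of p q] K L pq by auto
  have c: "cone_map p p f x = f x" "cone_map q q f x = f x" if "x \<in> realization K" for x
    using that K by (auto simp: cone_map_base coord_outside_verts)
  have "f ` realization K = realization L"
    using f by (simp add: pl_homeo_def bij_betw_def)
  then have "cone_map p p f ` realization K = realization L" using c by force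
  then have "pl_homeo (cone_over p K \<union> cone_over q K) (cone_over p L \<union> cone_over q L)
      (\<lambda>x. if x \<in> realization (cone_over p K) then cone_map p p f x else cone_map q q f x)"
    using K L f c I by (intro pl_homeo_glue pl_homeo_cone complex_cone) auto
  then show ?thesis unfolding pl_equiv_def by auto
qed

lemma pl_equiv_map:
  assumes K: "abstract_complex K" "inj_on \<phi> (verts K)" and L: "abstract_complex L" "inj_on \<phi> (verts L)"
    and M: "M \<subseteq> K" and e: "pl_equiv M K L"
  shows "pl_equiv (map_complex \<phi> M) (map_complex \<phi> K) (map_complex \<phi> L)"
proof -
  obtain f where f: "pl_homeo K L f" "\<And>x. x \<in> realization M \<Longrightarrow> f x = x"
    using e unfolding pl_equiv_def by blast
  let ?r = "relabel \<phi>"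
  let ?s = "inv_into (realization K) ?r"
  have rK: "pl_homeo K (map_complex \<phi> K) ?r" by (rule pl_homeo_relabel[OF K])
  have "pl_homeo (map_complex \<phi> K) (map_complex \<phi> L) (?r \<circ> f \<circ> ?s)"
    using pl_homeo_inv_into[OF rK] f(1) pl_homeo_relabel[OF L] by (blast intro: pl_homeo_compose)
  moreover have "(?r \<circ> f \<circ> ?s) x = x" if x: "x \<in> realization (map_complex \<phi> M)" for x
  proof -
    obtain y where y: "y \<in> realization M" "x = ?r y" using x unfolding relabel_image[symmetric] by blast
    then have "?s x = y"
      using rK realization_mono[OF M] by (auto simp: pl_homeo_def bij_betw_def)
    then show ?thesis using y f(2) by simp
  qed
  ultimately show ?thesis unfolding pl_equiv_def by blast
qed

section \<open>Images of complexes under vertex maps\<close>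

lemma map_complex_cong:
  assumes "\<And>x. x \<in> verts K \<Longrightarrow> \<phi> x = \<psi> x"
  shows "map_complex \<phi> K = map_complex \<psi> K"
  unfolding map_complex_def
proof (rule image_cong[OF refl])
  fix F assume "F \<in> K"
  then show "\<phi> ` F = \<psi> ` F" using assms by (intro image_cong) (auto simp: verts_def)
qed

lemma map_complex_id: "(\<And>x. x \<in> verts K \<Longrightarrow> \<phi> x = x) \<Longrightarrow> map_complex \<phi> K = K"
  using map_complex_cong[of K \<phi> id] by (simp add: map_complex_def)

lemma map_complex_comp: "map_complex \<phi> (map_complex \<psi> K) = map_complex (\<phi> \<circ> \<psi>) K"
  unfolding map_complex_def by (simp add: image_image image_comp)

lemma map_complex_cone: "map_complex \<phi> (cone_over v K) = cone_over (\<phi> v) (map_complex \<phi> K)"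
  unfolding map_complex_def cone_over_def by (simp add: image_Un image_image)

lemma map_complex_Un: "map_complex \<phi> (K \<union> L) = map_complex \<phi> K \<union> map_complex \<phi> L"
  by (simp add: map_complex_def image_Un)

lemma pl_equiv_relabel:
  assumes K: "abstract_complex K" "inj_on \<phi> (verts K)" and M: "abstract_complex M" "\<And>x. x \<in> verts M \<Longrightarrow> \<phi> x = x"
  shows "pl_equiv M K (map_complex \<phi> K)"
proof -
  have "relabel \<phi> x = x" if "x \<in> realization M" for x
    using that M by (intro relabel_id) (auto simp: realization_iff verts_def)
  then show ?thesis using pl_homeo_relabel[OF K] unfolding pl_equiv_def by blast
qed

lemma pl_equiv_cone_apex:
  assumes "abstract_complex T" "b \<notin> verts T" "c \<notin> verts T"
  shows "pl_equiv T (cone_over b T) (cone_over c T)"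
proof -
  let ?\<phi> = "\<lambda>x. if x = b then c else x"
  have T: "map_complex ?\<phi> T = T" using assms by (intro map_complex_id) auto
  have "inj_on ?\<phi> (verts (cone_over b T))"
    using assms by (auto simp: verts_cone complex_empty inj_on_def)
  then have "pl_equiv T (cone_over b T) (map_complex ?\<phi> (cone_over b T))"
    using assms by (intro pl_equiv_relabel complex_cone) auto
  then show ?thesis by (simp add: map_complex_cone T)
qed

text \<open>Both sides accept exactly the faces that omit \<open>p\<close> or \<open>q\<close> and
  whose remainder without \<open>m\<close>, \<open>p\<close> and \<open>q\<close> lies in
  \<open>K\<close>. Read from right to left, a cone over a suspension is a double cone up to one
  subdivision.\<close>

lemma edge_subdivision_double_cone:
  assumes K: "abstract_complex K" "p \<notin> verts K" "q \<notin> verts K" "m \<notin> verts K"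
    and ne: "m \<noteq> p" "m \<noteq> q" "p \<noteq> q"
  shows "edge_subdivision p q m (cone_over p (cone_over q K)) = cone_over m (cone_over p K \<union> cone_over q K)"
proof (rule set_eqI)
  fix F
  have cq: "abstract_complex (cone_over q K)" "p \<notin> verts (cone_over q K)"
    using K ne by (auto simp: complex_cone verts_cone complex_empty)
  have cpq: "abstract_complex (cone_over p (cone_over q K))" "m \<notin> verts (cone_over p (cone_over q K))"
    using K ne cq by (auto simp: complex_cone verts_cone complex_empty)
  have cu: "abstract_complex (cone_over p K \<union> cone_over q K)" "m \<notin> verts (cone_over p K \<union> cone_over q K)"
    using K ne by (auto simp: complex_cone complex_Un verts_cone complex_empty)
  have l: "G \<in> cone_over p (cone_over q K) \<longleftrightarrow> G - {p} - {q} \<in> K" for G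
    using cone_iff[OF cq] cone_iff[OF K(1,3)] by simp
  have r: "F \<in> cone_over m (cone_over p K \<union> cone_over q K) \<longleftrightarrow> F - {m} - {p} \<in> K \<or> F - {m} - {q} \<in> K"
    using cone_iff[OF cu] cone_iff[OF K(1,2)] cone_iff[OF K(1,3)] by simp
  have p: "F - {m} - {p} \<in> K \<longleftrightarrow> q \<notin> F \<and> F - {m} - {p} - {q} \<in> K"
  proof -
    have "F - {m} - {p} - {q} = F - {m} - {p}" if "q \<notin> F" using that by auto
    moreover have "q \<notin> F" if "F - {m} - {p} \<in> K" using that K(3) ne by (auto simp: verts_def)
    ultimately show ?thesis by metis
  qed
  have q: "F - {m} - {q} \<in> K \<longleftrightarrow> p \<notin> F \<and> F - {m} - {p} - {q} \<in> K"
  proof -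
    have "F - {m} - {p} - {q} = F - {m} - {q}" if "p \<notin> F" using that by auto
    moreover have "p \<notin> F" if "F - {m} - {q} \<in> K" using that K(2) ne by (auto simp: verts_def)
    ultimately show ?thesis by metis
  qed
  have a: "(F - {m} \<union> {p, q}) - {p} - {q} = F - {m} - {p} - {q}" by auto
  show "F \<in> edge_subdivision p q m (cone_over p (cone_over q K)) \<longleftrightarrow>
      F \<in> cone_over m (cone_over p K \<union> cone_over q K)"
    unfolding edge_subdivision_iff[OF cpq ne(1,2)] r l a p q by auto
qed

text \<open>A ball that is PL homeomorphic to the cone over its boundary \<open>T\<close>, relative to \<open>T\<close>, gives
  a cone \<open>u * B\<close> which may be replaced by the cone \<open>w * \<partial>(u * B)\<close>: conjugating by the
  homeomorphism to \<open>b * T\<close>, this is the subdivision of the edge \<open>{u, b}\<close> in \<open>u * b * T\<close>.\<close>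

lemma pl_equiv_cone_boundary:
  assumes B: "abstract_complex B" "u \<notin> verts B" "w \<notin> verts B"
    and T: "abstract_complex T" "T \<subseteq> B" and uw: "u \<noteq> w"
    and b: "b \<notin> verts B" "b \<noteq> u" "b \<noteq> w" and e: "pl_equiv T B (cone_over b T)"
  shows "pl_equiv (B \<union> cone_over u T) (cone_over w (B \<union> cone_over u T)) (cone_over u B)"
proof -
  let ?bT = "cone_over b T" and ?uT = "cone_over u T"
  have vT: "u \<notin> verts T" "w \<notin> verts T" "b \<notin> verts T" using B b T by (auto simp: verts_def)
  note [simp] = B T vT complex_cone complex_Un verts_cone complex_empty
  obtain g where g: "pl_homeo B ?bT g" "\<And>x. x \<in> realization T \<Longrightarrow> g x = x"
    using e unfolding pl_equiv_def by blast
  have "B \<inter> ?uT \<subseteq> T" "T \<subseteq> B \<inter> ?uT" "?bT \<inter> ?uT = T"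
    using B T(2)[THEN subsetD] vT b by (auto simp: cone_over_def verts_def)
  then have I: "B \<inter> ?uT = T" "?bT \<inter> ?uT = T" by blast+
  \<comment> \<open>Since \<open>g\<close> fixes \<open>T\<close>, it extends by the identity over
    \<open>cone_over u T\<close>, that is, to the whole boundary of
    \<open>cone_over u B\<close>.\<close>
  define g' where "g' = (\<lambda>x. if x \<in> realization B then g x else id x)"
  have "pl_homeo (B \<union> ?uT) (?bT \<union> ?uT) g'"
    unfolding g'_def
  proof (rule pl_homeo_glue[OF _ _ _ _ g(1)])
    show "pl_homeo ?uT ?uT id" by (intro pl_homeo_linear) (auto intro: linear_id)
  qed (auto simp: I g(2))
  then have h1: "pl_homeo (cone_over w (B \<union> ?uT)) (cone_over w (?bT \<union> ?uT)) (cone_map w w g')"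
    using uw b by (intro pl_homeo_cone) auto
  have "edge_subdivision b u w (cone_over b ?uT) = cone_over w (?bT \<union> ?uT)"
    using uw b by (intro edge_subdivision_double_cone) auto
  moreover have "cone_over b ?uT = cone_over u ?bT"
    by (auto simp: cone_over_def insert_commute)
  ultimately have h2: "pl_homeo (cone_over w (?bT \<union> ?uT)) (cone_over u ?bT) (edge_midpoint_map b u w)"
    using pl_homeo_edge_subdivision[of "cone_over b ?uT" w b u] uw b by auto
  let ?h = "inv_into (realization B) g"
  have h3: "pl_homeo (cone_over u ?bT) (cone_over u B) (cone_map u u ?h)"
    using b pl_homeo_inv_into[OF g(1)] by (intro pl_homeo_cone) auto
  have gB: "g x \<in> realization ?bT" if "x \<in> realization B" for x
    using g(1) that unfolding pl_homeo_def by (auto simp: bij_betw_def)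
  have hg: "?h (g x) = x" if "x \<in> realization B" for x
    using g(1) that unfolding pl_homeo_def by (auto simp: bij_betw_inv_into_left)
  let ?F = "cone_map u u ?h \<circ> edge_midpoint_map b u w \<circ> cone_map w w g'"
  \<comment> \<open>The subdivision map does nothing where the \<open>w\<close>-coordinate is
    \<open>0\<close>. On \<open>B\<close> the maps \<open>g\<close> and its inverse then cancel; on
    \<open>cone_over u T\<close> both act trivially because \<open>g\<close> fixes
    \<open>T\<close>.\<close>
  have "?F x = x" if x: "x \<in> realization (B \<union> ?uT)" for x
  proof -
    have w0: "coord x w = 0" using x uw by (intro coord_outside_verts[of "B \<union> ?uT"]) auto
    show ?thesis
    proof (cases "x \<in> realization B")
      case True
      have "coord (g x) w = 0" "coord (g x) u = 0"
        using gB[OF True] b by (auto intro!: coord_outside_verts[of ?bT])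
      then show ?thesis
        using w0 True hg by (simp add: cone_map_base g'_def edge_midpoint_map_def)
    next
      case False
      then have xu: "x \<in> realization ?uT" using x by (simp add: realization_Un)
      have "cone_map u u ?h x = x"
      proof (cases rule: cone_pointE[OF T(1) vT(1) xu])
        case (2 t y)
        have "y \<in> realization B" using 2 realization_mono[OF T(2)] by blast
        then have "?h y = y" using hg[of y] g(2)[of y] 2 by simp
        moreover have "coord y u = 0" using 2 by (intro coord_outside_verts[of T]) auto
        ultimately show ?thesis by (simp add: 2(4) cone_map_point)
      qed simp
      then show ?thesis
        using w0 False by (simp add: cone_map_base g'_def edge_midpoint_map_def)
    qed
  qed
  moreover have "pl_homeo (cone_over w (B \<union> ?uT)) (cone_over u B) ?F"
    using h1 h2 h3 by (blast intro: pl_homeo_compose)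
  ultimately show ?thesis unfolding pl_equiv_def by blast
qed

section \<open>Balls and spheres\<close>

lemma pl_equiv_commute: "pl_equiv {{}} K L \<Longrightarrow> abstract_complex K \<Longrightarrow> pl_equiv {{}} L K"
  by (rule pl_equiv_sym) (simp_all add: complex_empty)

text \<open>The index is the number of vertices of a facet for spheres, so that \<open>{{}}\<close> is the sphere with
  index \<open>0\<close>, and the dimension for balls.\<close>

definition sphere_complex :: "nat \<Rightarrow> nat set set \<Rightarrow> bool" where
  "sphere_complex n K \<longleftrightarrow> abstract_complex K \<and>
     (\<exists>A. finite A \<and> card A = Suc n \<and> pl_equiv {{}} K (Pow A - {A}))"

definition ball_complex :: "nat \<Rightarrow> nat set set \<Rightarrow> bool" where
  "ball_complex n K \<longleftrightarrow> abstract_complex K \<and>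
     (\<exists>A. finite A \<and> card A = Suc n \<and> pl_equiv {{}} K (Pow A))"

lemma complex_Pow: "finite A \<Longrightarrow> abstract_complex (Pow A)"
  by (auto simp: abstract_complex_def intro: finite_subset)

lemma complex_Pow_boundary: "finite A \<Longrightarrow> A \<noteq> {} \<Longrightarrow> abstract_complex (Pow A - {A})"
  by (auto simp: abstract_complex_def intro: finite_subset)

lemma verts_Pow [simp]: "verts (Pow A) = A"
  by (auto simp: verts_def)

lemma verts_Pow_boundary: "verts (Pow A - {A}) \<subseteq> A"
  by (auto simp: verts_def)

lemma pl_equiv_Pow:
  assumes "finite A" "finite A'" "card A = card A'"
  shows "pl_equiv {{}} (Pow A) (Pow A')"
    and "A \<noteq> {} \<Longrightarrow> pl_equiv {{}} (Pow A - {A}) (Pow A' - {A'})"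
proof -
  obtain \<phi> where \<phi>: "bij_betw \<phi> A A'" using assms finite_same_card_bij by blast
  then have inj: "inj_on \<phi> A" and img: "\<phi> ` A = A'" by (auto simp: bij_betw_def)
  have m: "map_complex \<phi> (Pow A) = Pow A'"
    using img image_Pow_surj unfolding map_complex_def by blast
  show "pl_equiv {{}} (Pow A) (Pow A')"
    using pl_equiv_relabel[of "Pow A" \<phi> "{{}}"] complex_Pow[OF assms(1)] inj m by (simp add: verts_def)
  assume ne: "A \<noteq> {}"
  have "map_complex \<phi> (Pow A - {A}) = map_complex \<phi> (Pow A) - {A'}"
  proof -
    have "\<phi> ` F \<noteq> A'" if "F \<in> Pow A - {A}" for F
      using that inj img inj_on_image_eq_iff[of \<phi> A F A] by auto
    then show ?thesis unfolding map_complex_def using img by auto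
  qed
  then show "pl_equiv {{}} (Pow A - {A}) (Pow A' - {A'})"
    using pl_equiv_relabel[of "Pow A - {A}" \<phi> "{{}}"] complex_Pow_boundary[OF assms(1) ne] m
      inj_on_subset[OF inj verts_Pow_boundary] by (simp add: verts_def)
qed

lemma sphere_complexD:
  assumes "sphere_complex n K" "finite A" "card A = Suc n"
  shows "pl_equiv {{}} K (Pow A - {A})"
proof -
  obtain A' where A': "finite A'" "card A' = Suc n" "pl_equiv {{}} K (Pow A' - {A'})"
    using assms(1) unfolding sphere_complex_def by blast
  then have "A' \<noteq> {}" by auto
  then show ?thesis using A' assms pl_equiv_Pow(2)[of A' A] pl_equiv_trans by auto
qed

lemma ball_complexD:
  assumes "ball_complex n K" "finite A" "card A = Suc n"
  shows "pl_equiv {{}} K (Pow A)"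
proof -
  obtain A' where A': "finite A'" "card A' = Suc n" "pl_equiv {{}} K (Pow A')"
    using assms(1) unfolding ball_complex_def by blast
  then show ?thesis using assms pl_equiv_Pow(1)[of A' A] pl_equiv_trans by auto
qed

lemma sphere_complex_imp_pl_sphere:
  assumes "sphere_complex (Suc d) K"
  shows "pl_sphere d K"
proof -
  have "pl_equiv {{}} K (simplex_boundary (d + 1))"
    unfolding simplex_boundary_def using sphere_complexD[OF assms, of "{..d + 1}"] by simp
  then show ?thesis
    using assms pl_homeo_imp_pl_homeomorphic unfolding pl_sphere_def pl_equiv_def sphere_complex_def by blast
qed

lemma ball_complex_imp_pl_ball:
  assumes "ball_complex d K"
  shows "pl_ball d K"
proof -
  have "pl_equiv {{}} K (simplex_complex d)"
    unfolding simplex_complex_def using ball_complexD[OF assms, of "{..d}"] by simp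
  then show ?thesis
    using assms pl_homeo_imp_pl_homeomorphic unfolding pl_ball_def pl_equiv_def ball_complex_def by blast
qed

lemma sphere_complex_cong:
  "abstract_complex K \<Longrightarrow> pl_equiv {{}} K L \<Longrightarrow> sphere_complex n L \<Longrightarrow> sphere_complex n K"
  unfolding sphere_complex_def using pl_equiv_trans by blast

lemma ball_complex_cong:
  "abstract_complex K \<Longrightarrow> pl_equiv {{}} K L \<Longrightarrow> ball_complex n L \<Longrightarrow> ball_complex n K"
  unfolding ball_complex_def using pl_equiv_trans by blast

lemma pl_equiv_map_complex:
  assumes "abstract_complex K" "inj_on \<phi> (verts K)"
  shows "pl_equiv {{}} (map_complex \<phi> K) K"
  by (rule pl_equiv_commute[OF pl_equiv_relabel]) (use assms in \<open>auto simp: verts_def\<close>)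

lemma sphere_complex_map:
  "sphere_complex n K \<Longrightarrow> inj_on \<phi> (verts K) \<Longrightarrow> sphere_complex n (map_complex \<phi> K)"
  by (rule sphere_complex_cong[OF complex_map pl_equiv_map_complex]) (simp_all add: sphere_complex_def)

lemma ball_complex_map:
  "ball_complex n K \<Longrightarrow> inj_on \<phi> (verts K) \<Longrightarrow> ball_complex n (map_complex \<phi> K)"
  by (rule ball_complex_cong[OF complex_map pl_equiv_map_complex]) (simp_all add: ball_complex_def)

lemma ball_complex_Pow: "finite A \<Longrightarrow> card A = Suc n \<Longrightarrow> ball_complex n (Pow A)"
  unfolding ball_complex_def using complex_Pow pl_equiv_refl by blast

lemma sphere_complex_empty: "sphere_complex 0 {{}}"
proof -
  have "Pow {0::nat} - {{0}} = {{}}" by auto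
  then have "pl_equiv {{}} {{}} (Pow {0::nat} - {{0}})" by (simp add: pl_equiv_refl)
  then show ?thesis unfolding sphere_complex_def by (intro conjI exI[of _ "{0}"]) auto
qed

section \<open>Cones and suspensions of balls and spheres\<close>

lemma pl_equiv_Pow_cone:
  assumes "pl_equiv {{}} K L" "abstract_complex K" "abstract_complex L" "v \<notin> verts K" "v \<notin> verts L"
  shows "pl_equiv {{}} (cone_over v K) (cone_over v L)"
  using pl_equiv_cone[of K v L "{{}}"] assms complex_empty[of K]
  by (auto simp: cone_over_def intro: pl_equiv_mono)

lemma ball_complex_cone:
  assumes "ball_complex n K" "v \<notin> verts K"
  shows "ball_complex (Suc n) (cone_over v K)"
proof -
  have K: "abstract_complex K" using assms(1) by (simp add: ball_complex_def)
  obtain A where A: "finite A" "card A = Suc n" "A \<subseteq> - {v}"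
    using infinite_arbitrarily_large[of "- {v}" "Suc n"] by auto
  then have vA: "v \<notin> A" by auto
  have "pl_equiv {{}} (cone_over v K) (cone_over v (Pow A))"
    using ball_complexD[OF assms(1) A(1,2)] K assms(2) A complex_Pow
    by (intro pl_equiv_Pow_cone) auto
  also have "cone_over v (Pow A) = Pow (insert v A)" by (simp add: cone_over_def Pow_insert)
  finally show ?thesis
    unfolding ball_complex_def using A vA complex_cone[OF K]
    by (intro conjI exI[of _ "insert v A"]) auto
qed

text \<open>Removing a vertex \<open>m\<close> from \<open>A\<close> and adding \<open>p\<close> and
  \<open>q\<close> gives a simplex with one vertex more. Subdividing the edge \<open>{p, q}\<close>
  of its boundary at \<open>m\<close> yields exactly the suspension of the boundary of
  \<open>A\<close>.\<close>

lemma suspension_simplex_boundary: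
  assumes "finite A" "A \<noteq> {}" "p \<notin> A" "q \<notin> A" "p \<noteq> q"
  obtains A' where "finite A'" "card A' = Suc (card A)"
    "pl_equiv {{}} (cone_over p (Pow A - {A}) \<union> cone_over q (Pow A - {A})) (Pow A' - {A'})"
proof -
  obtain m where m: "m \<in> A" using assms by blast
  define W where "W = A - {m}"
  have A: "A = insert m W" "m \<notin> W" using m by (auto simp: W_def)
  have ne: "m \<noteq> p" "m \<noteq> q" using m assms by auto
  define A' where "A' = insert p (insert q W)"
  let ?b = "Pow A' - {A'}"
  have "m \<notin> A'" using ne by (simp add: A'_def W_def)
  then have A': "finite A'" "A' \<noteq> {}" "m \<notin> verts ?b"
    using assms(1) verts_Pow_boundary[of A'] by (simp add: A'_def W_def, simp add: A'_def, blast)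
  have "finite W" "p \<notin> W" "q \<notin> W" using assms by (auto simp: W_def)
  then have card: "card A' = Suc (card A)"
    using assms(5) A by (simp add: A'_def)
  have "edge_subdivision p q m ?b = cone_over p (Pow A - {A}) \<union> cone_over q (Pow A - {A})"
  proof (rule set_eqI)
    fix F
    have vb: "verts (Pow A - {A}) \<subseteq> A" by (rule verts_Pow_boundary)
    have c: "F \<in> cone_over x (Pow A - {A}) \<longleftrightarrow> F - {x} \<subseteq> A \<and> F - {x} \<noteq> A" if "x \<notin> A" for x
      using cone_iff[of "Pow A - {A}" x F] complex_Pow_boundary assms that vb by auto
    have "F \<in> edge_subdivision p q m ?b \<longleftrightarrow>
        \<not> {p, q} \<subseteq> F \<and> (if m \<in> F then F - {m} \<union> {p, q} \<subseteq> A' \<and> F - {m} \<union> {p, q} \<noteq> A' else F \<subseteq> A' \<and> F \<noteq> A')"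
      using edge_subdivision_iff[OF complex_Pow_boundary[OF A'(1,2)] A'(3) ne] by auto
    also have "\<dots> \<longleftrightarrow> \<not> {p, q} \<subseteq> F \<and> F \<subseteq> insert p (insert q A) \<and> \<not> A \<subseteq> F"
    proof (cases "m \<in> F")
      case True
      have "F - {m} \<union> {p, q} \<subseteq> A' \<longleftrightarrow> F \<subseteq> insert p (insert q A)"
        using ne A True by (auto simp: A'_def)
      moreover have "F - {m} \<union> {p, q} = A' \<longleftrightarrow> A \<subseteq> F" if "F \<subseteq> insert p (insert q A)"
        using ne A assms(3,4) True that by (auto simp: A'_def)
      ultimately show ?thesis using True by auto
    next
      case False
      have "F \<subseteq> A' \<longleftrightarrow> F \<subseteq> insert p (insert q A)" using ne A False by (auto simp: A'_def)
      moreover have "\<not> {p, q} \<subseteq> F \<Longrightarrow> F \<noteq> A'" by (auto simp: A'_def)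
      moreover have "\<not> A \<subseteq> F" using False m by auto
      ultimately show ?thesis using False by auto
    qed
    also have "\<dots> \<longleftrightarrow> F - {p} \<subseteq> A \<and> F - {p} \<noteq> A \<or> F - {q} \<subseteq> A \<and> F - {q} \<noteq> A"
    proof -
      have "F - {x} \<subseteq> A \<and> F - {x} \<noteq> A \<longleftrightarrow> F \<subseteq> insert x A \<and> \<not> A \<subseteq> F" if "x \<notin> A" for x
        using that by auto
      moreover have "\<not> {p, q} \<subseteq> F \<and> F \<subseteq> insert p (insert q A) \<longleftrightarrow> F \<subseteq> insert p A \<or> F \<subseteq> insert q A"
        using assms(3-5) by auto
      ultimately show ?thesis using assms(3,4) by auto
    qed
    finally show "F \<in> edge_subdivision p q m ?b \<longleftrightarrow>
        F \<in> cone_over p (Pow A - {A}) \<union> cone_over q (Pow A - {A})"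
      using c assms by auto
  qed
  moreover have "pl_equiv {{}} (edge_subdivision p q m ?b) ?b"
    using A' ne assms by (intro pl_equiv_edge_subdivision complex_Pow_boundary) (auto simp: verts_def)
  ultimately show ?thesis using that[OF A'(1) card] by simp
qed

lemma sphere_complex_suspension:
  assumes "sphere_complex n K" "p \<notin> verts K" "q \<notin> verts K" "p \<noteq> q"
  shows "sphere_complex (Suc n) (cone_over p K \<union> cone_over q K)"
proof -
  have K: "abstract_complex K" using assms(1) by (simp add: sphere_complex_def)
  obtain A where A: "finite A" "card A = Suc n" "A \<subseteq> - {p, q}"
    using infinite_arbitrarily_large[of "- {p, q}" "Suc n"] by auto
  have ne: "A \<noteq> {}" using A by auto
  obtain A' where A': "finite A'" "card A' = Suc (card A)"
    "pl_equiv {{}} (cone_over p (Pow A - {A}) \<union> cone_over q (Pow A - {A})) (Pow A' - {A'})"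
    by (rule suspension_simplex_boundary[of A p q]) (use A ne assms in auto)
  have "pl_equiv {{}} (cone_over p K \<union> cone_over q K) (cone_over p (Pow A - {A}) \<union> cone_over q (Pow A - {A}))"
    using sphere_complexD[OF assms(1) A(1,2)] K assms A(3) complex_Pow_boundary[OF A(1) ne] verts_Pow_boundary[of A]
    by (intro pl_equiv_suspension) auto
  then have "pl_equiv {{}} (cone_over p K \<union> cone_over q K) (Pow A' - {A'})"
    using A'(3) pl_equiv_trans by blast
  then show ?thesis
    unfolding sphere_complex_def using A' A(2) K by (auto intro: complex_Un complex_cone)
qed

text \<open>Up to equivalence the sphere is the suspension of a simplex boundary \<open>b\<close>
  one dimension lower, with poles \<open>p\<close> and \<open>q\<close>. The cone over it is an edge
  subdivision of the double cone on \<open>b\<close> with apices \<open>p\<close> and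
  \<open>q\<close>; there the inner cone is a ball by induction, and a cone over a ball is a
  ball.\<close>

lemma ball_complex_cone_sphere:
  assumes "sphere_complex n K" "v \<notin> verts K"
  shows "ball_complex n (cone_over v K)"
  using assms
proof (induction n arbitrary: v K)
  case 0
  have K: "abstract_complex K" using 0 by (simp add: sphere_complex_def)
  obtain A :: "nat set" where A: "finite A" "card A = 1" "v \<notin> A"
    by (rule that[of "{Suc v}"]) auto
  have "pl_equiv {{}} K {{}}"
  proof -
    obtain a where "A = {a}" using A(2) card_1_singletonE by blast
    then have "Pow A - {A} = {{}}" by auto
    then show ?thesis using sphere_complexD[OF 0(1) A(1)] A(2) by simp
  qed
  then have "pl_equiv {{}} (cone_over v K) (cone_over v {{}})"
    using K 0 by (intro pl_equiv_Pow_cone) (auto simp: verts_def)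
  moreover have "cone_over v {{}} = Pow {v}" by (auto simp: cone_over_def)
  ultimately show ?case
    using K ball_complex_cong[OF complex_cone[OF K]] ball_complex_Pow[of "{v}" 0] by auto
next
  case (Suc n)
  have K: "abstract_complex K" using Suc.prems by (simp add: sphere_complex_def)
  obtain A where A: "finite A" "card A = Suc n" "A \<subseteq> - {v}"
    using infinite_arbitrarily_large[of "- {v}" "Suc n"] by auto
  have "infinite (- insert v A)" using A by simp
  then obtain p where p: "p \<notin> A" "p \<noteq> v" using ex_new_if_finite[of "insert v A"] A by auto
  obtain q where q: "q \<notin> A" "q \<noteq> v" "q \<noteq> p" using ex_new_if_finite[of "insert p (insert v A)"] A by auto
  have ne: "A \<noteq> {}" using A by auto
  let ?b = "Pow A - {A}"
  have b: "abstract_complex ?b" "v \<notin> verts ?b" "p \<notin> verts ?b" "q \<notin> verts ?b"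
    using complex_Pow_boundary[OF A(1) ne] verts_Pow_boundary[of A] A p q by auto
  have sb: "sphere_complex n ?b"
    unfolding sphere_complex_def using A b pl_equiv_refl by blast
  obtain A' where A': "finite A'" "card A' = Suc (card A)"
    "pl_equiv {{}} (cone_over p ?b \<union> cone_over q ?b) (Pow A' - {A'})"
    by (rule suspension_simplex_boundary[of A p q]) (use A ne p q in auto)
  let ?s = "cone_over p ?b \<union> cone_over q ?b"
  have s: "abstract_complex ?s" using b by (intro complex_Un complex_cone)
  have vs: "v \<notin> verts ?s"
    using b p q verts_cone[OF complex_empty[OF b(1)]] by auto
  have "pl_equiv {{}} ?s K"
  proof -
    have "pl_equiv {{}} K (Pow A' - {A'})"
      using A' A by (intro sphere_complexD[OF Suc.prems(1)]) auto
    then have "pl_equiv {{}} (Pow A' - {A'}) K" by (rule pl_equiv_commute) (rule K)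
    then show ?thesis using A'(3) pl_equiv_trans by blast
  qed
  then have "pl_equiv {{}} K ?s" by (rule pl_equiv_commute) (rule s)
  then have "pl_equiv {{}} (cone_over v K) (cone_over v ?s)"
    using K s vs Suc.prems by (intro pl_equiv_Pow_cone)
  moreover have "pl_equiv {{}} (cone_over v ?s) (cone_over p (cone_over q ?b))"
  proof -
    have "edge_subdivision p q v (cone_over p (cone_over q ?b)) = cone_over v ?s"
      using b p q by (intro edge_subdivision_double_cone) auto
    moreover have "v \<notin> verts (cone_over p (cone_over q ?b))"
      using b p q by (auto simp: verts_cone[OF complex_empty[OF b(1)]]
          verts_cone[OF complex_empty[OF complex_cone[OF b(1)]]])
    ultimately show ?thesis
      using pl_equiv_edge_subdivision[of "cone_over p (cone_over q ?b)" v p q "{{}}"] b p q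
      by (auto simp: complex_cone verts_def)
  qed
  moreover have "ball_complex (Suc n) (cone_over p (cone_over q ?b))"
    using Suc.IH[OF sb b(4)] b p q by (intro ball_complex_cone) (auto simp: verts_cone[OF complex_empty[OF b(1)]])
  ultimately show ?case
    using ball_complex_cong[OF complex_cone[OF K]] pl_equiv_trans by blast
qed

section \<open>Pseudomanifolds\<close>

text \<open>The vertices of the link of \<open>G\<close>. If \<open>G\<close> is a ridge, they
  correspond to the facets containing it, so facets can be counted as vertices.\<close>

definition nbrs :: "'a set set \<Rightarrow> 'a set \<Rightarrow> 'a set" where
  "nbrs K G = {x. x \<notin> G \<and> insert x G \<in> K}"

text \<open>Facets have \<open>n\<close> vertices; \<open>M\<close> collects the boundary faces, so \<open>M = {}\<close> means closed.\<close>

definition pseudomanifold :: "nat \<Rightarrow> 'a set set \<Rightarrow> 'a set set \<Rightarrow> bool" where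
  "pseudomanifold n K M \<longleftrightarrow> (\<forall>F\<in>K. \<exists>H\<in>K. F \<subseteq> H \<and> card H = n) \<and>
     (\<forall>G\<in>K. Suc (card G) = n \<longrightarrow> card (nbrs K G) = (if G \<in> M then 1 else 2))"

lemma pseudomanifoldI:
  assumes "\<And>F. F \<in> K \<Longrightarrow> \<exists>H\<in>K. F \<subseteq> H \<and> card H = n"
    and "\<And>G. G \<in> K \<Longrightarrow> Suc (card G) = n \<Longrightarrow> card (nbrs K G) = (if G \<in> M then 1 else 2)"
  shows "pseudomanifold n K M"
  using assms unfolding pseudomanifold_def by blast

lemma pseudomanifold_pure:
  assumes "pseudomanifold n K M" "F \<in> K"
  obtains H where "H \<in> K" "F \<subseteq> H" "card H = n"
  using assms unfolding pseudomanifold_def by blast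

lemma pseudomanifold_pure_ex:
  "pseudomanifold n K M \<Longrightarrow> F \<in> K \<Longrightarrow> \<exists>H\<in>K. F \<subseteq> H \<and> card H = n"
  by (simp add: pseudomanifold_def)

lemma pseudomanifold_card_nbrs:
  "pseudomanifold n K M \<Longrightarrow> G \<in> K \<Longrightarrow> Suc (card G) = n \<Longrightarrow> card (nbrs K G) = (if G \<in> M then 1 else 2)"
  unfolding pseudomanifold_def by blast

lemma pseudomanifold_card_le:
  assumes "abstract_complex K" "pseudomanifold n K M" "F \<in> K"
  shows "card F \<le> n"
  using pseudomanifold_pure[OF assms(2,3)] complex_finite_face[OF assms(1)] card_mono by metis

lemma finite_nbrs:
  assumes "abstract_complex K"
  shows "finite (nbrs K G)"
proof (rule finite_subset)
  show "nbrs K G \<subseteq> verts K" by (auto simp: nbrs_def verts_def)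
qed (rule complex_finite_verts[OF assms])

lemma nbrs_outside: "abstract_complex K \<Longrightarrow> G \<notin> K \<Longrightarrow> nbrs K G = {}"
  using complex_subset[of K _ G] by (auto simp: nbrs_def)

lemma nbrs_Un: "nbrs (K \<union> L) G = nbrs K G \<union> nbrs L G"
  by (auto simp: nbrs_def)

text \<open>A ridge avoiding \<open>v\<close> is a facet of \<open>K\<close> and extends only by
  \<open>v\<close>; a ridge through \<open>v\<close> has the same neighbours as its trace on
  \<open>K\<close>. For \<open>M = {}\<close> only the base remains as boundary, since the cone over
  the empty family is empty.\<close>

lemma pseudomanifold_cone:
  assumes K: "abstract_complex K" "v \<notin> verts K" and M: "M \<subseteq> K" and pm: "pseudomanifold n K M"
  shows "pseudomanifold (Suc n) (cone_over v K) (K \<union> cone_over v M)"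
proof (rule pseudomanifoldI)
  have vK: "v \<notin> F" if "F \<in> K" for F using that K by (auto simp: verts_def)
  fix F assume "F \<in> cone_over v K"
  then have "F - {v} \<in> K" using K by (simp add: cone_iff)
  then obtain H where H: "H \<in> K" "F - {v} \<subseteq> H" "card H = n" by (rule pseudomanifold_pure[OF pm])
  then show "\<exists>H\<in>cone_over v K. F \<subseteq> H \<and> card H = Suc n"
    using vK[OF H(1)] complex_finite_face[OF K(1) H(1)]
    by (intro bexI[of _ "insert v H"]) (auto simp: cone_over_def)
next
  have vK: "v \<notin> F" if "F \<in> K" for F using that K by (auto simp: verts_def)
  fix G assume G: "G \<in> cone_over v K" "Suc (card G) = Suc n"
  have fin: "finite G" using complex_finite_face[OF complex_cone[OF K(1)] G(1)] .
  show "card (nbrs (cone_over v K) G) = (if G \<in> K \<union> cone_over v M then 1 else 2)"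
  proof (cases "v \<in> G")
    case False
    then have GK: "G \<in> K" using G K by (simp add: cone_iff)
    have "nbrs (cone_over v K) G = {v}"
    proof -
      have "insert x G \<notin> K" if "x \<notin> G" for x
        using pseudomanifold_card_le[OF K(1) pm, of "insert x G"] that fin G(2) by auto
      then have "insert x G \<in> cone_over v K \<longleftrightarrow> x = v" if "x \<notin> G" for x
      proof (cases "x = v")
        case True
        have "insert v G - {v} = G" using False by auto
        then show ?thesis using True GK by (simp add: cone_iff[OF K])
      next
        case ne: False
        then have "insert x G - {v} = insert x G" using False by auto
        then show ?thesis using ne that \<open>\<And>x. x \<notin> G \<Longrightarrow> insert x G \<notin> K\<close> by (simp add: cone_iff[OF K])
      qed
      then show ?thesis using False by (auto simp: nbrs_def)
    qed
    then show ?thesis using GK by simp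
  next
    case True
    let ?G = "G - {v}"
    have "?G \<in> K" using G K by (simp add: cone_iff)
    moreover have "Suc (card ?G) = n" using card_Suc_Diff1[OF fin True] G(2) by linarith
    moreover have "G = insert v ?G" using True by blast
    ultimately have G': "?G \<in> K" "Suc (card ?G) = n" "G = insert v ?G" .
    have "nbrs (cone_over v K) G = nbrs K ?G"
    proof -
      have "insert x G - {v} = insert x ?G" if "x \<notin> G" for x using that True by auto
      moreover have "x \<noteq> v" if "insert x ?G \<in> K" for x using vK[OF that] by auto
      ultimately show ?thesis
        using True by (auto simp: nbrs_def cone_iff[OF K])
    qed
    moreover have "G \<in> K \<union> cone_over v M \<longleftrightarrow> ?G \<in> M"
    proof -
      have GK: "G \<notin> K" using vK True by blast
      show ?thesis
      proof
        assume "G \<in> K \<union> cone_over v M"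
        then obtain H where H: "H \<in> M" "G = insert v H" using GK M by (auto simp: cone_over_def)
        moreover have "v \<notin> H" using vK H(1) M by blast
        ultimately show "?G \<in> M" by simp
      next
        assume "?G \<in> M"
        then have "insert v ?G \<in> cone_over v M" unfolding cone_over_def by blast
        then show "G \<in> K \<union> cone_over v M" unfolding G'(3)[symmetric] by blast
      qed
    qed
    ultimately show ?thesis using pseudomanifold_card_nbrs[OF pm G'(1,2)] by simp
  qed
qed

text \<open>The bound on \<open>card F\<close> excludes common facets, so a ridge in
  \<open>X\<close> receives one facet from each side. Every other ridge lies on one side
  only.\<close>

lemma pseudomanifold_Un:
  assumes KL: "abstract_complex K" "abstract_complex L" and X: "K \<inter> L = X" "\<And>F. F \<in> X \<Longrightarrow> card F < n"
    and pm: "pseudomanifold n K X" "pseudomanifold n L X"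
  shows "pseudomanifold n (K \<union> L) {}"
proof (rule pseudomanifoldI)
  fix F assume "F \<in> K \<union> L"
  then show "\<exists>H\<in>K \<union> L. F \<subseteq> H \<and> card H = n"
    using pseudomanifold_pure_ex[OF pm(1), of F] pseudomanifold_pure_ex[OF pm(2), of F] by blast
next
  fix G assume G: "G \<in> K \<union> L" "Suc (card G) = n"
  show "card (nbrs (K \<union> L) G) = (if G \<in> {} then 1 else 2)"
  proof (cases "G \<in> X")
    case True
    then have GKL: "G \<in> K" "G \<in> L" using X by auto
    have "nbrs K G \<inter> nbrs L G = {}"
    proof -
      have False if "x \<notin> G" "insert x G \<in> K" "insert x G \<in> L" for x
        using X(2)[of "insert x G"] X(1) that G(2) complex_finite_face[OF KL(1) GKL(1)] by auto
      then show ?thesis by (auto simp: nbrs_def)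
    qed
    then have "card (nbrs (K \<union> L) G) = card (nbrs K G) + card (nbrs L G)"
      unfolding nbrs_Un by (intro card_Un_disjoint finite_nbrs KL)
    then show ?thesis
      using pseudomanifold_card_nbrs[OF pm(1) GKL(1) G(2)] pseudomanifold_card_nbrs[OF pm(2) GKL(2) G(2)] True
      by simp
  next
    case False
    then consider "G \<in> K" "G \<notin> L" | "G \<in> L" "G \<notin> K" using G X by blast
    then show ?thesis
      using False pseudomanifold_card_nbrs[OF pm(1) _ G(2)] pseudomanifold_card_nbrs[OF pm(2) _ G(2)]
        nbrs_outside[OF KL(1)] nbrs_outside[OF KL(2)] by cases (simp_all add: nbrs_Un)
  qed
qed

text \<open>Over a ridge of \<open>L\<close> the exchange can alter the count only if the ridge lies
  in \<open>X\<close>, and there \<open>P\<close> and \<open>P'\<close> contribute one facet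
  each.\<close>

lemma pseudomanifold_replace:
  assumes cplx: "abstract_complex L" "abstract_complex P" "abstract_complex P'"
    and X: "L \<inter> P = X" "L \<inter> P' = X" "\<And>F. F \<in> X \<Longrightarrow> card F < n"
    and pm: "pseudomanifold n (L \<union> P) M" "pseudomanifold n P X" "pseudomanifold n P' X" and M: "M \<subseteq> L"
  shows "pseudomanifold n (L \<union> P') M"
proof (rule pseudomanifoldI)
  fix F assume F: "F \<in> L \<union> P'"
  show "\<exists>H\<in>L \<union> P'. F \<subseteq> H \<and> card H = n"
  proof (cases "F \<in> P'")
    case True
    then show ?thesis using pseudomanifold_pure_ex[OF pm(3), of F] by blast
  next
    case False
    then have FL: "F \<in> L" using F by simp
    then have "F \<in> L \<union> P" by simp
    then obtain H where H: "H \<in> L \<union> P" "F \<subseteq> H" "card H = n" by (rule pseudomanifold_pure[OF pm(1)])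
    have "H \<in> L"
    proof (rule ccontr)
      assume "H \<notin> L"
      then have "F \<in> P" using H complex_subset[OF cplx(2)] by blast
      then show False using FL False X by blast
    qed
    then show ?thesis using H by blast
  qed
next
  fix G assume G: "G \<in> L \<union> P'" "Suc (card G) = n"
  have disj: "nbrs L G \<inter> nbrs Q G = {}" if Q: "abstract_complex Q" "L \<inter> Q = X" for Q
  proof -
    have False if x: "x \<notin> G" "insert x G \<in> L" "insert x G \<in> Q" for x
    proof -
      have "finite (insert x G)" using complex_finite_face[OF cplx(1) x(2)] .
      then have "card (insert x G) = n" using x(1) G(2) by simp
      moreover have "insert x G \<in> X" using Q(2) x by blast
      ultimately show False using X(3) by fastforce
    qed
    then show ?thesis by (auto simp: nbrs_def)
  qed
  have card: "card (nbrs (L \<union> Q) G) = card (nbrs L G) + card (nbrs Q G)"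
    if "abstract_complex Q" "L \<inter> Q = X" for Q
    unfolding nbrs_Un using that cplx(1) by (intro card_Un_disjoint finite_nbrs disj)
  show "card (nbrs (L \<union> P') G) = (if G \<in> M then 1 else 2)"
  proof (cases "G \<in> L")
    case True
    have "card (nbrs P G) = card (nbrs P' G)"
    proof (cases "G \<in> X")
      case True
      then have "G \<in> P" "G \<in> P'" using X by auto
      then show ?thesis
        using pseudomanifold_card_nbrs[OF pm(2) _ G(2)] pseudomanifold_card_nbrs[OF pm(3) _ G(2)] by simp
    next
      case False
      then have "G \<notin> P" "G \<notin> P'" using X \<open>G \<in> L\<close> by auto
      then show ?thesis using nbrs_outside cplx by metis
    qed
    then have "card (nbrs (L \<union> P') G) = card (nbrs (L \<union> P) G)"
      using card cplx X by simp
    then show ?thesis using pseudomanifold_card_nbrs[OF pm(1) _ G(2)] True by simp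
  next
    case False
    then have "G \<in> P'" "G \<notin> X" "G \<notin> M" using G X M by auto
    then show ?thesis
      using pseudomanifold_card_nbrs[OF pm(3) _ G(2)] nbrs_outside[OF cplx(1) False]
      by (simp add: nbrs_Un)
  qed
qed

lemma pseudomanifold_edge_subdivision:
  assumes K: "abstract_complex K" "m \<notin> verts K" "m \<noteq> p" "m \<noteq> q" and pq: "p \<noteq> q"
    and M: "\<And>F. F \<in> M \<Longrightarrow> \<not> {p, q} \<subseteq> F" "M \<subseteq> K" and pm: "pseudomanifold n K M"
  shows "pseudomanifold n (edge_subdivision p q m K) M" (is "pseudomanifold n ?K' M")
proof (rule pseudomanifoldI)
  have mK: "m \<notin> F" if "F \<in> K" for F using that K(2) by (auto simp: verts_def)
  note iff = edge_subdivision_iff[OF K]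
  have fin: "finite F" if "F \<in> K" for F using complex_finite_face[OF K(1) that] .
  note sub = complex_subset[OF K(1)]
  {
    fix F assume F: "F \<in> ?K'"
    define F0 where "F0 = (if m \<in> F then F - {m} \<union> {p, q} else F)"
    have "F0 \<in> K" using F by (auto simp: iff F0_def)
    then obtain H where H: "H \<in> K" "F0 \<subseteq> H" "card H = n" by (rule pseudomanifold_pure[OF pm])
    show "\<exists>H\<in>?K'. F \<subseteq> H \<and> card H = n"
    proof (cases "{p, q} \<subseteq> H")
      case True
      have "\<not> {p, q} \<subseteq> F" using F by (simp add: iff)
      then obtain x where x: "x \<in> {p, q}" "x \<notin> F" by auto
      \<comment> \<open>A facet through the subdivided edge is halved; the half containing
        \<open>F\<close> arises by trading an endpoint missing from \<open>F\<close> for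
        \<open>m\<close>.\<close>
      let ?H = "insert m (H - {x})"
      have "?H - {m} \<union> {p, q} = H" using True x mK[OF H(1)] K(3,4) by auto
      moreover have "\<not> {p, q} \<subseteq> ?H" using x K(3,4) by auto
      ultimately have "?H \<in> ?K'" using H(1) by (simp add: iff)
      moreover have "F \<subseteq> ?H" using H(2) x by (auto simp: F0_def split: if_splits)
      moreover have "card ?H = n"
        using H(3) fin[OF H(1)] mK[OF H(1)] card_Suc_Diff1[of H x] x(1) True by auto
      ultimately show ?thesis by blast
    next
      case False
      then have "m \<notin> F" using H(2) by (auto simp: F0_def split: if_splits)
      then show ?thesis
        using H False mK[OF H(1)] by (intro bexI[of _ H]) (auto simp: iff F0_def)
    qed
  next
    fix G assume G: "G \<in> ?K'" "Suc (card G) = n"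
    have ng: "\<not> {p, q} \<subseteq> G" using G by (simp add: iff)
    show "card (nbrs ?K' G) = (if G \<in> M then 1 else 2)"
    proof (cases "m \<in> G")
      case False
      then have GK: "G \<in> K" using G by (simp add: iff)
      have "card (nbrs ?K' G) = card (nbrs K G)"
      proof (cases "G \<union> {p, q} \<in> K")
        case True
        \<comment> \<open>\<open>G\<close> is a ridge, so at most one vertex can be added. Hence one
          endpoint lies in \<open>G\<close>, and among the neighbours the other endpoint is
          superseded by \<open>m\<close>.\<close>
        have "card (G \<union> {p, q}) \<le> Suc (card G)"
          using pseudomanifold_card_le[OF K(1) pm True] G(2) by simp
        then have "p \<in> G \<or> q \<in> G" using fin[OF GK] pq by (auto simp: card_insert_if split: if_splits)
        then obtain x y where xy: "{x, y} = {p, q}" "x \<in> G" "y \<notin> G" using ng by auto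
        have "G \<union> {p, q} = insert y G" using xy by auto
        then have yK: "y \<in> nbrs K G" using True xy by (simp add: nbrs_def)
        have "nbrs ?K' G = insert m (nbrs K G - {y})"
        proof (rule set_eqI)
          fix z
          show "z \<in> nbrs ?K' G \<longleftrightarrow> z \<in> insert m (nbrs K G - {y})"
          proof (cases "z = m")
            case True
            then show ?thesis
              using False \<open>G \<union> {p, q} \<in> K\<close> ng K(3,4) by (auto simp: nbrs_def iff)
          next
            case zm: False
            have "{p, q} \<subseteq> insert z G \<longleftrightarrow> z = y" using xy by (auto simp: doubleton_eq_iff)
            then show ?thesis using zm False by (auto simp: nbrs_def iff)
          qed
        qed
        moreover have "m \<notin> nbrs K G" using mK[of "insert m G"] by (auto simp: nbrs_def)
        ultimately show ?thesis
          using card_Suc_Diff1[OF finite_nbrs[OF K(1)] yK] finite_nbrs[OF K(1), of G]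
          by (metis DiffD1 card_insert_disjoint finite_Diff)
      next
        case npq: False
        have "nbrs ?K' G = nbrs K G"
        proof (rule set_eqI)
          fix z
          show "z \<in> nbrs ?K' G \<longleftrightarrow> z \<in> nbrs K G"
          proof (cases "z = m")
            case True
            then show ?thesis using npq False mK[of "insert m G"] by (auto simp: nbrs_def iff)
          next
            case zm: False
            have "\<not> {p, q} \<subseteq> insert z G" if "insert z G \<in> K"
            proof
              assume "{p, q} \<subseteq> insert z G"
              then have "G \<union> {p, q} \<subseteq> insert z G" by auto
              then show False using that npq sub by blast
            qed
            then show ?thesis using zm False by (auto simp: nbrs_def iff)
          qed
        qed
        then show ?thesis by simp
      qed
      then show ?thesis using pseudomanifold_card_nbrs[OF pm GK G(2)] by simp
    next
      case True
      define F where "F = G - {m}"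
      have F: "G = insert m F" "m \<notin> F" "F \<union> {p, q} \<in> K" "\<not> {p, q} \<subseteq> F"
        using True G ng by (auto simp: F_def iff)
      have finF: "finite F" using fin[OF F(3)] by simp
      have cF: "Suc (Suc (card F)) = n" using G(2) F finF by simp
      have "G \<notin> M" using True mK M(2) by blast
      moreover have "card (nbrs ?K' G) = 2"
      proof (cases "p \<in> F \<or> q \<in> F")
        case True
        then obtain x y where xy: "{x, y} = {p, q}" "x \<in> F" "y \<notin> F" using F(4) by auto
        \<comment> \<open>The facets over \<open>insert m F\<close> correspond to those over the old
          ridge \<open>F \<union> {p, q}\<close>, which contains the edge and therefore is not in
          \<open>M\<close>.\<close>
        let ?R = "insert y F"
        have R: "?R = F \<union> {p, q}" using xy by auto
        then have RK: "?R \<in> K" using F(3) by simp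
        have "nbrs ?K' G = nbrs K ?R"
        proof (rule set_eqI)
          fix z
          show "z \<in> nbrs ?K' G \<longleftrightarrow> z \<in> nbrs K ?R"
          proof (cases "z = m")
            case True
            then show ?thesis using F(1) mK[of "insert m ?R"] by (auto simp: nbrs_def)
          next
            case zm: False
            have "{p, q} \<subseteq> insert z G \<longleftrightarrow> z = y"
              using xy F(1) K(3,4) by (auto simp: doubleton_eq_iff)
            moreover have "insert z G - {m} \<union> {p, q} = insert z ?R" using R F(1,2) zm by auto
            ultimately show ?thesis using zm F(1) by (auto simp: nbrs_def iff)
          qed
        qed
        moreover have "?R \<notin> M" using M(1)[of ?R] R by auto
        ultimately show ?thesis
          using pseudomanifold_card_nbrs[OF pm RK] cF finF xy(3) by simp
      next
        case False
        \<comment> \<open>Here \<open>F \<union> {p, q}\<close> is a facet cut into two by the ridge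
          \<open>insert m F\<close>; the halves are obtained by adding \<open>p\<close> or
          \<open>q\<close>.\<close>
        then have cn: "card (F \<union> {p, q}) = n" using finF cF pq by simp
        have "nbrs ?K' G = {p, q}"
        proof (rule set_eqI)
          fix z
          have *: "insert z G - {m} \<union> {p, q} = insert z (F \<union> {p, q})" if "z \<noteq> m"
            using F(1,2) that by auto
          have out: "insert z (F \<union> {p, q}) \<notin> K" if "z \<notin> F \<union> {p, q}"
            using pseudomanifold_card_le[OF K(1) pm, of "insert z (F \<union> {p, q})"] that cn finF by auto
          have pqG: "p \<notin> G" "q \<notin> G" using False F(1) K(3,4) by auto
          show "z \<in> nbrs ?K' G \<longleftrightarrow> z \<in> {p, q}"
          proof (cases "z = m")
            case True
            then show ?thesis using F(1) K(3,4) by (simp add: nbrs_def)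
          next
            case zm: False
            then have iz: "insert z G \<in> ?K' \<longleftrightarrow> \<not> {p, q} \<subseteq> insert z G \<and> insert z (F \<union> {p, q}) \<in> K"
              unfolding iff *[OF zm] using \<open>m \<in> G\<close> by simp
            show ?thesis
            proof (cases "z \<in> {p, q}")
              case True
              then have "insert z (F \<union> {p, q}) = F \<union> {p, q}" by auto
              moreover have "\<not> {p, q} \<subseteq> insert z G" using pqG pq by auto
              moreover have "z \<notin> G" using True pqG by auto
              ultimately show ?thesis using iz True F(3) by (simp add: nbrs_def)
            next
              case zpq: False
              have "insert z G \<notin> ?K'" if "z \<notin> G" using that zpq out F(1) iz by blast
              then show ?thesis using zpq by (auto simp: nbrs_def)
            qed
          qed
        qed
        then show ?thesis using pq by simp
      qed
      ultimately show ?thesis by simp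
    qed
  }
qed

lemma pseudomanifold_map:
  assumes K: "abstract_complex K" "inj_on \<phi> (verts K)" and M: "M \<subseteq> K" and pm: "pseudomanifold n K M"
  shows "pseudomanifold n (map_complex \<phi> K) (map_complex \<phi> M)"
proof (rule pseudomanifoldI)
  have inj: "inj_on \<phi> F" if "F \<in> K" for F
    using K(2) that by (rule_tac inj_on_subset) (auto simp: verts_def)
  {
    fix F assume "F \<in> map_complex \<phi> K"
    then obtain F' where F': "F' \<in> K" "F = \<phi> ` F'" by (auto simp: map_complex_def)
    obtain H where "H \<in> K" "F' \<subseteq> H" "card H = n" by (rule pseudomanifold_pure[OF pm F'(1)])
    then show "\<exists>H\<in>map_complex \<phi> K. F \<subseteq> H \<and> card H = n"
      using F' inj by (intro bexI[of _ "\<phi> ` H"]) (auto simp: map_complex_def card_image)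
  next
    fix G assume G: "G \<in> map_complex \<phi> K" "Suc (card G) = n"
    then obtain G' where G': "G' \<in> K" "G = \<phi> ` G'" by (auto simp: map_complex_def)
    have eq: "F = F'" if "F \<subseteq> verts K" "F' \<subseteq> verts K" "\<phi> ` F = \<phi> ` F'" for F F'
      using inj_on_image_eq_iff[OF K(2) that(1,2)] that(3) by simp
    have vG: "F \<subseteq> verts K" if "F \<in> K" for F using that by (auto simp: verts_def)
    have "nbrs (map_complex \<phi> K) G = \<phi> ` nbrs K G'"
    proof
      show "\<phi> ` nbrs K G' \<subseteq> nbrs (map_complex \<phi> K) G"
      proof
        fix y assume "y \<in> \<phi> ` nbrs K G'"
        then obtain x where x: "y = \<phi> x" "x \<notin> G'" "insert x G' \<in> K" by (auto simp: nbrs_def)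
        have "\<phi> x \<notin> \<phi> ` G'" using inj[OF x(3)] x(2) by (auto simp: inj_on_def)
        moreover have "insert y G = \<phi> ` insert x G'" using x G' by simp
        then have "insert y G \<in> map_complex \<phi> K" using x(3) unfolding map_complex_def by blast
        ultimately show "y \<in> nbrs (map_complex \<phi> K) G" using x(1) G'(2) by (simp add: nbrs_def)
      qed
      show "nbrs (map_complex \<phi> K) G \<subseteq> \<phi> ` nbrs K G'"
      proof
        fix y assume "y \<in> nbrs (map_complex \<phi> K) G"
        then obtain H where H: "y \<notin> G" "H \<in> K" "insert y G = \<phi> ` H" by (auto simp: nbrs_def map_complex_def)
        then obtain x where x: "x \<in> H" "y = \<phi> x" by blast
        have "\<phi> ` H = \<phi> ` insert x G'" using H x G' by simp
        then have "H = insert x G'"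
          using vG[OF H(2)] vG[OF G'(1)] x(1) by (intro eq) auto
        moreover have "x \<notin> G'" using H(1) x G' by auto
        ultimately show "y \<in> \<phi> ` nbrs K G'" using H x by (auto simp: nbrs_def)
      qed
    qed
    moreover have "nbrs K G' \<subseteq> verts K" by (auto simp: nbrs_def verts_def)
    then have "card (\<phi> ` nbrs K G') = card (nbrs K G')"
      using K(2) inj_on_subset card_image by blast
    moreover have "G \<in> map_complex \<phi> M \<longleftrightarrow> G' \<in> M"
    proof
      assume "G \<in> map_complex \<phi> M"
      then obtain F where F: "F \<in> M" "G = \<phi> ` F" by (auto simp: map_complex_def)
      then have "F = G'" using vG M G' by (intro eq) auto
      then show "G' \<in> M" using F by simp
    qed (use G' in \<open>auto simp: map_complex_def\<close>)
    moreover have "Suc (card G') = n" using G(2) G' inj card_image by metis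
    ultimately show "card (nbrs (map_complex \<phi> K) G) = (if G \<in> map_complex \<phi> M then 1 else 2)"
      using pseudomanifold_card_nbrs[OF pm G'(1)] by simp
  }
qed

text \<open>Adding a neighbour to a ridge gives a bijection onto the facets above it, so the ridges
  in exactly one facet are those in \<open>T\<close>. Purity of \<open>T\<close> accounts for its
  smaller faces.\<close>

lemma boundary_pseudomanifold:
  assumes B: "abstract_complex B" "pseudomanifold (Suc d) B T"
    and T: "abstract_complex T" "T \<subseteq> B" "\<And>F. F \<in> T \<Longrightarrow> \<exists>G\<in>T. F \<subseteq> G \<and> card G = d"
  shows "boundary d B = T"
proof -
  have "card {H \<in> B. G \<subseteq> H \<and> card H = d + 1} = card (nbrs B G)" if G: "G \<in> B" "card G = d" for G
  proof -
    have fin: "finite G" using complex_finite_face[OF B(1) G(1)] .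
    have "bij_betw (\<lambda>x. insert x G) (nbrs B G) {H \<in> B. G \<subseteq> H \<and> card H = d + 1}"
      unfolding bij_betw_def
    proof
      show "inj_on (\<lambda>x. insert x G) (nbrs B G)"
        by (rule inj_onI) (auto simp: nbrs_def dest: insert_ident)
      show "(\<lambda>x. insert x G) ` nbrs B G = {H \<in> B. G \<subseteq> H \<and> card H = d + 1}"
      proof
        show "(\<lambda>x. insert x G) ` nbrs B G \<subseteq> {H \<in> B. G \<subseteq> H \<and> card H = d + 1}"
          using fin G(2) by (auto simp: nbrs_def)
        show "{H \<in> B. G \<subseteq> H \<and> card H = d + 1} \<subseteq> (\<lambda>x. insert x G) ` nbrs B G"
        proof
          fix H assume H: "H \<in> {H \<in> B. G \<subseteq> H \<and> card H = d + 1}"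
          then have "card (H - G) = 1" using fin G(2) by (simp add: card_Diff_subset)
          then obtain x where "H - G = {x}" using card_1_singletonE by blast
          then have "H = insert x G" "x \<notin> G" using H by auto
          then show "H \<in> (\<lambda>x. insert x G) ` nbrs B G" using H by (auto simp: nbrs_def)
        qed
      qed
    qed
    then show ?thesis by (simp add: bij_betw_same_card)
  qed
  then have key: "card {H \<in> B. G \<subseteq> H \<and> card H = d + 1} = 1 \<longleftrightarrow> G \<in> T" if "G \<in> B" "card G = d" for G
    using that pseudomanifold_card_nbrs[OF B(2) that(1)] by simp
  show ?thesis
  proof
    show "boundary d B \<subseteq> T"
    proof
      fix F assume "F \<in> boundary d B"
      then obtain G where G: "G \<in> B" "F \<subseteq> G" "card G = d" "card {H \<in> B. G \<subseteq> H \<and> card H = d + 1} = 1"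
        unfolding boundary_def by blast
      then have "G \<in> T" using key by simp
      then show "F \<in> T" using G(2) by (rule complex_subset[OF T(1)])
    qed
    show "T \<subseteq> boundary d B"
    proof
      fix F assume "F \<in> T"
      then obtain G where G: "G \<in> T" "F \<subseteq> G" "card G = d" using T(3) by blast
      then have "G \<in> B" using T(2) by blast
      then show "F \<in> boundary d B" unfolding boundary_def using G key by blast
    qed
  qed
qed

section \<open>Pushing a cone off its base\<close>

lemma complex_avoid: "abstract_complex K \<Longrightarrow> abstract_complex {F \<in> K. v \<notin> F}"
  by (auto simp: abstract_complex_def)

lemma map_complex_swap_iff:
  assumes Q: "abstract_complex Q" "x1 \<notin> verts Q" "x0 \<noteq> x1"
  shows "H \<in> map_complex (\<lambda>x. if x = x0 then x1 else x) Q \<longleftrightarrow>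
    x0 \<notin> H \<and> (if x1 \<in> H then insert x0 (H - {x1}) \<in> Q else H \<in> Q)"
proof -
  let ?r = "\<lambda>x. if x = x0 then x1 else x"
  have img: "?r ` G = (if x0 \<in> G then insert x1 (G - {x0}) else G)" for G by auto
  have x1: "x1 \<notin> G" if "G \<in> Q" for G using that Q(2) by (auto simp: verts_def)
  have m: "?r ` G \<in> map_complex ?r Q" if "G \<in> Q" for G
    using that unfolding map_complex_def by (rule imageI)
  show ?thesis
  proof
    assume "H \<in> map_complex ?r Q"
    then obtain G where G: "G \<in> Q" "H = ?r ` G" by (auto simp: map_complex_def)
    show "x0 \<notin> H \<and> (if x1 \<in> H then insert x0 (H - {x1}) \<in> Q else H \<in> Q)"
    proof (cases "x0 \<in> G")
      case True
      then have H: "H = insert x1 (G - {x0})" unfolding G(2) img by simp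
      then have "insert x0 (H - {x1}) = G" using True x1[OF G(1)] by auto
      then show ?thesis using H G(1) Q(3) by simp
    next
      case False
      then have "H = G" unfolding G(2) img by simp
      then show ?thesis using False G(1) x1[OF G(1)] by simp
    qed
  next
    assume H: "x0 \<notin> H \<and> (if x1 \<in> H then insert x0 (H - {x1}) \<in> Q else H \<in> Q)"
    show "H \<in> map_complex ?r Q"
    proof (cases "x1 \<in> H")
      case True
      then have eq: "?r ` (insert x0 (H - {x1})) = H" using H by auto
      have "insert x0 (H - {x1}) \<in> Q" using H True by simp
      from m[OF this] show ?thesis unfolding eq .
    next
      case False
      then have "H \<in> Q" using H by simp
      from m[OF this] show ?thesis unfolding img using H by simp
    qed
  qed
qed

text \<open>Subdividing the edge from the apex \<open>v\<close> to \<open>x0\<close> pushes the link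
  of \<open>v\<close> off \<open>x0\<close>: in the link, \<open>x0\<close> becomes
  \<open>x1\<close>. The faces left behind join \<open>x1\<close> to the closed star of
  \<open>x0\<close> in \<open>Q\<close> and are added to the part avoiding \<open>v\<close>.\<close>

lemma edge_subdivision_cone:
  assumes C: "abstract_complex C" and Q: "abstract_complex Q" "Q \<subseteq> C"
    and new: "v \<notin> verts C" "x1 \<notin> verts C" "x1 \<noteq> v" "x0 \<noteq> v" "x0 \<noteq> x1"
  shows "edge_subdivision v x0 x1 (C \<union> cone_over v Q) =
    C \<union> {insert x1 F | F. insert x0 F \<in> Q} \<union> cone_over v (map_complex (\<lambda>x. if x = x0 then x1 else x) Q)"
proof (rule set_eqI)
  fix G
  let ?r = "\<lambda>x. if x = x0 then x1 else x"
  have vQ: "v \<notin> verts Q" "x1 \<notin> verts Q" using new Q by (auto simp: verts_def)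
  have nC: "v \<notin> F" "x1 \<notin> F" if "F \<in> C" for F using that new by (auto simp: verts_def)
  have nQ: "v \<notin> F" "x1 \<notin> F" if "F \<in> Q" for F using that Q(2) nC by auto
  have cK: "abstract_complex (C \<union> cone_over v Q)" using C Q by (intro complex_Un complex_cone)
  have x1K: "x1 \<notin> verts (C \<union> cone_over v Q)"
    using new vQ complex_empty[OF Q(1)] by (simp add: verts_cone)
  have vR: "v \<notin> verts (map_complex ?r Q)" using vQ new by (auto simp: verts_map)
  have K: "F \<in> C \<union> cone_over v Q \<longleftrightarrow> F \<in> C \<or> F - {v} \<in> Q" for F
    using cone_iff[OF Q(1) vQ(1)] by simp
  have lhs: "G \<in> edge_subdivision v x0 x1 (C \<union> cone_over v Q) \<longleftrightarrow> \<not> {v, x0} \<subseteq> G \<and>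
      (if x1 \<in> G then G - {x1} \<union> {v, x0} - {v} \<in> Q else G \<in> C \<or> G - {v} \<in> Q)"
  proof -
    have "G - {x1} \<union> {v, x0} \<notin> C" using nC by blast
    then show ?thesis
      unfolding edge_subdivision_iff[OF cK x1K new(3) new(5)[symmetric]] K by simp
  qed
  have rhs: "G \<in> cone_over v (map_complex ?r Q) \<longleftrightarrow>
      x0 \<notin> G - {v} \<and> (if x1 \<in> G - {v} then insert x0 (G - {v} - {x1}) \<in> Q else G - {v} \<in> Q)"
    unfolding cone_iff[OF complex_map[OF Q(1)] vR] map_complex_swap_iff[OF Q(1) vQ(2) new(5)] ..
  have mid: "G \<in> {insert x1 F | F. insert x0 F \<in> Q} \<longleftrightarrow> x1 \<in> G \<and> insert x0 (G - {x1}) \<in> Q"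
  proof
    assume "G \<in> {insert x1 F | F. insert x0 F \<in> Q}"
    then obtain F where F: "G = insert x1 F" "insert x0 F \<in> Q" by blast
    then have "G - {x1} = F" using nQ(2)[OF F(2)] by auto
    then show "x1 \<in> G \<and> insert x0 (G - {x1}) \<in> Q" using F by simp
  next
    assume *: "x1 \<in> G \<and> insert x0 (G - {x1}) \<in> Q"
    then have "G = insert x1 (G - {x1})" by auto
    then show "G \<in> {insert x1 F | F. insert x0 F \<in> Q}" using * by blast
  qed
  show "G \<in> edge_subdivision v x0 x1 (C \<union> cone_over v Q) \<longleftrightarrow>
    G \<in> C \<union> {insert x1 F | F. insert x0 F \<in> Q} \<union> cone_over v (map_complex ?r Q)"
  proof (cases "x1 \<in> G")
    case x1G: True
    then have GC: "G \<notin> C" using nC by blast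
    show ?thesis
    proof (cases "v \<in> G")
      case True
      have "insert x0 (G - {x1}) \<notin> Q" using True nQ(1)[of "insert x0 (G - {x1})"] new(3) by auto
      moreover have "G - {x1} \<union> {v, x0} - {v} = insert x0 (G - {v} - {x1})" using new by auto
      ultimately show ?thesis
        unfolding Un_iff lhs rhs mid using x1G GC True new by simp
    next
      case False
      then have "G - {x1} \<union> {v, x0} - {v} = insert x0 (G - {x1})" "G - {v} = G" using new by auto
      then show ?thesis
        unfolding Un_iff lhs rhs mid using x1G GC False by auto
    qed
  next
    case x1G: False
    show ?thesis
    proof (cases "v \<in> G")
      case True
      then have "G \<notin> C" using nC by blast
      then show ?thesis unfolding Un_iff lhs rhs mid using x1G True new by simp
    next
      case False
      then have "G - {v} = G" by auto
      then show ?thesis unfolding Un_iff lhs rhs mid using x1G False Q(2) by auto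
    qed
  qed
qed

section \<open>The antipodal map and the inductive step\<close>

text \<open>Antipodal pairs are \<open>{2 * k, 2 * k + 1}\<close>, so the sign is a parity and every
  initial segment \<open>{..<2 * a}\<close> is invariant.\<close>

definition anti :: "nat \<Rightarrow> nat" where
  "anti x = (if even x then x + 1 else x - 1)"

lemma anti_anti [simp]: "anti (anti x) = x"
  by (auto simp: anti_def)

lemma anti_neq [simp]: "anti x \<noteq> x"
  by (auto simp: anti_def elim: oddE)

lemma even_anti [simp]: "even (anti x) \<longleftrightarrow> odd x"
  by (auto simp: anti_def)

lemma anti_less_iff [simp]: "anti x < 2 * a \<longleftrightarrow> x < 2 * a"
  by (auto simp: anti_def elim!: evenE oddE)

lemma inj_anti: "inj_on anti A"
  by (rule inj_on_inverseI[of _ anti]) simp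

lemma map_anti_anti [simp]: "map_complex anti (map_complex anti K) = K"
  unfolding map_complex_comp by (rule map_complex_id) simp

lemma image_anti_anti [simp]: "anti ` anti ` F = F"
  by (simp add: image_image)

lemma map_anti_iff: "F \<in> map_complex anti K \<longleftrightarrow> anti ` F \<in> K"
proof
  assume "F \<in> map_complex anti K"
  then show "anti ` F \<in> K" by (auto simp: map_complex_def)
next
  assume "anti ` F \<in> K"
  then have "anti ` anti ` F \<in> map_complex anti K" unfolding map_complex_def by (rule imageI)
  then show "F \<in> map_complex anti K" by simp
qed

text \<open>Even vertices form the positive half and \<open>anti\<close> exchanges the halves. The map \<open>up b m\<close> moves
  the negative vertices below \<open>2 * m\<close> to new positive vertices, leaving \<open>2 * b\<close> and \<open>2 * b + 2\<close> free.\<close>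

definition up :: "nat \<Rightarrow> nat \<Rightarrow> nat \<Rightarrow> nat" where
  "up b m x = (if odd x \<and> x < 2 * m then x + (2 * b + 3) else x)"

text \<open>A left inverse of \<open>up b m\<close> below \<open>2 * b\<close>, for all
  \<open>m\<close> at once. The offset \<open>2 * b + 3\<close> is odd, hence turns negative
  vertices into positive ones, and the smallest, \<open>1\<close>, goes to \<open>2 * b + 4\<close>,
  just past the two apices.\<close>

definition down :: "nat \<Rightarrow> nat \<Rightarrow> nat" where
  "down b x = (if x < 2 * b then x else x - (2 * b + 3))"

text \<open>The part avoiding the apex after \<open>m\<close> subdivisions of the cone over
  \<open>S\<close>: the region between \<open>S\<close> and the pushed-off link of the apex.\<close>

primrec collar :: "nat \<Rightarrow> nat set set \<Rightarrow> nat \<Rightarrow> nat set set" where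
  "collar b S 0 = S"
| "collar b S (Suc m) = collar b S m \<union>
     {insert (2 * m + 1 + (2 * b + 3)) F | F. insert (2 * m + 1) F \<in> map_complex (up b m) S}"

definition next_ball :: "nat \<Rightarrow> nat \<Rightarrow> nat set set \<Rightarrow> nat set set \<Rightarrow> nat set set" where
  "next_ball a b B T = collar b (B \<union> map_complex anti B) a \<union> cone_over (2 * b) (map_complex (up b a) B) \<union>
     cone_over (2 * b + 2) (map_complex (up b a) (map_complex anti B) \<union> cone_over (2 * b) (map_complex (up b a) T))"

lemma verts_insert_set: "verts (X \<union> {insert y F | F. insert x F \<in> R}) \<subseteq> verts X \<union> insert y (verts R)"
  unfolding verts_def by blast

text \<open>One level of the induction: \<open>B\<close> has dimension \<open>n\<close>, and
  \<open>T\<close> and the sphere made of \<open>B\<close> and its mirror image have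
  \<open>2 * a\<close> and \<open>2 * b\<close> vertices. By \<open>ind\<close>, \<open>T\<close> is
  an induced subcomplex of \<open>B\<close>. Degenerate pairs \<open>x = y\<close> are allowed in
  \<open>no_cycle\<close>, so it also forbids edges between antipodes. The apex in
  \<open>coneB\<close> is left free so that it can be taken outside whatever complex is at
  hand.\<close>

locale step =
  fixes a b n :: nat and B T :: "nat set set"
  assumes ab: "a \<le> b"
    and B: "abstract_complex B" and T: "abstract_complex T" and TB: "T \<subseteq> B"
    and vB: "verts B = {..<2 * a} \<union> {x. even x \<and> x < 2 * b}"
    and vT: "verts T = {..<2 * a}"
    and ind: "F \<in> B \<Longrightarrow> F \<subseteq> {..<2 * a} \<Longrightarrow> F \<in> T"
    and anti_T: "map_complex anti T = T"
    and no_cycle: "{x, y} \<in> B \<union> map_complex anti B \<Longrightarrow> {x, anti y} \<notin> B \<union> map_complex anti B"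
    and pmB: "pseudomanifold (Suc n) B T"
    and pmT: "pseudomanifold n T {}"
    and coneB: "c \<notin> {..<2 * a} \<Longrightarrow> pl_equiv T B (cone_over c T)"
    and sphT: "sphere_complex n T"
begin

abbreviation A where "A \<equiv> map_complex anti B"
abbreviation S where "S \<equiv> B \<union> A"
abbreviation v where "v \<equiv> 2 * b"
abbreviation w where "w \<equiv> 2 * b + 2"

section \<open>The sphere formed by \<open>B\<close> and its mirror image\<close>

lemma cA: "abstract_complex A" using B by (rule complex_map)
lemma cS: "abstract_complex S" using B cA by (rule complex_Un)

lemma vA: "verts A = {..<2 * a} \<union> {x. odd x \<and> x < 2 * b}"
proof -
  have "x \<in> verts A \<longleftrightarrow> anti x \<in> verts B" for x
    unfolding verts_map by (metis anti_anti imageE imageI)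
  then show ?thesis unfolding vB by auto
qed

lemma vS: "verts S = {..<2 * b}"
  using ab by (auto simp: vB vA)

lemma TA: "T \<subseteq> A"
proof -
  have "map_complex anti T \<subseteq> A" unfolding map_complex_def using TB by (rule image_mono)
  then show ?thesis by (simp only: anti_T)
qed

lemma BA: "B \<inter> A = T"
proof
  show "B \<inter> A \<subseteq> T"
  proof
    fix F assume F: "F \<in> B \<inter> A"
    then have "F \<subseteq> verts B" "F \<subseteq> verts A" by (auto simp: verts_def)
    then have "F \<subseteq> {..<2 * a}" unfolding vB vA by auto
    then show "F \<in> T" using F ind by blast
  qed
qed (use TA TB in blast)

lemma anti_S: "map_complex anti S = S"
  unfolding map_complex_Un by auto

lemma pmA: "pseudomanifold (Suc n) A T"
  using pseudomanifold_map[OF B inj_anti TB pmB] anti_T by simp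

lemma card_T: "F \<in> T \<Longrightarrow> card F < Suc n"
  using pseudomanifold_card_le[OF T pmT] by (simp add: less_Suc_eq_le)

lemma pmS: "pseudomanifold (Suc n) S {}"
  using pseudomanifold_Un[OF B cA BA card_T pmB pmA] .

lemma coneA: "pl_equiv T A (cone_over (anti c) T)" if "c \<notin> {..<2 * a}" for c
proof -
  have "pl_equiv (map_complex anti T) A (map_complex anti (cone_over c T))"
    by (rule pl_equiv_map[OF B inj_anti complex_cone[OF T] inj_anti TB coneB[OF that]])
  then show ?thesis by (simp add: anti_T map_complex_cone)
qed

text \<open>Each half is equivalent to a cone over \<open>T\<close> by a map fixing
  \<open>T\<close>, so the two maps glue to an equivalence of \<open>S\<close> with a suspension of
  the sphere \<open>T\<close>.\<close>

lemma sphS: "sphere_complex (Suc n) S"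
proof -
  let ?c = "2 * a" and ?d = "anti (2 * a)"
  have c: "?c \<notin> verts T" "?d \<notin> verts T" "?c \<noteq> ?d"
    using anti_neq[of "2 * a"] by (auto simp: vT simp del: anti_neq)
  have I: "cone_over ?c T \<inter> cone_over ?d T = T"
    using cone_inter_cone[of ?c ?d T T] c by auto
  have "pl_equiv (T \<union> T) S (cone_over ?c T \<union> cone_over ?d T)"
    by (rule pl_equiv_glue[OF B cA complex_cone[OF T] complex_cone[OF T] coneB coneA])
      (use BA I TA TB in auto)
  then have "pl_equiv {{}} S (cone_over ?c T \<union> cone_over ?d T)"
    using complex_empty[OF T] by (rule_tac pl_equiv_mono) auto
  then show ?thesis
    using sphere_complex_cong[OF cS] sphere_complex_suspension[OF sphT c] by blast
qed

subsection \<open>The collar\<close>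

lemma down_up: "x < 2 * b \<Longrightarrow> down b (up b m x) = x"
  by (auto simp: up_def down_def)

lemma inj_up: "inj_on (up b m) {..<2 * b}"
  by (rule inj_on_inverseI[of _ "down b"]) (simp add: down_up)

abbreviation Q where "Q m \<equiv> map_complex (up b m) S"
abbreviation C where "C m \<equiv> collar b S m"

lemma cQ: "abstract_complex (Q m)" using cS by (rule complex_map)

lemma vQ: "verts (Q m) = up b m ` {..<2 * b}" unfolding verts_map vS ..

lemma Q_Suc: "m < a \<Longrightarrow>
    Q (Suc m) = map_complex (\<lambda>x. if x = 2 * m + 1 then 2 * m + 1 + (2 * b + 3) else x) (Q m)"
  unfolding map_complex_comp
proof (rule map_complex_cong)
  fix x assume "x \<in> verts S" and m: "m < a"
  then have x: "x < 2 * b" by (simp only: vS lessThan_iff)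
  have "x = 2 * m + 1 \<or> (x < 2 * Suc m \<longleftrightarrow> x < 2 * m)" if "odd x" using that by (elim oddE) auto
  then show "up b (Suc m) x = ((\<lambda>x. if x = 2 * m + 1 then 2 * m + 1 + (2 * b + 3) else x) \<circ> up b m) x"
    using x m ab by (auto simp: up_def)
qed

lemma vC: "m \<le> a \<Longrightarrow> verts (C m) \<subseteq> {..<2 * b} \<union> {x. even x \<and> 2 * b + 4 \<le> x \<and> x < 2 * b + 4 + 2 * m}"
proof (induction m)
  case 0
  then show ?case by (simp only: collar.simps vS) blast
next
  case (Suc m)
  have "verts (Q m) \<subseteq> {..<2 * b} \<union> {x. even x \<and> 2 * b + 4 \<le> x \<and> x < 2 * b + 4 + 2 * m}"
    unfolding vQ by (auto simp: up_def elim!: oddE)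
  moreover have "verts (C (Suc m)) \<subseteq> verts (C m) \<union> insert (2 * m + 1 + (2 * b + 3)) (verts (Q m))"
    unfolding collar.simps by (rule verts_insert_set)
  ultimately show ?case using Suc by fastforce
qed

lemma vwC: "m \<le> a \<Longrightarrow> v \<notin> verts (C m) \<and> w \<notin> verts (C m)"
  using vC[of m] by auto

lemma S_C: "S \<subseteq> C m"
  by (induction m) auto

lemma collar_step:
  assumes "m < a" "abstract_complex (C m)" "Q m \<subseteq> C m"
  shows "edge_subdivision v (2 * m + 1) (2 * m + 1 + (2 * b + 3)) (C m \<union> cone_over v (Q m)) =
    C (Suc m) \<union> cone_over v (Q (Suc m))"
proof -
  have "2 * m + 1 + (2 * b + 3) \<notin> verts (C m)" using vC[of m] assms(1) ab by auto
  moreover have "2 * m + 1 \<noteq> 2 * b" by presburger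
  ultimately show ?thesis
    unfolding Q_Suc[OF assms(1)] collar.simps
    using vwC[of m] assms by (intro edge_subdivision_cone cQ) auto
qed

text \<open>The step from \<open>m\<close> to \<open>Suc m\<close> is one subdivision of the edge
  from \<open>v\<close> to the negative vertex \<open>2 * m + 1\<close>. The new vertex is not in
  \<open>S\<close>, and no face of \<open>S\<close> contains the edge, so both the equivalence
  relative to \<open>S\<close> and the boundary \<open>S\<close> persist.\<close>

lemma collar_invariant:
  "m \<le> a \<Longrightarrow> abstract_complex (C m) \<and> Q m \<subseteq> C m \<and>
    pl_equiv S (C m \<union> cone_over v (Q m)) (cone_over v S) \<and>
    pseudomanifold (Suc (Suc n)) (C m \<union> cone_over v (Q m)) S"
proof (induction m)
  case 0
  have "up b 0 = (\<lambda>x. x)" by (auto simp: up_def)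
  then have Q0: "Q 0 = S" by (simp add: map_complex_def)
  have K0: "C 0 \<union> cone_over v (Q 0) = cone_over v S" unfolding Q0 collar.simps by (auto simp: cone_over_def)
  have vS': "v \<notin> verts S" by (simp only: vS) simp
  have "pseudomanifold (Suc (Suc n)) (cone_over v S) (S \<union> cone_over v {})"
    by (rule pseudomanifold_cone[OF cS vS' _ pmS]) simp
  then have "pseudomanifold (Suc (Suc n)) (cone_over v S) S" by (simp add: cone_over_def)
  then show ?case unfolding K0 using Q0 cS pl_equiv_refl[OF complex_cone[OF cS]] by simp
next
  case (Suc m)
  let ?x0 = "2 * m + 1" and ?x1 = "2 * m + 1 + (2 * b + 3)"
  let ?K = "C m \<union> cone_over v (Q m)" and ?K' = "C (Suc m) \<union> cone_over v (Q (Suc m))"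
  have m: "m < a" "m \<le> a" using Suc.prems by auto
  have IH: "abstract_complex (C m)" "Q m \<subseteq> C m" "pl_equiv S ?K (cone_over v S)"
    "pseudomanifold (Suc (Suc n)) ?K S" using Suc.IH m by auto
  have eq: "edge_subdivision v ?x0 ?x1 ?K = ?K'" using collar_step[OF m(1) IH(1,2)] .
  have cK: "abstract_complex ?K" using IH cQ by (intro complex_Un complex_cone)
  have x1C: "?x1 \<notin> verts (C m)" using vC[OF m(2)] m(1) ab by auto
  have vQC: "verts (Q m) \<subseteq> verts (C m)" using IH(2) by (auto simp: verts_def)
  have x1: "?x1 \<notin> verts ?K" "?x1 \<noteq> v" "?x1 \<noteq> ?x0"
    using x1C vQC complex_empty[OF cQ] by (auto simp: verts_cone simp del: verts_Un) (auto simp: verts_cone)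
  have vx0: "v \<noteq> ?x0" by presburger
  have cK': "abstract_complex ?K'" using complex_edge_subdivision[OF cK x1] unfolding eq .
  have QC: "Q (Suc m) \<subseteq> C (Suc m)"
  proof
    fix H assume H: "H \<in> Q (Suc m)"
    have x1Q: "?x1 \<notin> verts (Q m)" using x1C vQC by blast
    have H': "?x0 \<notin> H \<and> (if ?x1 \<in> H then insert ?x0 (H - {?x1}) \<in> Q m else H \<in> Q m)"
      using H unfolding Q_Suc[OF m(1)] map_complex_swap_iff[OF cQ x1Q x1(3)[symmetric]] .
    show "H \<in> C (Suc m)"
    proof (cases "?x1 \<in> H")
      case True
      then have "H = insert ?x1 (H - {?x1})" by auto
      moreover have "insert ?x0 (H - {?x1}) \<in> Q m" using H' True by simp
      ultimately show ?thesis unfolding collar.simps by blast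
    next
      case False
      then have "H \<in> C m" using H' IH(2) by auto
      then show ?thesis by simp
    qed
  qed
  have CK: "C (Suc m) = {F \<in> ?K'. v \<notin> F}"
  proof -
    have 1: "v \<notin> F" if "F \<in> C (Suc m)" for F using vwC[OF Suc.prems] that by (auto simp: verts_def)
    have "F \<in> C (Suc m)" if "F \<in> cone_over v (Q (Suc m))" "v \<notin> F" for F
      using that QC by (auto simp: cone_over_def)
    then show ?thesis using 1 by blast
  qed
  have "abstract_complex (C (Suc m))" by (subst CK) (rule complex_avoid[OF cK'])
  moreover have "pl_equiv S ?K' (cone_over v S)"
  proof -
    have "?x1 \<notin> verts S" by (simp only: vS) simp
    then have "pl_equiv S ?K' ?K"
      using pl_equiv_edge_subdivision[OF cK x1(1,2,3) vx0 cS] unfolding eq by blast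
    then show ?thesis using IH(3) by (rule pl_equiv_trans)
  qed
  moreover have "pseudomanifold (Suc (Suc n)) ?K' S"
  proof -
    have "\<not> {v, ?x0} \<subseteq> F" if "F \<in> S" for F
    proof -
      have "F \<subseteq> {..<2 * b}" using that vS by (auto simp: verts_def simp del: verts_Un)
      then show ?thesis by auto
    qed
    moreover have "S \<subseteq> ?K" using S_C by blast
    ultimately show ?thesis
      using pseudomanifold_edge_subdivision[OF cK x1 vx0 _ _ IH(4)] unfolding eq by blast
  qed
  ultimately show ?case using QC by blast
qed

text \<open>Collapsing every new vertex to the one it replaced is a simplicial map of the collar
  onto \<open>S\<close>. It transfers the absence of vertices adjacent to antipodal pairs from
  \<open>S\<close> to the new vertices.\<close>

lemma collar_down: "F \<in> C m \<Longrightarrow> m \<le> a \<Longrightarrow> down b ` F \<in> S"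
proof (induction m arbitrary: F)
  case 0
  have "F \<subseteq> {..<2 * b}" using 0 vS by (auto simp: verts_def simp del: verts_Un)
  then have "down b ` F = F" by (force simp: down_def image_iff)
  then show ?case using 0 by simp
next
  case (Suc m)
  show ?case
  proof (cases "F \<in> C m")
    case True
    then show ?thesis using Suc by simp
  next
    case False
    let ?x0 = "2 * m + 1" and ?x1 = "2 * m + 1 + (2 * b + 3)"
    obtain G where G: "F = insert ?x1 G" "insert ?x0 G \<in> Q m" using False Suc.prems(1) by auto
    obtain X where X: "X \<in> S" "insert ?x0 G = up b m ` X" using G(2) unfolding map_complex_def by blast
    have "X \<subseteq> {..<2 * b}" using X(1) vS by (auto simp: verts_def simp del: verts_Un)
    then have "down b ` up b m ` X = X" by (force simp: image_image down_up)
    then have "down b ` insert ?x0 G = X" using X(2) by simp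
    moreover have "down b ?x1 = ?x0" "down b ?x0 = ?x0" using Suc.prems(2) ab by (auto simp: down_def)
    ultimately have "down b ` F = X" unfolding G(1) by simp
    then show ?thesis using X by simp
  qed
qed

lemma collar_low: "F \<in> C m \<Longrightarrow> F \<subseteq> {..<2 * b} \<Longrightarrow> F \<in> S"
proof (induction m)
  case (Suc m)
  then show ?case by auto
qed simp

text \<open>The pushed-off link contains every collar face without replaced vertices: a face added
  at some stage joins the new vertex to a face in the star of the old one, and once the old vertex
  is excluded only its renamed copy remains. This is how positive faces and new faces of the next
  ball are determined.\<close>

lemma collar_avoid: "F \<in> C m \<Longrightarrow> m \<le> a \<Longrightarrow> (\<And>x. x \<in> F \<Longrightarrow> odd x \<Longrightarrow> 2 * m \<le> x) \<Longrightarrow> F \<in> Q m"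
proof (induction m)
  case 0
  have "up b 0 = (\<lambda>x. x)" by (auto simp: up_def)
  then show ?case using 0 by (simp add: map_complex_def)
next
  case (Suc m)
  let ?x0 = "2 * m + 1" and ?x1 = "2 * m + 1 + (2 * b + 3)"
  have m: "m < a" "m \<le> a" using Suc.prems by auto
  have inv: "abstract_complex (C m)" "Q m \<subseteq> C m" using collar_invariant[OF m(2)] by auto
  have x1C: "?x1 \<notin> verts (C m)" using vC[OF m(2)] m(1) ab by auto
  then have x1Q: "?x1 \<notin> verts (Q m)" using inv(2) by (auto simp: verts_def)
  have ne: "?x0 \<noteq> ?x1" by simp
  have x0F: "?x0 \<notin> F" using Suc.prems(3)[of ?x0] by auto
  note iff = map_complex_swap_iff[OF cQ x1Q ne, folded Q_Suc[OF m(1)]]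
  show ?case
  proof (cases "F \<in> C m")
    case True
    then have "F \<in> Q m" using Suc.IH[OF _ m(2)] Suc.prems(3) by fastforce
    moreover have "?x1 \<notin> F" using True x1C by (auto simp: verts_def)
    ultimately show ?thesis unfolding iff using x0F by simp
  next
    case False
    then obtain G where G: "F = insert ?x1 G" "insert ?x0 G \<in> Q m" using Suc.prems(1) by auto
    have "?x1 \<notin> G" using G(2) x1Q by (auto simp: verts_def)
    then have "insert ?x0 (F - {?x1}) \<in> Q m" using G by simp
    then show ?thesis unfolding iff using x0F G(1) by simp
  qed
qed

end

lemma map_complex_mono: "K \<subseteq> L \<Longrightarrow> map_complex \<phi> K \<subseteq> map_complex \<phi> L"
  unfolding map_complex_def by (rule image_mono)

text \<open>The subcomplex induced on the positive half. It is a ball at every level, which is what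
  makes the complex of new faces a ball two levels higher.\<close>

definition even_faces :: "nat set set \<Rightarrow> nat set set" where
  "even_faces K = {F \<in> K. \<forall>x\<in>F. even x}"

context step
begin

subsection \<open>The next ball\<close>

abbreviation pB where "pB \<equiv> map_complex (up b a) B"
abbreviation pA where "pA \<equiv> map_complex (up b a) A"
abbreviation pT where "pT \<equiv> map_complex (up b a) T"
abbreviation N where "N \<equiv> next_ball a b B T"

lemma N_eq: "N = C a \<union> cone_over v pB \<union> cone_over w (pA \<union> cone_over v pT)"
  by (simp add: next_ball_def)

lemma cC: "abstract_complex (C a)" and QC: "Q a \<subseteq> C a"
  using collar_invariant[of a] by auto

lemma cpB: "abstract_complex pB" and cpA: "abstract_complex pA" and cpT: "abstract_complex pT"
  using B cA T by (auto intro: complex_map)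

lemma Q_eq: "Q a = pB \<union> pA"
  by (rule map_complex_Un)

lemma pBC: "pB \<subseteq> C a" and pAC: "pA \<subseteq> C a"
  using QC unfolding Q_eq by auto

lemma pTB: "pT \<subseteq> pB" and pTA: "pT \<subseteq> pA"
  using TB TA by (simp_all only: map_complex_mono)

lemma inj_upS: "inj_on (up b a) (verts S)"
  unfolding vS by (rule inj_up)

lemma inj_upB: "inj_on (up b a) (verts B)" and inj_upA: "inj_on (up b a) (verts A)"
  using inj_upS by (auto intro: inj_on_subset)

lemma up_image_eq: "X \<in> S \<Longrightarrow> Y \<in> S \<Longrightarrow> up b a ` X = up b a ` Y \<Longrightarrow> X = Y"
  using inj_on_image_eq_iff[OF inj_upS, of X Y] by (auto simp: verts_def)

lemma up_mem: "X \<in> K \<Longrightarrow> up b a ` X \<in> map_complex (up b a) K"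
  unfolding map_complex_def by (rule imageI)

lemma up_mem_iff:
  assumes "X \<in> S" "K \<subseteq> S"
  shows "up b a ` X \<in> map_complex (up b a) K \<longleftrightarrow> X \<in> K"
proof
  assume "up b a ` X \<in> map_complex (up b a) K"
  then obtain Y where Y: "Y \<in> K" "up b a ` X = up b a ` Y" unfolding map_complex_def by blast
  have "Y \<in> S" using Y(1) assms(2) by blast
  then have "X = Y" by (rule up_image_eq[OF assms(1) _ Y(2)])
  then show "X \<in> K" using Y by simp
qed (rule up_mem)

lemma pBA: "pB \<inter> pA = pT"
proof
  show "pB \<inter> pA \<subseteq> pT"
  proof
    fix F assume F: "F \<in> pB \<inter> pA"
    then obtain X where X: "X \<in> B" "F = up b a ` X" unfolding map_complex_def by blast
    then have "X \<in> A" using F up_mem_iff[of X A] by auto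
    then have "X \<in> T" using X BA by blast
    then show "F \<in> pT" using X up_mem by simp
  qed
qed (use pTB pTA in blast)

lemma vpB: "verts pB = {x. even x \<and> (x < 2 * b \<or> 2 * b + 4 \<le> x \<and> x < 2 * b + 4 + 2 * a)}" (is "_ = ?R")
proof
  show "verts pB \<subseteq> ?R" unfolding verts_map vB using ab by (auto simp: up_def elim!: oddE)
  show "?R \<subseteq> verts pB"
  proof
    fix x assume x: "x \<in> ?R"
    show "x \<in> verts pB"
    proof (cases "x < 2 * b")
      case True
      then have "x \<in> verts B" "up b a x = x" using x by (auto simp: vB up_def)
      then show ?thesis unfolding verts_map by force
    next
      case False
      let ?y = "x - (2 * b + 3)"
      have x': "even x" "2 * b + 4 \<le> x" "x < 2 * b + 4 + 2 * a" using x False by auto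
      then have "odd ?y" by simp
      moreover from this have "?y < 2 * a" using x'(2,3) by presburger
      moreover have "x = ?y + (2 * b + 3)" using x'(2) by simp
 ultimately have "?y \<in> verts B" "up b a ?y = x" by (auto simp: vB up_def)
      then show ?thesis unfolding verts_map by force
    qed
  qed
qed

text \<open>Among the old vertices, \<open>pA\<close> keeps the positive ones of \<open>T\<close>
  and the negative ones outside \<open>T\<close>. No antipodal pair is left for \<open>w\<close> to
  see.\<close>

lemma vpA:
  assumes "x \<in> verts pA" "x < 2 * b"
  shows "even x \<longleftrightarrow> x < 2 * a"
proof -
  obtain y where "y \<in> verts A" "x = up b a y" using assms(1) unfolding verts_map[of "up b a" A] by blast
  then show ?thesis using assms(2) unfolding vA by (auto simp: up_def split: if_splits)
qed

lemma C_fresh: "F \<in> C a \<Longrightarrow> v \<notin> F \<and> w \<notin> F"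
  using vwC[of a] by (auto simp: verts_def)

lemma fresh: "v \<notin> verts pB" "v \<notin> verts pA" "v \<notin> verts pT" "w \<notin> verts pB" "w \<notin> verts pA" "w \<notin> verts pT"
  using C_fresh pBC pAC pTB unfolding verts_def by blast+

lemma c_inner: "abstract_complex (pA \<union> cone_over v pT)" and w_inner: "w \<notin> verts (pA \<union> cone_over v pT)"
  using cpA cpT fresh complex_empty[OF cpT] by (auto simp: verts_cone intro: complex_Un complex_cone)

lemma cN: "abstract_complex N"
  unfolding N_eq by (rule complex_Un[OF complex_Un[OF cC complex_cone[OF cpB]] complex_cone[OF c_inner]])

lemma S_N: "S \<subseteq> N"
  unfolding N_eq using S_C[of a] by blast

lemma N_iff: "F \<in> N \<longleftrightarrow> F \<in> C a \<or> F - {v} \<in> pB \<or> F - {w} \<in> pA \<or> F - {w} - {v} \<in> pT"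
  unfolding N_eq Un_iff cone_iff[OF cpB fresh(1)] cone_iff[OF c_inner w_inner] cone_iff[OF cpT fresh(3)]
  by blast

lemma N_old: "F \<in> N \<Longrightarrow> F - {v, w} \<in> C a"
proof -
  assume F: "F \<in> N"
  have "F - {v, w} \<in> N" by (rule complex_subset[OF cN F]) blast
  moreover have "F - {v, w} - {v} = F - {v, w}" "F - {v, w} - {w} = F - {v, w}" by auto
  ultimately show ?thesis using pBC pAC pTB unfolding N_iff by auto
qed

lemma N_low: "F \<in> N \<Longrightarrow> F \<subseteq> {..<2 * b} \<Longrightarrow> F \<in> S"
proof -
  assume F: "F \<in> N" "F \<subseteq> {..<2 * b}"
  then have "F - {v, w} = F" by auto
  then show ?thesis using N_old[OF F(1)] F(2) collar_low by simp
qed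

lemma vN: "verts N = {..<2 * b} \<union> {x. even x \<and> x < 2 * (a + b + 2)}"
proof
  have v1: "verts (C a) \<subseteq> {..<2 * b} \<union> {x. even x \<and> x < 2 * (a + b + 2)}"
    using vC[of a] by auto
  have v2: "verts pB \<subseteq> verts (C a)" "verts pA \<subseteq> verts (C a)" "verts pT \<subseteq> verts (C a)"
    using pBC pAC pTB unfolding verts_def by blast+
  have "verts N = verts (C a) \<union> insert v (verts pB) \<union> insert w (verts pA \<union> insert v (verts pT))"
    unfolding N_eq verts_Un verts_cone[OF complex_empty[OF cpB]] verts_cone[OF complex_empty[OF c_inner]]
      verts_cone[OF complex_empty[OF cpT]] by blast
  then have v3: "verts N = verts (C a) \<union> {v, w}" using v2 by blast
  then show "verts N \<subseteq> {..<2 * b} \<union> {x. even x \<and> x < 2 * (a + b + 2)}" using v1 by auto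
  have "verts S \<subseteq> verts N" using S_N unfolding verts_def by blast
  then have lowN: "{..<2 * b} \<subseteq> verts N" unfolding vS .
  show "{..<2 * b} \<union> {x. even x \<and> x < 2 * (a + b + 2)} \<subseteq> verts N"
  proof
    fix x assume x: "x \<in> {..<2 * b} \<union> {x. even x \<and> x < 2 * (a + b + 2)}"
    consider "x < 2 * b" | "x = v" | "x = w" | "\<not> x < 2 * b" "x \<noteq> v" "x \<noteq> w" by blast
    then show "x \<in> verts N"
    proof cases
      case 4
      then have "even x" "x < 2 * b + 4 + 2 * a" using x by auto
      moreover from this have "2 * b + 4 \<le> x" using 4 by presburger
 ultimately have "x \<in> verts pB" unfolding vpB by blast
      then show ?thesis using v2 v3 by blast
    qed (use lowN v3 in auto)
  qed
qed

text \<open>The star condition of Property P on the positive side: \<open>v\<close> sees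
  \<open>w\<close> through the edge \<open>{v, w}\<close>, and all other positive vertices lie in
  \<open>pB\<close>.\<close>

lemma apex_edge:
  assumes "even x" "x < 2 * (a + b + 2)"
  shows "{v, x} \<in> N"
proof -
  have pt: "{} \<in> pT" using cpT by (rule complex_empty)
  have "x = v \<or> x = w \<or> x < 2 * b \<or> 2 * b + 4 \<le> x" using assms(1) by presburger
  then consider "x = v" | "x = w" | "x < 2 * b \<or> 2 * b + 4 \<le> x" by blast
  then show ?thesis
  proof cases
    case 1
    then show ?thesis using pt unfolding N_iff by simp
  next
    case 2
    then have eq: "{v, x} - {w} - {v} = {}" by auto
    show ?thesis using pt unfolding N_iff eq by blast
  next
    case 3
    then have "x \<in> verts pB" unfolding vpB using assms by auto
    then obtain F where "F \<in> pB" "x \<in> F" unfolding verts_def by blast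
    then have "{x} \<in> pB" using complex_subset[OF cpB] by blast
    moreover have eq: "{v, x} - {v} = {x}" using 3 by auto
    ultimately show ?thesis unfolding N_iff eq by blast
  qed
qed

text \<open>Three kinds of new vertices: \<open>v\<close> sees only positive old vertices,
  \<open>w\<close> sees those described by \<open>vpA\<close>, and a vertex replacing an old one
  sees only what that one saw in \<open>S\<close>.\<close>

lemma no_cycle_new:
  assumes x: "x < 2 * b" and y: "2 * b \<le> y" and e: "{y, x} \<in> N" "{y, anti x} \<in> N"
  shows False
proof -
  have ax: "anti x < 2 * b" using x by simp
  consider "y = v" | "y = w" | "y \<noteq> v" "y \<noteq> w" by blast
  then show False
  proof cases
    case 1
    have "even z" if "{v, z} \<in> N" "z < 2 * b" for z
    proof -
      have ne: "{v, z} - {w} - {v} = {z}" "{v, z} - {w} = {v, z}" "{v, z} - {v} = {z}" using that(2) by auto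
      have "{v, z} \<notin> C a" "{v, z} \<notin> pA" using C_fresh pAC by blast+
      then have "{z} \<in> pB" using that(1) pTB unfolding N_iff ne by blast
      then have "z \<in> verts pB" unfolding verts_def by blast
      then show ?thesis unfolding vpB by blast
    qed
    from this[of x] this[of "anti x"] show False using 1 e x ax by simp
  next
    case 2
    have "even z \<longleftrightarrow> z < 2 * a" if "{w, z} \<in> N" "z < 2 * b" for z
    proof -
      have ne: "{w, z} - {w} - {v} = {z}" "{w, z} - {w} = {z}" "{w, z} - {v} = {w, z}" "{z} - {v} = {z}" using that(2) by auto
      have "{w, z} \<notin> C a" "{w, z} \<notin> pB" using C_fresh pBC by blast+
      then have "{z} \<in> pA" using that(1) pTA unfolding N_iff ne by blast
      then have "z \<in> verts pA" unfolding verts_def by blast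
      then show ?thesis using vpA that(2) by blast
    qed
    from this[of x] this[of "anti x"] show False using 2 e x ax by simp
  next
    case 3
    have "{down b y, z} \<in> S" if "{y, z} \<in> N" "z < 2 * b" for z
    proof -
      have "{y, z} - {v, w} = {y, z}" using 3 that(2) by auto
      then have "{y, z} \<in> C a" using N_old[OF that(1)] by simp
      then have "down b ` {y, z} \<in> S" by (rule collar_down) simp
      moreover have "down b z = z" using that(2) by (simp add: down_def)
      ultimately show ?thesis by simp
    qed
    from this[OF e(1) x] this[OF e(2) ax] show False using no_cycle by blast
  qed
qed

lemma N_new_even: "x \<in> F \<Longrightarrow> F \<in> N \<Longrightarrow> 2 * b \<le> x \<Longrightarrow> even x"
proof -
  assume "x \<in> F" "F \<in> N" "2 * b \<le> x"
  then have "x \<in> verts N" unfolding verts_def by blast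
  then show "even x" unfolding vN using \<open>2 * b \<le> x\<close> by auto
qed

lemma anti_ge: "2 * b \<le> anti x \<longleftrightarrow> 2 * b \<le> x"
  using anti_less_iff[of x b] by linarith

text \<open>New vertices in \<open>N\<close> are positive. So an edge at a positive new vertex lies
  in \<open>N\<close>, an edge at a negative one has its mirror image in \<open>N\<close>, and new
  vertices of opposite sign are never adjacent. Edges among old vertices lie in \<open>S\<close>. If
  the antipodal pair is new, reflecting one of the two edges makes an old antipodal pair seen by one
  new vertex.\<close>

lemma no_cycle_N:
  assumes e: "{x, y} \<in> N \<union> map_complex anti N" "{x, anti y} \<in> N \<union> map_complex anti N"
  shows False
proof -
  have mem: "{s, t} \<in> N \<or> {anti s, anti t} \<in> N" if "{s, t} \<in> N \<union> map_complex anti N" for s t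
    using that by (simp add: map_anti_iff)
  have low: "{s, t} \<in> S" if "{s, t} \<in> N \<union> map_complex anti N" "s < 2 * b" "t < 2 * b" for s t
  proof (cases "{s, t} \<in> N")
    case True
    then show ?thesis using that by (intro N_low) auto
  next
    case False
    then have "{anti s, anti t} \<in> N" using mem[OF that(1)] by blast
    then have "{anti s, anti t} \<in> S" using that by (intro N_low) auto
    then have "anti ` {s, t} \<in> S" by simp
    then have "{s, t} \<in> map_complex anti S" by (simp only: map_anti_iff)
    then show ?thesis by (simp only: anti_S)
  qed
  have pos: "{s, t} \<in> N" if "{s, t} \<in> N \<union> map_complex anti N" "2 * b \<le> s" "even s" for s t
    using mem[OF that(1)] N_new_even[of "anti s" "{anti s, anti t}"] that(2,3) by (auto simp: anti_ge)
  have neg: "{anti s, anti t} \<in> N" if "{s, t} \<in> N \<union> map_complex anti N" "2 * b \<le> s" "odd s" for s t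
    using mem[OF that(1)] N_new_even[of s "{s, t}"] that(2,3) by auto
  consider "x < 2 * b" "y < 2 * b" | "2 * b \<le> x" "y < 2 * b" | "x < 2 * b" "2 * b \<le> y" | "2 * b \<le> x" "2 * b \<le> y"
    by linarith
  then show False
  proof cases
    case 1
    then have "{x, y} \<in> S" "{x, anti y} \<in> S" using low[OF e(1)] low[OF e(2)] by simp_all
    then show False using no_cycle by blast
  next
    case 2
    show False
    proof (cases "even x")
      case True
      show False using no_cycle_new[OF 2(2,1)] pos[OF e(1) 2(1) True] pos[OF e(2) 2(1) True] by blast
    next
      case False
      have "2 * b \<le> anti x" using 2(1) by (simp only: anti_ge)
      then show False
        using no_cycle_new[OF 2(2)] neg[OF e(1) 2(1) False] neg[OF e(2) 2(1) False]
        by (metis anti_anti)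
    qed
  next
    case 3
    have e': "{y, x} \<in> N \<union> map_complex anti N" "{anti y, x} \<in> N \<union> map_complex anti N"
      using e by (simp_all add: insert_commute)
    have ay: "2 * b \<le> anti y" using 3(2) by (simp only: anti_ge)
    show False
    proof (cases "even y")
      case True
      have "{y, x} \<in> N" by (rule pos[OF e'(1) 3(2) True])
      moreover have "{anti (anti y), anti x} \<in> N" by (rule neg[OF e'(2) ay]) (use True in simp)
      then have "{y, anti x} \<in> N" by simp
      ultimately show False by (rule no_cycle_new[OF 3(1,2)])
    next
      case False
      have "{anti y, x} \<in> N" by (rule pos[OF e'(2) ay]) (use False in simp)
      moreover have "{anti y, anti x} \<in> N" by (rule neg[OF e'(1) 3(2) False])
      ultimately show False by (rule no_cycle_new[OF 3(1) ay])
    qed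
  next
    case 4
    have ay: "2 * b \<le> anti y" and ax: "2 * b \<le> anti x" using 4 by (simp_all only: anti_ge)
    show False
    proof (cases "even x")
      case True
      have "{x, y} \<in> N" "{x, anti y} \<in> N" using pos[OF _ 4(1) True] e by blast+
      then have "even y" "even (anti y)"
        using N_new_even[of y "{x, y}"] N_new_even[of "anti y" "{x, anti y}"] 4 ay by blast+
      then show False by simp
    next
      case False
      have "{anti x, anti y} \<in> N" "{anti x, anti (anti y)} \<in> N" using neg[OF _ 4(1) False] e by blast+
      then have "even (anti y)" "even (anti (anti y))"
        using N_new_even[of "anti y" "{anti x, anti y}"] N_new_even[of "anti (anti y)" "{anti x, anti (anti y)}"]
          4 ay by auto
      then show False by simp
    qed
  qed
qed

text \<open>The last step exchanges the cone \<open>v * pA\<close> for the cone from \<open>w\<close> over its boundary.\<close>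

lemma replace_sides:
  shows "C a \<union> cone_over v (Q a) = (C a \<union> cone_over v pB) \<union> cone_over v pA"
    and "(C a \<union> cone_over v pB) \<inter> cone_over v pA = pA \<union> cone_over v pT"
    and "(C a \<union> cone_over v pB) \<inter> cone_over w (pA \<union> cone_over v pT) = pA \<union> cone_over v pT"
proof -
  show "C a \<union> cone_over v (Q a) = (C a \<union> cone_over v pB) \<union> cone_over v pA"
    unfolding Q_eq cone_Un by blast
  show "(C a \<union> cone_over v pB) \<inter> cone_over v pA = pA \<union> cone_over v pT"
  proof (rule set_eqI)
    fix F
    show "F \<in> (C a \<union> cone_over v pB) \<inter> cone_over v pA \<longleftrightarrow> F \<in> pA \<union> cone_over v pT"
    proof (cases "v \<in> F")
      case True
      then have "F \<notin> C a" "F \<notin> pA" using C_fresh pAC by blast+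
      then show ?thesis
        unfolding Int_iff Un_iff cone_iff[OF cpB fresh(1)] cone_iff[OF cpA fresh(2)] cone_iff[OF cpT fresh(3)]
        using pBA by blast
    next
      case False
      then have "F - {v} = F" by auto
      then show ?thesis
        unfolding Int_iff Un_iff cone_iff[OF cpB fresh(1)] cone_iff[OF cpA fresh(2)] cone_iff[OF cpT fresh(3)]
        using pAC pTA by auto
    qed
  qed
  show "(C a \<union> cone_over v pB) \<inter> cone_over w (pA \<union> cone_over v pT) = pA \<union> cone_over v pT"
  proof (rule set_eqI)
    fix F
    show "F \<in> (C a \<union> cone_over v pB) \<inter> cone_over w (pA \<union> cone_over v pT) \<longleftrightarrow> F \<in> pA \<union> cone_over v pT"
    proof (cases "w \<in> F")
      case True
      then have "F - {v} \<notin> pB" using fresh(4) by (auto simp: verts_def)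
      moreover have "F \<notin> C a" using C_fresh True by blast
      moreover have "F \<notin> pA \<union> cone_over v pT" using w_inner True by (auto simp: verts_def simp del: verts_Un)
      ultimately show ?thesis unfolding Int_iff Un_iff cone_iff[OF cpB fresh(1)] by blast
    next
      case False
      then have "F - {w} = F" by auto
      moreover have "pA \<union> cone_over v pT \<subseteq> C a \<union> cone_over v pB"
        using pAC cone_mono[OF pTB, of v] by blast
      ultimately show ?thesis unfolding Int_iff cone_iff[OF c_inner w_inner] by auto
    qed
  qed
qed

lemma cL: "abstract_complex (C a \<union> cone_over v pB)"
  using cC cpB by (intro complex_Un complex_cone)

text \<open>The auxiliary apex \<open>2 * b + 6 + 2 * a\<close> is even, hence fixed by
  \<open>up\<close>, and larger than every vertex of the collar.\<close>

lemma inj_up_cone: "inj_on (up b a) (verts (cone_over (2 * b + 6 + 2 * a) T))" (is "inj_on _ (verts (cone_over ?c T))")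
proof -
  have "up b a x < ?c" if "x < 2 * a" for x using that ab by (auto simp: up_def)
  moreover have "up b a ?c = ?c" by (simp add: up_def)
  moreover have "inj_on (up b a) {..<2 * a}" using ab by (intro inj_on_subset[OF inj_up]) auto
  ultimately have "inj_on (up b a) (insert ?c {..<2 * a})" by (force simp: inj_on_insert)
  moreover have "verts (cone_over ?c T) = insert ?c {..<2 * a}"
    using complex_empty[OF T] by (simp add: verts_cone vT)
  ultimately show ?thesis by simp
qed

lemma cone_N: "pl_equiv S N (cone_over v S)"
proof -
  let ?c = "2 * b + 6 + 2 * a"
  \<comment> \<open>\<open>coneA\<close> returns the antipode of its argument as apex, so it is
    applied to \<open>anti ?c\<close>.\<close>
  have cn: "anti ?c \<notin> {..<2 * a}" using anti_ge[of ?c] ab by auto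
  have "pl_equiv T A (cone_over (anti (anti ?c)) T)" by (rule coneA[OF cn])
  then have eA: "pl_equiv T A (cone_over ?c T)" by simp
  have "pl_equiv pT pA (map_complex (up b a) (cone_over ?c T))"
    by (rule pl_equiv_map[OF cA inj_upA complex_cone[OF T] inj_up_cone TA eA])
  moreover have "up b a ?c = ?c" by (simp add: up_def)
  ultimately have e: "pl_equiv pT pA (cone_over ?c pT)" by (simp add: map_complex_cone)
  have cf: "?c \<notin> verts pA"
  proof -
    have "verts pA \<subseteq> verts (C a)" using pAC unfolding verts_def by blast
    then show ?thesis using vC[of a] by auto
  qed
  have P: "pl_equiv (pA \<union> cone_over v pT) (cone_over w (pA \<union> cone_over v pT)) (cone_over v pA)"
    by (rule pl_equiv_cone_boundary[OF cpA fresh(2,5) cpT pTA _ cf _ _ e]) auto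
  let ?L = "C a \<union> cone_over v pB"
  have "pl_equiv (?L \<union> (pA \<union> cone_over v pT)) (?L \<union> cone_over w (pA \<union> cone_over v pT)) (?L \<union> cone_over v pA)"
  proof (rule pl_equiv_glue[OF cL complex_cone[OF c_inner] cL complex_cone[OF cpA] pl_equiv_refl[OF cL] P])
    show "?L \<inter> cone_over w (pA \<union> cone_over v pT) = ?L \<inter> cone_over v pA"
      unfolding replace_sides ..
    show "?L \<inter> cone_over w (pA \<union> cone_over v pT) \<subseteq> ?L" by blast
    show "?L \<inter> cone_over w (pA \<union> cone_over v pT) \<subseteq> pA \<union> cone_over v pT"
      unfolding replace_sides by blast
    show "?L \<subseteq> ?L" ..
    show "pA \<union> cone_over v pT \<subseteq> cone_over w (pA \<union> cone_over v pT)" by (rule subset_cone)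
  qed
  then have "pl_equiv S (?L \<union> cone_over w (pA \<union> cone_over v pT)) (?L \<union> cone_over v pA)"
    using S_C[of a] by (rule_tac pl_equiv_mono) blast+
  then have "pl_equiv S N (C a \<union> cone_over v (Q a))" unfolding N_eq replace_sides(1) .
  then show ?thesis using collar_invariant[of a] pl_equiv_trans by blast
qed

text \<open>The exchanged cones have the same boundary \<open>pA \<union> cone_over v pT\<close>,
  which is closed because its two parts meet in their common boundary \<open>pT\<close>. Hence the
  boundary \<open>S\<close> obtained from the collar is unaffected.\<close>

lemma pmN: "pseudomanifold (Suc (Suc n)) N S"
  unfolding N_eq
proof (rule pseudomanifold_replace[OF cL complex_cone[OF cpA] complex_cone[OF c_inner] replace_sides(2,3)])
  have cT: "cone_over v {} = {}" by (simp add: cone_over_def)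
  have pmpA: "pseudomanifold (Suc n) pA pT" by (rule pseudomanifold_map[OF cA inj_upA TA pmA])
  have pmpT: "pseudomanifold n pT {}"
    using pseudomanifold_map[OF T _ _ pmT, of "up b a"] inj_on_subset[OF inj_upB, of "verts T"] TB
    by (auto simp: verts_def map_complex_def)
  have cardT: "card F < Suc n" if "F \<in> pT" for F
    using pseudomanifold_card_le[OF cpT pmpT that] by simp
  have pmX: "pseudomanifold (Suc n) (pA \<union> cone_over v pT) {}"
  proof (rule pseudomanifold_Un[OF cpA complex_cone[OF cpT] _ cardT pmpA])
    show "pA \<inter> cone_over v pT = pT"
      using fresh(2) pTA by (auto simp: cone_over_def verts_def)
    show "pseudomanifold (Suc n) (cone_over v pT) pT"
      using pseudomanifold_cone[OF cpT fresh(3) _ pmpT] by (simp add: cT)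
  qed
  show "pseudomanifold (Suc (Suc n)) (C a \<union> cone_over v pB \<union> cone_over v pA) S"
    using collar_invariant[of a] unfolding replace_sides(1) by simp
  show "pseudomanifold (Suc (Suc n)) (cone_over v pA) (pA \<union> cone_over v pT)"
    by (rule pseudomanifold_cone[OF cpA fresh(2) pTA pmpA])
  show "pseudomanifold (Suc (Suc n)) (cone_over w (pA \<union> cone_over v pT)) (pA \<union> cone_over v pT)"
    using pseudomanifold_cone[OF c_inner w_inner _ pmX] by (simp add: cone_over_def)
  show "S \<subseteq> C a \<union> cone_over v pB" using S_C[of a] by blast
  show "card F < Suc (Suc n)" if "F \<in> pA \<union> cone_over v pT" for F
    using pseudomanifold_card_le[OF c_inner pmX that] by simp
qed

lemma step_N: "step b (a + b + 2) (Suc n) N S"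
proof
  show "b \<le> a + b + 2" by simp
  show "pl_equiv S N (cone_over c S)" if "c \<notin> {..<2 * b}" for c
  proof -
    have "pl_equiv S (cone_over v S) (cone_over c S)"
      using that by (intro pl_equiv_cone_apex cS) (simp_all only: vS, simp_all)
    then show ?thesis using cone_N pl_equiv_trans by blast
  qed
  show "{x, anti y} \<notin> N \<union> map_complex anti N" if "{x, y} \<in> N \<union> map_complex anti N" for x y
    using no_cycle_N[OF that] by blast
qed (use cN cS S_N vN vS N_low anti_S pmN pmS sphS in \<open>simp_all del: verts_Un\<close>)

section \<open>Positive faces and new faces of the next ball\<close>

lemma even_faces_N: "even_faces N = cone_over v (pB \<union> cone_over w pT)"
proof -
  have cwT: "abstract_complex (pB \<union> cone_over w pT)" "v \<notin> verts (pB \<union> cone_over w pT)"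
    using cpB cpT fresh complex_empty[OF cpT] by (auto simp: verts_cone intro: complex_Un complex_cone)
  have iff: "F \<in> cone_over v (pB \<union> cone_over w pT) \<longleftrightarrow> F - {v} \<in> pB \<or> F - {v} - {w} \<in> pT" for F
    unfolding cone_iff[OF cwT] Un_iff cone_iff[OF cpT fresh(6)] ..
  have comm: "F - {v} - {w} = F - {w} - {v}" for F :: "nat set" by auto
  have evB: "even x" if "x \<in> F" "F \<in> pB" for x F
  proof -
    have "x \<in> verts pB" using that unfolding verts_def by blast
    then show ?thesis unfolding vpB by blast
  qed
  show ?thesis
  proof
    show "cone_over v (pB \<union> cone_over w pT) \<subseteq> even_faces N"
    proof
      fix F assume F: "F \<in> cone_over v (pB \<union> cone_over w pT)"
      have "F \<in> N" using F unfolding iff N_iff comm by blast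
      moreover have "even x" if "x \<in> F" for x
      proof (cases "x = v \<or> x = w")
        case False
        have "F - {v} \<in> pB \<or> F - {v} - {w} \<in> pB" using F pTB unfolding iff by blast
        then show ?thesis using evB[of x "F - {v}"] evB[of x "F - {v} - {w}"] that False by blast
      qed auto
      ultimately show "F \<in> even_faces N" unfolding even_faces_def by blast
    qed
    show "even_faces N \<subseteq> cone_over v (pB \<union> cone_over w pT)"
    proof
      fix F assume "F \<in> even_faces N"
      then have F: "F \<in> N" "\<And>x. x \<in> F \<Longrightarrow> even x" unfolding even_faces_def by blast+
      let ?F = "F - {v, w}"
      \<comment> \<open>A positive face avoids all replaced vertices, so its part in the collar lies
        in the link of \<open>v\<close> before the apex is split.\<close>
      have "?F \<in> Q a" using F(2) by (intro collar_avoid[OF N_old[OF F(1)]]) auto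
      then obtain X where X: "X \<in> S" "?F = up b a ` X" unfolding map_complex_def by blast
      have XB: "X \<in> B"
      proof (rule ccontr)
        assume "X \<notin> B"
        then have XA: "X \<in> A" using X by blast
        \<comment> \<open>A vertex of \<open>A\<close> outside \<open>T\<close> is negative and not
          moved by \<open>up\<close>, so a positive image forces every vertex of \<open>X\<close>
          into \<open>T\<close>.\<close>
        have "x < 2 * a" if "x \<in> X" for x
        proof -
          have "up b a x \<in> ?F" using X(2) that by blast
          then have "even (up b a x)" using F(2) by blast
          moreover have "x \<in> verts A" using XA that unfolding verts_def by blast
          ultimately show ?thesis unfolding vA by (auto simp: up_def split: if_splits)
        qed
        then have "anti ` X \<subseteq> {..<2 * a}" by auto
        moreover have "anti ` X \<in> B" using XA by (simp only: map_anti_iff)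
        ultimately have "anti ` X \<in> T" by (intro ind)
        then have "X \<in> map_complex anti T" by (simp only: map_anti_iff)
        then have "X \<in> T" by (simp only: anti_T)
        then show False using \<open>X \<notin> B\<close> TB by blast
      qed
      have FB: "?F \<in> pB" using X XB up_mem by simp
      show "F \<in> cone_over v (pB \<union> cone_over w pT)"
      proof (cases "w \<in> F")
        case False
        then have "F - {v} = ?F" by auto
        then show ?thesis unfolding iff using FB by simp
      next
        case True
        have "F \<notin> C a" using C_fresh True by blast
        moreover have "F - {v} \<notin> pB" using fresh(4) True by (auto simp: verts_def)
        ultimately have "F - {w} \<in> pA \<or> F - {w} - {v} \<in> pT" using F(1) unfolding N_iff by blast
        moreover have "?F \<subseteq> F - {w}" "F - {w} - {v} = ?F" by auto
        ultimately have "?F \<in> pA" using complex_subset[OF cpA] pTA by auto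
        then have "?F \<in> pT" using FB pBA by blast
        then show ?thesis unfolding iff comm \<open>F - {w} - {v} = ?F\<close> by blast
      qed
    qed
  qed
qed

text \<open>\<open>pB\<close> is a cone over \<open>pT\<close> relative to \<open>pT\<close>;
  together with the cone from \<open>w\<close> it forms a suspension of the sphere
  \<open>pT\<close>. The positive faces are the cone from \<open>v\<close> over this sphere.\<close>

lemma ball_even_faces_N: "ball_complex (Suc n) (even_faces N)"
proof -
  let ?c = "2 * b + 6 + 2 * a"
  have cn: "?c \<notin> {..<2 * a}" by simp
  have upc: "up b a ?c = ?c" by (simp add: up_def)
  have "pl_equiv pT pB (map_complex (up b a) (cone_over ?c T))"
    by (rule pl_equiv_map[OF B inj_upB complex_cone[OF T] inj_up_cone TB coneB[OF cn]])
  then have e: "pl_equiv pT pB (cone_over ?c pT)" by (simp add: map_complex_cone upc)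
  have cf: "?c \<notin> verts pT"
  proof -
    have "verts pT \<subseteq> verts pB" using pTB unfolding verts_def by blast
    then show ?thesis unfolding vpB by auto
  qed
  have I: "cone_over ?c pT \<inter> cone_over w pT = pT"
    using cone_inter_cone[of ?c w pT pT] cf fresh(6) by auto
  have I': "pB \<inter> cone_over w pT = pT"
    using fresh(4) pTB by (auto simp: cone_over_def verts_def)
  have "pl_equiv (pT \<union> pT) (pB \<union> cone_over w pT) (cone_over ?c pT \<union> cone_over w pT)"
    by (rule pl_equiv_glue[OF cpB complex_cone[OF cpT] complex_cone[OF cpT] complex_cone[OF cpT] e
        pl_equiv_refl[OF complex_cone[OF cpT]]]) (use I I' pTB subset_cone[of pT w] in auto)
  then have "pl_equiv {{}} (pB \<union> cone_over w pT) (cone_over ?c pT \<union> cone_over w pT)"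
    using complex_empty[OF cpT] by (rule_tac pl_equiv_mono) auto
  moreover have "sphere_complex n pT"
  proof (rule sphere_complex_map[OF sphT])
    show "inj_on (up b a) (verts T)" unfolding vT using ab by (intro inj_on_subset[OF inj_up]) auto
  qed
  then have "sphere_complex (Suc n) (cone_over ?c pT \<union> cone_over w pT)"
    using cf fresh(6) by (intro sphere_complex_suspension) auto
  ultimately have "sphere_complex (Suc n) (pB \<union> cone_over w pT)"
    using cpB cpT by (intro sphere_complex_cong[of "pB \<union> cone_over w pT"] complex_Un complex_cone)
  then show ?thesis
    unfolding even_faces_N using fresh complex_empty[OF cpT]
    by (intro ball_complex_cone_sphere) (auto simp: verts_cone)
qed

text \<open>Apart from \<open>v\<close> and \<open>w\<close>, the new vertices are the images of the
  negative vertices of \<open>T\<close>. By the symmetry of \<open>T\<close>, its negative faces are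
  the antipodes of its positive ones, whence the two maps applied to
  \<open>even_faces T\<close>.\<close>

lemma new_faces_N:
  "{F \<in> N. \<forall>x\<in>F. 2 * b \<le> x} = cone_over v (cone_over w (map_complex (up b a) (map_complex anti (even_faces T))))"
  (is "_ = cone_over v (cone_over w ?O)")
proof -
  have "abstract_complex (even_faces T)" using T unfolding even_faces_def by (auto simp: abstract_complex_def)
  then have cO: "abstract_complex ?O" by (intro complex_map)
  have OT: "?O \<subseteq> pT"
  proof -
    have "map_complex anti (even_faces T) \<subseteq> map_complex anti T"
      unfolding map_complex_def even_faces_def by (intro image_mono) auto
    then show ?thesis unfolding anti_T unfolding map_complex_def[of "up b a"] by (rule image_mono)
  qed
  then have "verts ?O \<subseteq> verts pT" unfolding verts_def by (rule Union_mono)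
  then have fO: "v \<notin> verts ?O" "w \<notin> verts ?O" using contra_subsetD[OF _ fresh(3)] contra_subsetD[OF _ fresh(6)] by simp_all
  have cwO: "abstract_complex (cone_over w ?O)" "v \<notin> verts (cone_over w ?O)"
    using cO fO complex_empty[OF cO] by (auto simp: verts_cone intro: complex_cone)
  have iff: "F \<in> cone_over v (cone_over w ?O) \<longleftrightarrow> F - {v} - {w} \<in> ?O" for F
    unfolding cone_iff[OF cwO] cone_iff[OF cO fO(2)] ..
  have O: "up b a ` X \<in> ?O" if "X \<in> T" "\<And>x. x \<in> X \<Longrightarrow> odd x" for X
  proof (rule up_mem)
    have "anti ` X \<in> map_complex anti T" using that(1) unfolding map_complex_def by (rule imageI)
    then have "anti ` X \<in> even_faces T" using that(2) unfolding anti_T even_faces_def by auto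
    then show "X \<in> map_complex anti (even_faces T)" by (simp only: map_anti_iff)
  qed
  have O2: "2 * b \<le> x" if h: "x \<in> F" "F \<in> ?O" for x F
  proof -
    obtain Y where Y: "Y \<in> even_faces T" "F = up b a ` anti ` Y" using h(2) unfolding map_complex_def by blast
    then obtain y where y: "y \<in> Y" "x = up b a (anti y)" using h(1) by blast
    have "even y" "Y \<in> T" using Y(1) y(1) unfolding even_faces_def by blast+
    then have "y < 2 * a" using vT y(1) unfolding verts_def by blast
    then have "odd (anti y)" "anti y < 2 * a" using \<open>even y\<close> by auto
    then show ?thesis unfolding y(2) up_def by simp
  qed
  show ?thesis
  proof
    show "cone_over v (cone_over w ?O) \<subseteq> {F \<in> N. \<forall>x\<in>F. 2 * b \<le> x}"
    proof
      fix F assume "F \<in> cone_over v (cone_over w ?O)"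
      then have F: "F - {v} - {w} \<in> ?O" unfolding iff .
      have "F - {w} - {v} = F - {v} - {w}" by auto
      then have "F \<in> N" using F OT unfolding N_iff by auto
      moreover have "2 * b \<le> x" if "x \<in> F" for x
        using O2[OF _ F, of x] that by (cases "x = v \<or> x = w") auto
      ultimately show "F \<in> {F \<in> N. \<forall>x\<in>F. 2 * b \<le> x}" by blast
    qed
    show "{F \<in> N. \<forall>x\<in>F. 2 * b \<le> x} \<subseteq> cone_over v (cone_over w ?O)"
    proof
      fix F assume "F \<in> {F \<in> N. \<forall>x\<in>F. 2 * b \<le> x}"
      then have F: "F \<in> N" "\<And>x. x \<in> F \<Longrightarrow> 2 * b \<le> x" by blast+
      let ?F = "F - {v, w}"
      have "2 * a \<le> x" if "x \<in> F" for x using F(2)[OF that] ab by simp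
      then have "?F \<in> Q a" by (intro collar_avoid[OF N_old[OF F(1)]]) auto
      then obtain X where X: "X \<in> S" "?F = up b a ` X" unfolding map_complex_def by blast
      have x: "odd x \<and> x < 2 * a" if "x \<in> X" for x
      proof -
        have "up b a x \<in> ?F" using X(2) that by blast
        then have "2 * b \<le> up b a x" using F(2) by blast
        moreover have "x < 2 * b" using X(1) that vS unfolding verts_def by blast
        ultimately show ?thesis by (auto simp: up_def split: if_splits)
      qed
      have "X \<in> T"
      proof (cases "X \<in> B")
        case True
        then show ?thesis using x by (intro ind) auto
      next
        case False
        then have "anti ` X \<in> B" using X(1) unfolding Un_iff map_anti_iff by blast
        then have "anti ` X \<in> T" using x by (intro ind) auto
        then have "X \<in> map_complex anti T" by (simp only: map_anti_iff)
        then show ?thesis by (simp only: anti_T)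
      qed
      then have "?F \<in> ?O" unfolding X(2) using x by (intro O) auto
      moreover have "F - {v} - {w} = ?F" by auto
      ultimately show "F \<in> cone_over v (cone_over w ?O)" unfolding iff by simp
    qed
  qed
qed

text \<open>Coning twice raises the dimension of the ball of positive faces of \<open>T\<close> from
  \<open>n - 1\<close> to \<open>Suc n\<close>. For \<open>n = 0\<close> the complex
  \<open>T\<close> has only the empty face, and the new faces are those of the edge
  \<open>{v, w}\<close>.\<close>

lemma ball_new_faces_N:
  assumes "n = 0 \<or> ball_complex (n - 1) (even_faces T)" "n = 0 \<Longrightarrow> T = {{}}"
  shows "ball_complex (Suc n) {F \<in> N. \<forall>x\<in>F. 2 * b \<le> x}"
proof -
  let ?O = "map_complex (up b a) (map_complex anti (even_faces T))"
  have vO: "verts ?O \<subseteq> verts pT"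
  proof -
    have "verts (map_complex anti (even_faces T)) \<subseteq> verts (map_complex anti T)"
      unfolding verts_map even_faces_def by (intro image_mono) (auto simp: verts_def)
    then show ?thesis unfolding anti_T verts_map[of "up b a"] by (rule image_mono)
  qed
  then have fO: "v \<notin> verts ?O" "w \<notin> verts ?O" using fresh by blast+
  show ?thesis
  proof (cases "n = 0")
    case True
    then have "T = {{}}" using assms(2) by simp
    then have "?O = {{}}" by (auto simp: even_faces_def map_complex_def)
    moreover have "cone_over v (cone_over w {{}}) = Pow {v, w}" by (auto simp: cone_over_def)
    ultimately show ?thesis unfolding new_faces_N using ball_complex_Pow[of "{v, w}" 1] True by simp
  next
    case False
    then obtain k where k: "n = Suc k" by (cases n) auto
    then have ball: "ball_complex k (even_faces T)" using assms(1) by simp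
    have "verts (map_complex anti (even_faces T)) \<subseteq> {..<2 * b}"
    proof -
      have "verts (even_faces T) \<subseteq> verts T" by (auto simp: even_faces_def verts_def)
      then have "verts (map_complex anti (even_faces T)) \<subseteq> anti ` verts T" unfolding verts_map by (rule image_mono)
      then show ?thesis using ab unfolding vT by auto
    qed
    then have "ball_complex k ?O"
      by (intro ball_complex_map[OF ball_complex_map[OF ball inj_anti]] inj_on_subset[OF inj_up])
    then have bw: "ball_complex (Suc k) (cone_over w ?O)" using fO by (intro ball_complex_cone)
    have "abstract_complex ?O" using \<open>ball_complex k ?O\<close> unfolding ball_complex_def by blast
    then have "v \<notin> verts (cone_over w ?O)" using fO by (simp add: verts_cone complex_empty)
    then show ?thesis unfolding new_faces_N k by (intro ball_complex_cone bw)
  qed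
qed

section \<open>Ball, boundary, symmetry and star conditions at one level\<close>

lemma ball_B: "ball_complex n B"
proof -
  have "pl_equiv T B (cone_over (2 * a) T)" by (rule coneB) simp
  then have "pl_equiv {{}} B (cone_over (2 * a) T)"
    by (rule pl_equiv_mono) (simp add: complex_empty[OF T])
  moreover have "ball_complex n (cone_over (2 * a) T)"
    by (rule ball_complex_cone_sphere[OF sphT]) (simp add: vT)
  ultimately show ?thesis by (rule ball_complex_cong[OF B])
qed

lemma boundary_B: "boundary n B = T"
  by (rule boundary_pseudomanifold[OF B pmB T TB pseudomanifold_pure_ex[OF pmT]])

text \<open>A positive face of the mirror image has all its vertices in \<open>T\<close>, and is
  therefore a face of \<open>T\<close> by inducedness and symmetry.\<close>

lemma even_faces_S: "even_faces S = even_faces B"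
proof -
  have "F \<in> B" if "F \<in> A" "\<forall>x\<in>F. even x" for F
  proof -
    have "F \<subseteq> verts A" using that(1) by (auto simp: verts_def)
    then have "F \<subseteq> {..<2 * a}" using that(2) unfolding vA by auto
    then have "anti ` F \<subseteq> {..<2 * a}" by auto
    moreover have "anti ` F \<in> B" using that(1) by (simp only: map_anti_iff)
    ultimately have "anti ` F \<in> T" by (intro ind)
    then have "F \<in> map_complex anti T" by (simp only: map_anti_iff)
    then show ?thesis using TB by (simp only: anti_T) blast
  qed
  then show ?thesis unfolding even_faces_def by blast
qed

text \<open>The degenerate instance of \<open>no_cycle\<close> in which one of the two edges is the
  vertex \<open>{x}\<close>.\<close>

lemma no_antipodal_edge: "{x, anti x} \<notin> S"
proof
  assume e: "{x, anti x} \<in> S"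
  have "{x, x} \<in> S" by (rule complex_subset[OF cS e]) auto
  then show False using no_cycle e by blast
qed

lemma centrally_symmetric_S: "centrally_symmetric S anti"
  unfolding centrally_symmetric_def
proof (intro conjI ballI impI)
  show "abstract_complex S" by (rule cS)
  fix x assume "x \<in> verts S"
  then show "anti x \<in> verts S" unfolding vS by simp
next
  fix F assume F: "F \<in> S"
  then have "anti ` F \<in> map_complex anti S" unfolding map_complex_def by (rule imageI)
  then show "anti ` F \<in> S" by (simp only: anti_S)
  assume "F \<noteq> {}"
  then obtain x where x: "x \<in> F" by blast
  show "anti ` F \<noteq> F"
  proof
    assume "anti ` F = F"
    then have "anti x \<in> F" using x by blast
    then have "{x, anti x} \<in> S" using x by (intro complex_subset[OF cS F]) auto
    then show False using no_antipodal_edge by blast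
  qed
qed auto

text \<open>In an invariant 4-cycle the antipode of a vertex \<open>p0\<close> is again on the
  cycle. If it is a neighbour of \<open>p0\<close>, there is an antipodal edge; if it is the
  opposite vertex, then \<open>p1\<close> is adjacent to an antipodal pair. Both are
  excluded.\<close>

lemma no_induced_4_cycle: "\<not> has_induced_cs_4_cycle S anti"
proof
  assume "has_induced_cs_4_cycle S anti"
  then obtain W where iso: "isomorphic_complexes (induced S W) four_cycle"
    and sym: "map_complex anti (induced S W) = induced S W"
    unfolding has_induced_cs_4_cycle_def by blast
  let ?I = "induced S W"
  obtain \<phi> where bij: "bij_betw \<phi> (verts ?I) (verts four_cycle)" and img: "map_complex \<phi> ?I = four_cycle"
    using iso unfolding isomorphic_complexes_def by blast
  have v4: "verts four_cycle = {0, 1, 2, 3}" by (auto simp: verts_def four_cycle_def)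
  have ex: "\<exists>p. p \<in> verts ?I \<and> \<phi> p = i" if "i \<in> {0, 1, 2, 3}" for i
  proof -
    have "i \<in> \<phi> ` verts ?I" using bij that unfolding bij_betw_def v4 by blast
    then show ?thesis by blast
  qed
  obtain p0 p1 p2 p3 where p: "p0 \<in> verts ?I" "p1 \<in> verts ?I" "p2 \<in> verts ?I" "p3 \<in> verts ?I"
    "\<phi> p0 = 0" "\<phi> p1 = 1" "\<phi> p2 = 2" "\<phi> p3 = 3"
    using ex[of 0] ex[of 1] ex[of 2] ex[of 3] by auto
  have inj: "inj_on \<phi> (verts ?I)" using bij by (simp add: bij_betw_def)
  have edge: "{x, y} \<in> S" if xy: "x \<in> verts ?I" "y \<in> verts ?I" "{\<phi> x, \<phi> y} \<in> four_cycle" for x y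
  proof -
    obtain F where F: "F \<in> ?I" "{\<phi> x, \<phi> y} = \<phi> ` F"
      using xy(3) unfolding img[symmetric] map_complex_def by blast
    have FI: "F \<subseteq> verts ?I" using F(1) by (auto simp: verts_def)
    have in_F: "z \<in> F" if "z \<in> verts ?I" "\<phi> z \<in> \<phi> ` F" for z
      using that inj_on_image_mem_iff[OF inj that(1) FI] by simp
    have "\<phi> x \<in> \<phi> ` F" "\<phi> y \<in> \<phi> ` F" unfolding F(2)[symmetric] by auto
    then have "x \<in> F" "y \<in> F" using in_F xy(1,2) by simp_all
    moreover have "F \<in> S" using F(1) unfolding induced_def by blast
    ultimately show ?thesis using complex_subset[OF cS, of F "{x, y}"] by simp
  qed
  have "anti p0 \<in> verts ?I"
  proof -
    have "anti p0 \<in> verts (map_complex anti ?I)" using p(1) unfolding verts_map by blast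
    then show ?thesis by (simp only: sym)
  qed
  then have "\<phi> (anti p0) \<in> {0, 1, 2, 3}" using bij unfolding bij_betw_def v4 by blast
  then have "\<phi> (anti p0) = \<phi> p0 \<or> \<phi> (anti p0) = \<phi> p1 \<or> \<phi> (anti p0) = \<phi> p2 \<or> \<phi> (anti p0) = \<phi> p3"
    using p by auto
  then consider "anti p0 = p0" | "anti p0 = p1" | "anti p0 = p2" | "anti p0 = p3"
    using inj_onD[OF inj] p(1-4) \<open>anti p0 \<in> verts ?I\<close> by metis
  then show False
  proof cases
    case 1
    then show False by simp
  next
    case 2
    have "{p0, p1} \<in> S" using p by (intro edge) (auto simp: four_cycle_def)
    then show False using no_antipodal_edge[of p0] 2 by simp
  next
    case 3
    have "{p1, p0} \<in> S" "{p1, p2} \<in> S" using p by (intro edge; auto simp: four_cycle_def insert_commute)+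
    then show False using no_cycle[of p1 p0] 3 by simp
  next
    case 4
    have "{p0, p3} \<in> S" using p by (intro edge) (auto simp: four_cycle_def insert_commute)
    then show False using no_antipodal_edge[of p0] 4 by simp
  qed
qed

lemma f0_S: "f0 S = 2 * b"
  unfolding f0_def vS by simp

abbreviation D where "D \<equiv> {F \<in> B. \<forall>x\<in>F. 2 * a \<le> x}"

lemma even_D: "x \<in> verts D \<Longrightarrow> even x"
proof -
  assume "x \<in> verts D"
  then obtain F where "F \<in> B" "x \<in> F" "2 * a \<le> x" by (auto simp: verts_def)
  moreover from this have "x \<in> verts B" by (auto simp: verts_def)
  ultimately show "even x" unfolding vB by auto
qed

lemma delete_S: "delete S T = D \<union> map_complex anti D"
proof -
  have "x \<in> verts S - verts T \<longleftrightarrow> 2 * a \<le> x" if "x \<in> F" "F \<in> S" for x F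
  proof -
    have "x \<in> verts S" using that unfolding verts_def by blast
    then show ?thesis unfolding vT by (simp add: not_less del: verts_Un)
  qed
  then have "F \<subseteq> verts S - verts T \<longleftrightarrow> (\<forall>x\<in>F. 2 * a \<le> x)" if "F \<in> S" for F
    using that by blast
  then have d: "delete S T = {F \<in> S. \<forall>x\<in>F. 2 * a \<le> x}"
    unfolding delete_def induced_def by blast
  have "2 * a \<le> anti x \<longleftrightarrow> 2 * a \<le> x" for x using anti_less_iff[of x a] by linarith
  then have "F \<in> map_complex anti D \<longleftrightarrow> F \<in> A \<and> (\<forall>x\<in>F. 2 * a \<le> x)" for F
    unfolding map_anti_iff by simp
  then show ?thesis unfolding d by blast
qed

lemma disjoint_D: "verts D \<inter> verts (map_complex anti D) = {}"
proof -
  have "odd x" if "x \<in> verts (map_complex anti D)" for x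
    using that even_D unfolding verts_map by fastforce
  then show ?thesis using even_D by blast
qed

lemma star_cover:
  assumes "\<And>x. even x \<Longrightarrow> x < 2 * b \<Longrightarrow> {u, x} \<in> B"
  shows "verts (star S {u}) \<union> verts (star S {anti u}) = verts S"
proof
  show "verts (star S {u}) \<union> verts (star S {anti u}) \<subseteq> verts S"
    unfolding verts_def star_def by blast
  show "verts S \<subseteq> verts (star S {u}) \<union> verts (star S {anti u})"
  proof
    fix x assume xS: "x \<in> verts S"
    then have x: "x < 2 * b" unfolding vS by simp
    obtain F where "F \<in> S" "x \<in> F" using xS unfolding verts_def by blast
    then have sx: "{x} \<in> S" using complex_subset[OF cS, of F "{x}"] by simp
    have mem: "x \<in> verts (star S {t})" if "{t, x} \<in> S" for t
    proof -
      have "{x} \<union> {t} \<in> S" using that by (simp add: insert_commute)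
      then have "{x} \<in> star S {t}" using sx unfolding star_def by blast
      then show ?thesis unfolding verts_def by blast
    qed
    show "x \<in> verts (star S {u}) \<union> verts (star S {anti u})"
    proof (cases "even x")
      case True
      then show ?thesis using mem[of u] assms[OF True x] by blast
    next
      case False
      have "{u, anti x} \<in> B" using False x by (intro assms) auto
      then have "anti ` {anti u, x} \<in> B" by simp
      then have "{anti u, x} \<in> A" by (simp only: map_anti_iff)
      then show ?thesis using mem[of "anti u"] by blast
    qed
  qed
qed

end

section \<open>The tower of spheres\<close>

text \<open>The number of antipodal pairs. In the recursion, \<open>half k\<close> counts the
  replacements of negative vertices and \<open>2\<close> the apices \<open>v\<close> and
  \<open>w\<close>, each of them starting a new pair.\<close>

fun half :: "nat \<Rightarrow> nat" where
  "half 0 = 0"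
| "half (Suc 0) = 1"
| "half (Suc (Suc k)) = half k + half (Suc k) + 2"

text \<open>\<open>tower k\<close> is the pair \<open>(B\<^sub>k, S\<^sub>k\<^sub>-\<^sub>1)\<close>, with \<open>S\<^sub>-\<^sub>1 = {\<emptyset>}\<close>; the sphere \<open>S\<^sub>k\<^sub>-\<^sub>1\<close> has \<open>2 * half k\<close> vertices.\<close>

primrec tower :: "nat \<Rightarrow> nat set set \<times> nat set set" where
  "tower 0 = (Pow {0}, {{}})"
| "tower (Suc k) = (next_ball (half k) (half (Suc k)) (fst (tower k)) (snd (tower k)),
     fst (tower k) \<union> map_complex anti (fst (tower k)))"

abbreviation tower_ball where "tower_ball k \<equiv> fst (tower k)"
abbreviation tower_sphere where "tower_sphere k \<equiv> snd (tower k)"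

lemma step_0: "step 0 1 0 (Pow {0}) {{}}"
proof
  have S: "Pow {0} \<union> map_complex anti (Pow {0}) = {{}, {0}, {1}}"
    by (auto simp: map_complex_def anti_def Pow_insert)
  show "{x, anti y} \<notin> Pow {0} \<union> map_complex anti (Pow {0})" if "{x, y} \<in> Pow {0} \<union> map_complex anti (Pow {0})" for x y
  proof -
    \<comment> \<open>The sphere consists of two isolated vertices, so its only edges are
      degenerate.\<close>
    have "x = y" using that unfolding S by (auto simp: doubleton_eq_iff)
    then have "card {x, anti y} = 2" using anti_neq[of y, symmetric] by simp
    moreover have "\<forall>F\<in>{{}, {0}, {1::nat}}. card F \<noteq> 2" by simp
    ultimately show ?thesis unfolding S by blast
  qed
  have n0: "nbrs (Pow {0}) {} = {0::nat}" by (auto simp: nbrs_def)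
  show "pseudomanifold (Suc 0) (Pow {0::nat}) {{}}"
  proof (rule pseudomanifoldI)
    fix F :: "nat set" assume "F \<in> Pow {0}"
    then show "\<exists>H\<in>Pow {0}. F \<subseteq> H \<and> card H = Suc 0" by (intro bexI[of _ "{0}"]) auto
  next
    fix G :: "nat set" assume "G \<in> Pow {0}" "Suc (card G) = Suc 0"
    then have "G = {}" using finite_subset[of G "{0}"] by auto
    then show "card (nbrs (Pow {0}) G) = (if G \<in> {{}} then 1 else 2)" using n0 by simp
  qed
  show "pseudomanifold 0 {{}} ({} :: nat set set)"
    by (rule pseudomanifoldI) auto
  show "pl_equiv {{}} (Pow {0}) (cone_over c {{}})" for c :: nat
  proof -
    have "cone_over c {{}} = Pow {c}" by (auto simp: cone_over_def)
    then show ?thesis using pl_equiv_Pow(1)[of "{0}" "{c}"] by simp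
  qed
  show "verts (Pow {0::nat}) = {..<2 * 0} \<union> {x. even x \<and> x < 2 * 1}"
    by (auto simp: less_2_cases_iff)
  show "abstract_complex (Pow {0::nat})" by (rule complex_Pow) simp
  show "sphere_complex 0 {{}}" by (rule sphere_complex_empty)
qed (auto simp: verts_def map_complex_def)

lemma step_tower: "step (half k) (half (Suc k)) k (tower_ball k) (tower_sphere k)"
proof (induction k)
  case 0
  show ?case using step_0 by simp
next
  case (Suc k)
  then show ?case using step.step_N[OF Suc] by simp
qed

lemma half_less: "half k < half (Suc k)"
  by (cases k) auto

lemma apex_tower:
  assumes "even x" "x < 2 * half (Suc k)"
  shows "{2 * half k, x} \<in> tower_ball k"
proof (cases k)
  case 0
  then show ?thesis using assms by (auto simp: less_2_cases_iff)
next
  case (Suc j)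
  then show ?thesis using step.apex_edge[OF step_tower[of j], of x] assms by simp
qed

lemma ball_even_faces_tower: "ball_complex k (even_faces (tower_ball k))"
proof (cases k)
  case 0
  have "even_faces (Pow {0}) = Pow {0}" by (auto simp: even_faces_def)
  then show ?thesis using 0 ball_complex_Pow[of "{0}" 0] by simp
next
  case (Suc j)
  then show ?thesis using step.ball_even_faces_N[OF step_tower[of j]] by simp
qed

definition tower_disk :: "nat \<Rightarrow> nat set set" where
  "tower_disk k = {F \<in> tower_ball k. \<forall>x\<in>F. 2 * half k \<le> x}"

lemma ball_tower_disk: "ball_complex k (tower_disk k)"
proof (cases k)
  case 0
  have "tower_disk 0 = Pow {0}" by (auto simp: tower_disk_def)
  then show ?thesis using 0 ball_complex_Pow[of "{0}" 0] by simp
next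
  case (Suc j)
  interpret step "half j" "half (Suc j)" j "tower_ball j" "tower_sphere j" by (rule step_tower)
  \<comment> \<open>The new faces at level \<open>Suc j\<close> depend on the positive faces of
    \<open>tower_sphere j\<close>, which are those of the ball two levels below.\<close>
  have "j = 0 \<or> ball_complex (j - 1) (even_faces (tower_sphere j))"
  proof (cases j)
    case (Suc i)
    have "even_faces (tower_sphere j) = even_faces (tower_ball i)"
      using step.even_faces_S[OF step_tower[of i]] Suc by simp
    then show ?thesis using ball_even_faces_tower[of i] Suc by simp
  qed simp
  then have "ball_complex (Suc j) {F \<in> N. \<forall>x\<in>F. 2 * half (Suc j) \<le> x}"
    by (rule ball_new_faces_N) simp
  then show ?thesis using Suc by (simp add: tower_disk_def)
qed

lemma property_P_tower:
  "property_P i (tower_sphere (Suc i)) anti (\<lambda>j. tower_sphere (Suc j)) tower_ball tower_disk (\<lambda>j. 2 * half j)"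
proof -
  have sphere: "pl_sphere j (tower_sphere (Suc j))" for j
    using step.sphS[OF step_tower[of j]] sphere_complex_imp_pl_sphere by simp
  have sub: "tower_sphere (Suc j) \<subset> tower_sphere (Suc (Suc j))" for j
  proof -
    have "tower_sphere (Suc j) \<subseteq> tower_sphere (Suc (Suc j))"
      using step.TB[OF step_tower[of "Suc j"]] by auto
    moreover have "verts (tower_sphere (Suc j)) \<noteq> verts (tower_sphere (Suc (Suc j)))"
      unfolding step.vT[OF step_tower] using half_less[of "Suc j"] by simp
    ultimately show ?thesis by (metis psubsetI)
  qed
  have level: "pl_ball j (tower_ball j) \<and> tower_ball j \<subseteq> tower_sphere (Suc j) \<and>
        pl_ball j (tower_disk j) \<and> tower_disk j \<subseteq> tower_sphere (Suc j) \<and> 2 * half j \<in> verts (tower_disk j) \<and>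
        tower_sphere (Suc j) = tower_ball j \<union> map_complex anti (tower_ball j) \<and>
        tower_ball j \<inter> map_complex anti (tower_ball j) = boundary j (tower_ball j) \<and>
        boundary j (tower_ball j) = tower_sphere j \<and>
        delete (tower_sphere (Suc j)) (tower_sphere j) = tower_disk j \<union> map_complex anti (tower_disk j) \<and>
        verts (tower_disk j) \<inter> verts (map_complex anti (tower_disk j)) = {} \<and>
        verts (star (tower_sphere (Suc j)) {2 * half j}) \<union> verts (star (tower_sphere (Suc j)) {anti (2 * half j)}) =
          verts (tower_sphere (Suc j))" for j
  proof -
    interpret step "half j" "half (Suc j)" j "tower_ball j" "tower_sphere j" by (rule step_tower)
    have S: "tower_sphere (Suc j) = S" by simp
    have disk: "tower_disk j = D" by (simp add: tower_disk_def)
    have "{2 * half j} \<in> D"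
      using apex_tower[of "2 * half j" j] half_less[of j] by simp
    then have "2 * half j \<in> verts D" unfolding verts_def by blast
    moreover have "verts (star S {2 * half j}) \<union> verts (star S {anti (2 * half j)}) = verts S"
      by (rule star_cover) (rule apex_tower)
    moreover have "pl_ball j D" using ball_tower_disk[of j] ball_complex_imp_pl_ball unfolding disk by blast
    moreover have "D \<subseteq> S" by blast
    ultimately show ?thesis
      unfolding S disk boundary_B
      using ball_complex_imp_pl_ball[OF ball_B] BA delete_S disjoint_D by blast
  qed
  have sym: "map_complex anti (tower_sphere (Suc j)) = tower_sphere (Suc j)" for j
    by (rule step.anti_T[OF step_tower])
  \<comment> \<open>Index shift: the sphere of dimension \<open>j\<close> is
    \<open>tower_sphere (Suc j)\<close>, so the boundary of the ball at level \<open>j\<close>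
    appears as \<open>tower_sphere (Suc (j - 1))\<close>, which for positive \<open>j\<close> is
    \<open>tower_sphere j\<close>.\<close>
  have pred: "j \<in> {1..i} \<Longrightarrow> Suc (j - 1) = j" for j by simp
  show ?thesis
    unfolding property_P_def
  proof (intro conjI)
    show "pl_sphere i (tower_sphere (Suc i))" by (rule sphere)
    show "centrally_symmetric (tower_sphere (Suc i)) anti"
      using step.centrally_symmetric_S[OF step_tower[of i]] by simp
    show "tower_sphere (Suc i) = tower_sphere (Suc i)" ..
    show "\<forall>j<i. tower_sphere (Suc j) \<subset> tower_sphere (Suc (Suc j))" using sub by blast
    show "\<forall>j\<le>i. pl_sphere j (tower_sphere (Suc j)) \<and> map_complex anti (tower_sphere (Suc j)) = tower_sphere (Suc j)"
      using sphere sym by blast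
    show "2 * half 0 \<in> verts (tower_sphere (Suc 0))" unfolding step.vT[OF step_tower] by simp
    show "tower_disk 0 = {{}, {2 * half 0}}" by (auto simp: tower_disk_def)
  qed (rule ballI, simp only: pred, rule level)
qed

theorem theorem4p4:
  shows "\<exists>(S :: nat \<Rightarrow> nat set set) (\<sigma> :: nat \<Rightarrow> nat \<Rightarrow> nat)
            (B :: nat \<Rightarrow> nat set set) (D :: nat \<Rightarrow> nat set set) (v :: nat \<Rightarrow> nat).
           (\<forall>i. pl_sphere i (S i) \<and> centrally_symmetric (S i) (\<sigma> i)) \<and>
           (\<forall>i. S i \<subset> S (i + 1) \<and> (\<forall>x\<in>verts (S i). \<sigma> (i + 1) x = \<sigma> i x)) \<and>
           (\<forall>i. property_P i (S i) (\<sigma> i) S B D v) \<and>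
           (\<forall>i\<ge>1. boundary i (B i) = S (i - 1)) \<and>
           (\<forall>i. \<not> has_induced_cs_4_cycle (S i) (\<sigma> i)) \<and>
           (\<forall>i\<ge>1. f0 (S (i + 1)) = f0 (S i) + f0 (S (i - 1)) + 4)"
proof -
  let ?S = "\<lambda>i. tower_sphere (Suc i)"
  have P: "property_P i (?S i) anti ?S tower_ball tower_disk (\<lambda>j. 2 * half j)" for i
    by (rule property_P_tower)
  have sphere: "pl_sphere i (?S i)" and symmetric: "centrally_symmetric (?S i) anti" for i
    using P[of i] unfolding property_P_def by blast+
  have sub: "?S i \<subset> ?S (i + 1)" for i
    using P[of "Suc i"] unfolding property_P_def by simp
  have bd: "boundary i (tower_ball i) = ?S (i - 1)" if "i \<ge> 1" for i
    using step.boundary_B[OF step_tower[of i]] that by simp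
  have cycle: "\<not> has_induced_cs_4_cycle (?S i) anti" for i
    using step.no_induced_4_cycle[OF step_tower[of i]] by simp
  have f0: "f0 (?S i) = 2 * half (Suc i)" for i
    using step.f0_S[OF step_tower[of i]] by simp
  have count: "f0 (?S (i + 1)) = f0 (?S i) + f0 (?S (i - 1)) + 4" if "i \<ge> 1" for i
  proof -
    obtain j where "i = Suc j" using \<open>i \<ge> 1\<close> by (cases i) auto
    \<comment> \<open>Each pair has two vertices, so the summand \<open>2\<close> in the recursion
      of \<open>half\<close> becomes \<open>4\<close>.\<close>
    then show ?thesis unfolding f0 by simp
  qed
  show ?thesis
    by (rule exI[of _ ?S], rule exI[of _ "\<lambda>_. anti"], rule exI[of _ tower_ball],
        rule exI[of _ tower_disk], rule exI[of _ "\<lambda>j. 2 * half j"], intro conjI allI impI ballI)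
      (rule sphere symmetric sub refl P bd cycle count | assumption)+
qed

end
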